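(* Let $\eta\in L^\infty_+(\Omega)$. For any $0<T<+\infty$, if $\{f_k\}_{k\in\mathbb{N}}$ is a countable Fourier basis of $L^2(0,T)$, then the set $\{f_k(t)\,\mathbf j_n(x)\}_{k,n\in\mathbb{N}}$ forms a complete basis of $L^2(0,T;H_L(\Omega))$.
   Context: $\Omega\subset\mathbb{R}^3$ is an open bounded domain with Lipschitz boundary and outer unit normal $\hat{\mathbf n}$. $\langle \mathbf u,\mathbf v\rangle=\int_\Omega \mathbf u\cdot\mathbf v\,\mathrm dV$ is the $L^2(\Omega;\mathbb{R}^3)$ inner product. $L^\infty_+(\Omega)$ is the set of $\theta\in L^\infty(\Omega)$ such that $\theta\ge c_0$ a.e. in $\Omega$ for some constant $c_0>0$. $H_L(\Omega)$ is the space of $\mathbf v\in L^2(\Omega;\mathbb{R}^3)$ with $\operatorname{div}\mathbf v=0$ in $\Omega$ and $\mathbf v\cdot\hat{\mathbf n}=0$ on $\partial\Omega$ (normal trace in the weak sense), and $L^2(0,T;H_L(\Omega))$ is the associated Bochner space. The operator $A:H_L(\Omega)\to L^2(\Omega;\mathbb{R}^3)$ is $(A\mathbf v)(x)=\frac{\mu_0}{4\pi}\int_\Omega\frac{\mathbf v(x')}{\|x-x'\|}\,\mathrm dV(x')$ with $\mu_0>0$ a constant; it is compact, self-adjoint and positive definite. For $\eta\in L^\infty_+(\Omega)$ put $\|\mathbf v\|_\eta=\sqrt{\langle \eta\mathbf v,\mathbf v\rangle}$. The functions $\mathbf j_n$, $n=1,2,\dots$, are defined inductively: $\mathbf j_n$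 is a chosen maximizer of $$\tau_n(\eta)=\max\{\langle A\mathbf j,\mathbf j\rangle : \mathbf j\in H_L^n(\Omega),\ \|\mathbf j\|_\eta=1\},$$ where $H_L^1(\Omega)=H_L(\Omega)$ and $H_L^n(\Omega)=\{\mathbf v\in H_L(\Omega): \langle \mathbf v,\eta\mathbf j_1\rangle=\dots=\langle\mathbf v,\eta\mathbf j_{n-1}\rangle=0\}$ for $n\ge2$. The space $L^2(0,T;H_L(\Omega))$ is equipped with the weighted inner product $\langle\langle\mathbf u,\mathbf v\rangle\rangle_\eta=\int_0^T\int_\Omega\eta(x)\,\mathbf u(x,t)\cdot\mathbf v(x,t)\,\mathrm dV\,\mathrm dt$ (whose norm is equivalent to the usual one). A Fourier basis of $L^2(0,T)$ is a complete orthogonal system of nonzero functions. A "complete basis" of $L^2(0,T;H_L(\Omega))$ means an orthogonal system (for $\langle\langle\cdot,\cdot\rangle\rangle_\eta$) whose linear span is dense, so that every element is the sum of its Fourier series in the system. *)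

theory Defs
  imports "HOL-Analysis.Analysis"
begin

type_synonym R3 = "real ^ 3"

text \<open>Near each boundary point the domain is, after a rigid rotation of the coordinate axes,
  the set of points lying strictly below the graph of a Lipschitz function of two variables.\<close>

definition lipschitz_boundary :: "R3 set \<Rightarrow> bool" where
  "lipschitz_boundary \<Omega> \<longleftrightarrow>
     (\<forall>p\<in>frontier \<Omega>. \<exists>r>0. \<exists>R :: R3 \<Rightarrow> R3. \<exists>\<gamma> :: real ^ 2 \<Rightarrow> real. \<exists>L.
        orthogonal_transformation R \<and> L-lipschitz_on UNIV \<gamma> \<and>
        \<Omega> \<inter> ball p r = {x \<in> ball p r. R x $ 3 < \<gamma> (vector [R x $ 1, R x $ 2])})"

definition bounded_lipschitz_domain :: "R3 set \<Rightarrow> bool" where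
  "bounded_lipschitz_domain \<Omega> \<longleftrightarrow>
     open \<Omega> \<and> connected \<Omega> \<and> \<Omega> \<noteq> {} \<and> bounded \<Omega> \<and> lipschitz_boundary \<Omega>"

text \<open>Elements of Lebesgue spaces are represented by functions rather than by classes modulo
  almost everywhere equality; norms and inner products are therefore only semidefinite.\<close>

definition L2 :: "'a::euclidean_space set \<Rightarrow> ('a \<Rightarrow> 'b::euclidean_space) set" where
  "L2 S = {v. v \<in> borel_measurable (lebesgue_on S) \<and>
              integrable (lebesgue_on S) (\<lambda>x. (norm (v x))\<^sup>2)}"

definition L2_inner ::
    "'a::euclidean_space set \<Rightarrow> ('a \<Rightarrow> 'b::euclidean_space) \<Rightarrow> ('a \<Rightarrow> 'b) \<Rightarrow> real" where
  "L2_inner S u v = (LINT x|lebesgue_on S. u x \<bullet> v x)"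

definition L2_norm :: "'a::euclidean_space set \<Rightarrow> ('a \<Rightarrow> 'b::euclidean_space) \<Rightarrow> real" where
  "L2_norm S v = sqrt (L2_inner S v v)"

definition Linf_plus :: "R3 set \<Rightarrow> (R3 \<Rightarrow> real) set" where
  "Linf_plus \<Omega> = {\<theta>. \<theta> \<in> borel_measurable (lebesgue_on \<Omega>) \<and>
      (\<exists>C. AE x in lebesgue_on \<Omega>. \<bar>\<theta> x\<bar> \<le> C) \<and>
      (\<exists>c\<^sub>0>0. AE x in lebesgue_on \<Omega>. c\<^sub>0 \<le> \<theta> x)}"

definition partial :: "3 \<Rightarrow> (R3 \<Rightarrow> real) \<Rightarrow> R3 \<Rightarrow> real" where
  "partial i \<phi> x = frechet_derivative \<phi> (at x) (axis i 1)"

definition grad :: "(R3 \<Rightarrow> real) \<Rightarrow> R3 \<Rightarrow> R3" where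
  "grad \<phi> x = (\<chi> i. partial i \<phi> x)"

fun C_k :: "nat \<Rightarrow> (R3 \<Rightarrow> real) \<Rightarrow> bool" where
  "C_k 0 \<phi> \<longleftrightarrow> continuous_on UNIV \<phi>"
| "C_k (Suc k) \<phi> \<longleftrightarrow> \<phi> differentiable_on UNIV \<and> (\<forall>i. C_k k (partial i \<phi>))"

definition test_functions :: "R3 set \<Rightarrow> (R3 \<Rightarrow> real) set" where
  "test_functions \<Omega> = {\<phi>. (\<forall>k. C_k k \<phi>) \<and>
      compact (closure {x. \<phi> x \<noteq> 0}) \<and> closure {x. \<phi> x \<noteq> 0} \<subseteq> \<Omega>}"

definition has_weak_grad :: "R3 set \<Rightarrow> (R3 \<Rightarrow> real) \<Rightarrow> (R3 \<Rightarrow> R3) \<Rightarrow> bool" where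
  "has_weak_grad \<Omega> \<phi> g \<longleftrightarrow>
     (\<forall>\<psi>\<in>test_functions \<Omega>.
        (LINT x|lebesgue_on \<Omega>. \<phi> x *\<^sub>R grad \<psi> x) = - (LINT x|lebesgue_on \<Omega>. \<psi> x *\<^sub>R g x))"

definition has_weak_div :: "R3 set \<Rightarrow> (R3 \<Rightarrow> R3) \<Rightarrow> (R3 \<Rightarrow> real) \<Rightarrow> bool" where
  "has_weak_div \<Omega> v d \<longleftrightarrow>
     (\<forall>\<psi>\<in>test_functions \<Omega>.
        (LINT x|lebesgue_on \<Omega>. v x \<bullet> grad \<psi> x) = - (LINT x|lebesgue_on \<Omega>. d x * \<psi> x))"

text \<open>The weak normal trace of a field \<open>v\<close> with divergence \<open>d\<close> is the functional sending the
  boundary trace of \<open>\<phi>\<close>, for \<open>\<phi>\<close> in \<open>H\<^sup>1(\<Omega>)\<close> with weak gradient \<open>g\<close>, to the integral of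
  \<open>v \<bullet> g + d \<phi>\<close> (Green's formula).\<close>

definition normal_trace_zero :: "R3 set \<Rightarrow> (R3 \<Rightarrow> R3) \<Rightarrow> (R3 \<Rightarrow> real) \<Rightarrow> bool" where
  "normal_trace_zero \<Omega> v d \<longleftrightarrow>
     (\<forall>\<phi>\<in>L2 \<Omega>. \<forall>g\<in>L2 \<Omega>. has_weak_grad \<Omega> \<phi> g \<longrightarrow>
        (LINT x|lebesgue_on \<Omega>. v x \<bullet> g x + d x * \<phi> x) = 0)"

definition H_L :: "R3 set \<Rightarrow> (R3 \<Rightarrow> R3) set" where
  "H_L \<Omega> = {v \<in> L2 \<Omega>. has_weak_div \<Omega> v (\<lambda>_. 0) \<and> normal_trace_zero \<Omega> v (\<lambda>_. 0)}"

definition A_op :: "real \<Rightarrow> R3 set \<Rightarrow> (R3 \<Rightarrow> R3) \<Rightarrow> R3 \<Rightarrow> R3" where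
  "A_op \<mu>\<^sub>0 \<Omega> v x = (\<mu>\<^sub>0 / (4 * pi)) *\<^sub>R (LINT x'|lebesgue_on \<Omega>. (1 / norm (x - x')) *\<^sub>R v x')"

definition eta_norm :: "R3 set \<Rightarrow> (R3 \<Rightarrow> real) \<Rightarrow> (R3 \<Rightarrow> R3) \<Rightarrow> real" where
  "eta_norm \<Omega> \<eta> v = sqrt (L2_inner \<Omega> (\<lambda>x. \<eta> x *\<^sub>R v x) v)"

definition H_L_n :: "R3 set \<Rightarrow> (R3 \<Rightarrow> real) \<Rightarrow> (nat \<Rightarrow> R3 \<Rightarrow> R3) \<Rightarrow> nat \<Rightarrow> (R3 \<Rightarrow> R3) set" where
  "H_L_n \<Omega> \<eta> j n = {v \<in> H_L \<Omega>. \<forall>m\<in>{1..<n}. L2_inner \<Omega> v (\<lambda>x. \<eta> x *\<^sub>R j m x) = 0}"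

definition successive_maximizers ::
    "real \<Rightarrow> R3 set \<Rightarrow> (R3 \<Rightarrow> real) \<Rightarrow> (nat \<Rightarrow> R3 \<Rightarrow> R3) \<Rightarrow> bool" where
  "successive_maximizers \<mu>\<^sub>0 \<Omega> \<eta> j \<longleftrightarrow>
     (\<forall>n\<ge>1. is_arg_max (\<lambda>v. L2_inner \<Omega> (A_op \<mu>\<^sub>0 \<Omega> v) v)
                (\<lambda>v. v \<in> H_L_n \<Omega> \<eta> j n \<and> eta_norm \<Omega> \<eta> v = 1) (j n))"

definition simple_into :: "real \<Rightarrow> (R3 \<Rightarrow> R3) set \<Rightarrow> (real \<Rightarrow> R3 \<Rightarrow> R3) \<Rightarrow> bool" where
  "simple_into T X s \<longleftrightarrow>
     finite (s ` {0<..<T}) \<and> s ` {0<..<T} \<subseteq> X \<and>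
     (\<forall>w. {t\<in>{0<..<T}. s t = w} \<in> sets lebesgue)"

definition strongly_measurable_into ::
    "real \<Rightarrow> R3 set \<Rightarrow> (R3 \<Rightarrow> R3) set \<Rightarrow> (real \<Rightarrow> R3 \<Rightarrow> R3) \<Rightarrow> bool" where
  "strongly_measurable_into T \<Omega> X u \<longleftrightarrow>
     (AE t in lebesgue_on {0<..<T}. u t \<in> X) \<and>
     (\<exists>s. (\<forall>m::nat. simple_into T X (s m)) \<and>
          (AE t in lebesgue_on {0<..<T}.
             (\<lambda>m. L2_norm \<Omega> (\<lambda>x. s m t x - u t x)) \<longlonglongrightarrow> 0))"

text \<open>An element of \<open>L\<^sup>2(0,T;H\<^sub>L(\<Omega>))\<close> is written as a function of the pair \<open>(t, x)\<close>, but
  measurability is that of the \<open>L\<^sup>2(\<Omega>)\<close>-valued map \<open>t \<mapsto> u(t, \<cdot>)\<close>, as in the definition of the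
  Bochner integral; joint measurability in \<open>(t, x)\<close> is not required.\<close>

definition bochner_L2_H_L :: "real \<Rightarrow> R3 set \<Rightarrow> (real \<times> R3 \<Rightarrow> R3) set" where
  "bochner_L2_H_L T \<Omega> = {u. strongly_measurable_into T \<Omega> (H_L \<Omega>) (curry u) \<and>
      integrable (lebesgue_on {0<..<T}) (\<lambda>t. (L2_norm \<Omega> (curry u t))\<^sup>2)}"

definition bochner_eta_inner ::
    "real \<Rightarrow> R3 set \<Rightarrow> (R3 \<Rightarrow> real) \<Rightarrow> (real \<times> R3 \<Rightarrow> R3) \<Rightarrow> (real \<times> R3 \<Rightarrow> R3) \<Rightarrow> real" where
  "bochner_eta_inner T \<Omega> \<eta> u v =
     (LINT t|lebesgue_on {0<..<T}. LINT x|lebesgue_on \<Omega>. \<eta> x * (u (t, x) \<bullet> v (t, x)))"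

text \<open>Here \<open>V\<close> is a linear space of functions with a semidefinite inner product \<open>ip\<close>.\<close>

definition ip_norm :: "(('a \<Rightarrow> 'b) \<Rightarrow> ('a \<Rightarrow> 'b) \<Rightarrow> real) \<Rightarrow> ('a \<Rightarrow> 'b) \<Rightarrow> real" where
  "ip_norm ip u = sqrt (ip u u)"

definition complete_orthogonal_system ::
    "('a \<Rightarrow> 'b::real_vector) set \<Rightarrow> (('a \<Rightarrow> 'b) \<Rightarrow> ('a \<Rightarrow> 'b) \<Rightarrow> real) \<Rightarrow>
     'i set \<Rightarrow> ('i \<Rightarrow> 'a \<Rightarrow> 'b) \<Rightarrow> bool" where
  "complete_orthogonal_system V ip I e \<longleftrightarrow>
     (\<forall>i\<in>I. e i \<in> V \<and> ip_norm ip (e i) \<noteq> 0) \<and>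
     (\<forall>i\<in>I. \<forall>k\<in>I. i \<noteq> k \<longrightarrow> ip (e i) (e k) = 0) \<and>
     (\<forall>u\<in>V. \<forall>\<epsilon>>0. \<exists>F c. finite F \<and> F \<subseteq> I \<and>
        ip_norm ip (\<lambda>x. u x - (\<Sum>i\<in>F. c i *\<^sub>R e i x)) < \<epsilon>)"

definition sum_of_fourier_series ::
    "(('a \<Rightarrow> 'b::real_vector) \<Rightarrow> ('a \<Rightarrow> 'b) \<Rightarrow> real) \<Rightarrow> 'i set \<Rightarrow> ('i \<Rightarrow> 'a \<Rightarrow> 'b) \<Rightarrow>
     ('a \<Rightarrow> 'b) \<Rightarrow> bool" where
  "sum_of_fourier_series ip I e u \<longleftrightarrow>
     ((\<lambda>F. ip_norm ip (\<lambda>x. u x - (\<Sum>i\<in>F. (ip u (e i) / ip (e i) (e i)) *\<^sub>R e i x)))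
        \<longlongrightarrow> 0) (finite_subsets_at_top I)"

definition complete_basis ::
    "('a \<Rightarrow> 'b::real_vector) set \<Rightarrow> (('a \<Rightarrow> 'b) \<Rightarrow> ('a \<Rightarrow> 'b) \<Rightarrow> real) \<Rightarrow>
     'i set \<Rightarrow> ('i \<Rightarrow> 'a \<Rightarrow> 'b) \<Rightarrow> bool" where
  "complete_basis V ip I e \<longleftrightarrow>
     complete_orthogonal_system V ip I e \<and> (\<forall>u\<in>V. sum_of_fourier_series ip I e u)"

definition fourier_basis :: "real \<Rightarrow> (nat \<Rightarrow> real \<Rightarrow> real) \<Rightarrow> bool" where
  "fourier_basis T f \<longleftrightarrow>
     complete_orthogonal_system (L2 {0<..<T}) (L2_inner {0<..<T}) {1..} f"

end

theory Submission
  imports Defs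
begin

text \<open>By construction the \<open>j n\<close> are \<open>\<eta>\<close>-orthonormal. The Newton kernel is square integrable
  uniformly in its pole, so Bessel's inequality gives \<open>A (j n) \<longlonglongrightarrow> 0\<close> pointwise and boundedly, and
  the energies \<open>\<langle>A (j n), j n\<rangle>\<close> tend to \<open>0\<close>. A field of \<open>H_L\<close> of unit norm that is orthogonal to all
  \<open>j n\<close> competes in every maximum, hence has energy at most \<open>0\<close>. The Fefferman--de la Llave formula
  \<open>\<kappa> / |x - y| = \<integral>\<^sub>0\<^sup>\<infinity> |B(x,r) \<inter> B(y,r)| r\<^bsup>-5\<^esup> dr\<close> turns the energy of \<open>w\<close> into the
  integral over \<open>(z, r)\<close> of \<open>|\<integral>\<^bsub>B(z,r)\<^esub> w|\<^sup>2 r\<^bsup>-5\<^esup>\<close>, so that nonpositive energy forces \<open>w\<close> to have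
  integral \<open>0\<close> over almost all balls, hence to vanish. With the completeness of \<open>L2\<close> this makes
  the \<open>j n\<close> complete in \<open>H_L\<close>. A field depending on time is expanded slicewise in the \<open>j n\<close>, and
  its coefficients, which lie in \<open>L\<^sup>2(0,T)\<close>, in the Fourier basis.\<close>

section \<open>Semidefinite inner product spaces of functions\<close>

text \<open>Two obstacles shape the development. Functions are not identified almost everywhere, so
  a vanishing norm does not make a function zero; all Hilbert space arguments are carried out for
  semidefinite forms and end in statements about norms. And a field in the Bochner space need not be
  jointly measurable in \<open>(t, x)\<close>, which excludes Fubini in these two variables: time
  enters only through scalar functions such as the coefficient of \<open>u(t)\<close> along
  \<open>j n\<close>, measurable as limits of simple functions. Decay of the energies takes the
  place of the spectral theorem for compact operators, and the ball formula supplies strict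
  positivity of A. The exponent 5 in it is fixed by scaling in dimension 3: for r = d s with d = |x
  - y| the volume contributes d^3, the weight d^(-5) and dr one more d, in total 1 / d. The formula
  is useful because a product of two ball indicators separates x from y, so that for fixed (z, r)
  the double integral over x and y is a square.\<close>

locale semi_inner_space =
  fixes V :: "('a \<Rightarrow> 'b::real_vector) set" and ip :: "('a \<Rightarrow> 'b) \<Rightarrow> ('a \<Rightarrow> 'b) \<Rightarrow> real"
  assumes zero_mem: "(\<lambda>x. 0) \<in> V"
    and add_mem: "u \<in> V \<Longrightarrow> v \<in> V \<Longrightarrow> (\<lambda>x. u x + v x) \<in> V"
    and scale_mem: "u \<in> V \<Longrightarrow> (\<lambda>x. c *\<^sub>R u x) \<in> V"
    and ip_commute: "u \<in> V \<Longrightarrow> v \<in> V \<Longrightarrow> ip u v = ip v u"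
    and ip_add: "u \<in> V \<Longrightarrow> v \<in> V \<Longrightarrow> w \<in> V \<Longrightarrow> ip (\<lambda>x. u x + v x) w = ip u w + ip v w"
    and ip_scale: "u \<in> V \<Longrightarrow> w \<in> V \<Longrightarrow> ip (\<lambda>x. c *\<^sub>R u x) w = c * ip u w"
    and ip_nonneg: "u \<in> V \<Longrightarrow> 0 \<le> ip u u"
begin

lemma diff_mem: "u \<in> V \<Longrightarrow> v \<in> V \<Longrightarrow> (\<lambda>x. u x - v x) \<in> V"
  using add_mem[of u "\<lambda>x. (-1) *\<^sub>R v x"] scale_mem[of v "-1"] by simp

lemma ip_diff: "u \<in> V \<Longrightarrow> v \<in> V \<Longrightarrow> w \<in> V \<Longrightarrow> ip (\<lambda>x. u x - v x) w = ip u w - ip v w"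
  using ip_add[of u "\<lambda>x. (-1) *\<^sub>R v x" w] scale_mem[of v "-1"] ip_scale[of v w "-1"] by simp

lemma ip_diff_right: "u \<in> V \<Longrightarrow> v \<in> V \<Longrightarrow> w \<in> V \<Longrightarrow> ip w (\<lambda>x. u x - v x) = ip w u - ip w v"
  using ip_diff[of u v w] by (simp add: ip_commute diff_mem)

lemma ip_add_right: "u \<in> V \<Longrightarrow> v \<in> V \<Longrightarrow> w \<in> V \<Longrightarrow> ip w (\<lambda>x. u x + v x) = ip w u + ip w v"
  using ip_add[of u v w] by (simp add: ip_commute add_mem)

lemma ip_scale_right: "u \<in> V \<Longrightarrow> w \<in> V \<Longrightarrow> ip w (\<lambda>x. c *\<^sub>R u x) = c * ip w u"
  using ip_scale[of u w c] by (simp add: ip_commute scale_mem)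

lemma ip_zero: "w \<in> V \<Longrightarrow> ip (\<lambda>x. 0) w = 0"
  using ip_scale[of "\<lambda>x. 0" w 0] zero_mem by simp

lemma sum_mem:
  assumes "\<And>i. i \<in> F \<Longrightarrow> e i \<in> V"
  shows "(\<lambda>x. \<Sum>i\<in>F. c i *\<^sub>R e i x) \<in> V"
  using assms
proof (induction F rule: infinite_finite_induct)
  case (insert i F)
  then show ?case using add_mem[of "\<lambda>x. c i *\<^sub>R e i x" "\<lambda>x. \<Sum>i\<in>F. c i *\<^sub>R e i x"] scale_mem by simp
qed (simp_all add: zero_mem)

lemma ip_sum:
  assumes "\<And>i. i \<in> F \<Longrightarrow> e i \<in> V" "w \<in> V"
  shows "ip (\<lambda>x. \<Sum>i\<in>F. c i *\<^sub>R e i x) w = (\<Sum>i\<in>F. c i * ip (e i) w)"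
  using assms(1)
proof (induction F rule: infinite_finite_induct)
  case (insert i F)
  then show ?case
    using ip_add[of "\<lambda>x. c i *\<^sub>R e i x" "\<lambda>x. \<Sum>i\<in>F. c i *\<^sub>R e i x" w]
      scale_mem[of "e i" "c i"] sum_mem[of F e c] ip_scale[of "e i" w "c i"] \<open>w \<in> V\<close> by simp
qed (simp_all add: ip_zero \<open>w \<in> V\<close>)

lemma ip_diff_self:
  assumes "u \<in> V" "v \<in> V"
  shows "ip (\<lambda>x. u x - v x) (\<lambda>x. u x - v x) = ip u u - 2 * ip u v + ip v v"
  using assms by (simp add: ip_diff ip_diff_right diff_mem ip_commute[of v u])

lemma ip_add_self:
  assumes "u \<in> V" "v \<in> V"
  shows "ip (\<lambda>x. u x + v x) (\<lambda>x. u x + v x) = ip u u + 2 * ip u v + ip v v"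
  using assms by (simp add: ip_add ip_add_right add_mem ip_commute[of v u])

text \<open>A quadratic polynomial that is nonnegative everywhere has nonpositive discriminant.
  Since \<open>ip u u\<close> may vanish for a nonzero \<open>u\<close>, the degenerate case, where
  the polynomial is affine and must have slope 0, needs its own argument.\<close>

lemma Cauchy_Schwarz_square:
  assumes "u \<in> V" "v \<in> V"
  shows "(ip u v)\<^sup>2 \<le> ip u u * ip v v"
proof -
  have "0 \<le> ip u u * t\<^sup>2 + 2 * t * ip u v + ip v v" for t
    using ip_nonneg[OF add_mem[OF scale_mem[OF assms(1), of t] assms(2)]]
      ip_add_self[OF scale_mem[OF assms(1), of t] assms(2)] assms
    by (simp add: ip_scale ip_scale_right scale_mem power2_eq_square algebra_simps)
  note q = this
  show ?thesis
  proof (cases "ip u u = 0")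
    case True
    have "ip u v = 0"
    proof (rule ccontr)
      assume "ip u v \<noteq> 0"
      \<comment> \<open>At this argument the affine function \<open>2 * t * ip u v + ip v v\<close>
        takes the value -1.\<close>
      then show False
        using q[of "- (ip v v + 1) / (2 * ip u v)"] True by (simp add: field_simps)
    qed
    then show ?thesis using True by simp
  next
    case False
    then have p: "ip u u > 0" using ip_nonneg[OF assms(1)] by simp
    have "0 \<le> ip u u * (- ip u v / ip u u)\<^sup>2 + 2 * (- ip u v / ip u u) * ip u v + ip v v"
      by (rule q)
    also have "\<dots> = ip v v - (ip u v)\<^sup>2 / ip u u"
      using p by (simp add: field_simps power2_eq_square)
    finally show ?thesis using p by (simp add: field_simps)
  qed
qed

lemma norm_power2: "u \<in> V \<Longrightarrow> (ip_norm ip u)\<^sup>2 = ip u u"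
  by (simp add: ip_norm_def ip_nonneg)

lemma Cauchy_Schwarz:
  assumes "u \<in> V" "v \<in> V"
  shows "\<bar>ip u v\<bar> \<le> ip_norm ip u * ip_norm ip v"
  using Cauchy_Schwarz_square[OF assms]
  by (metis ip_norm_def real_sqrt_abs real_sqrt_le_iff real_sqrt_mult)

lemma norm_triangle:
  assumes "u \<in> V" "v \<in> V"
  shows "ip_norm ip (\<lambda>x. u x + v x) \<le> ip_norm ip u + ip_norm ip v"
proof (rule power2_le_imp_le)
  show "(ip_norm ip (\<lambda>x. u x + v x))\<^sup>2 \<le> (ip_norm ip u + ip_norm ip v)\<^sup>2"
    using Cauchy_Schwarz[OF assms] assms
    by (simp add: norm_power2 add_mem ip_add_self power2_sum)
qed (simp add: ip_norm_def ip_nonneg assms)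

text \<open>With \<open>c\<close> the Fourier coefficients this is Bessel's identity; in general it says that the
  Fourier partial sum is the best approximation.\<close>

lemma residual_expansion:
  assumes F: "finite F" "\<And>i. i \<in> F \<Longrightarrow> e i \<in> V" "u \<in> V"
    and ne: "\<And>i. i \<in> F \<Longrightarrow> ip (e i) (e i) \<noteq> 0"
    and orth: "\<And>i k. i \<in> F \<Longrightarrow> k \<in> F \<Longrightarrow> i \<noteq> k \<Longrightarrow> ip (e i) (e k) = 0"
  defines "a \<equiv> \<lambda>i. ip u (e i) / ip (e i) (e i)"
  shows "ip (\<lambda>x. u x - (\<Sum>i\<in>F. c i *\<^sub>R e i x)) (\<lambda>x. u x - (\<Sum>i\<in>F. c i *\<^sub>R e i x))
       = ip u u - (\<Sum>i\<in>F. (a i)\<^sup>2 * ip (e i) (e i)) + (\<Sum>i\<in>F. (a i - c i)\<^sup>2 * ip (e i) (e i))"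
proof -
  let ?s = "\<lambda>x. \<Sum>i\<in>F. c i *\<^sub>R e i x"
  have s: "?s \<in> V" using F(2) by (rule sum_mem)
  have us: "ip u ?s = (\<Sum>i\<in>F. c i * ip u (e i))"
    using ip_sum[of F e u c] F s by (simp add: ip_commute[of u])
  have es: "ip (e i) ?s = c i * ip (e i) (e i)" if "i \<in> F" for i
  proof -
    have "ip (e i) ?s = (\<Sum>k\<in>F. c k * ip (e k) (e i))"
      using ip_sum[of F e "e i" c] F s that by (simp add: ip_commute[of "e i"])
    also have "\<dots> = (\<Sum>k\<in>F. if k = i then c i * ip (e i) (e i) else 0)"
      using orth that by (intro sum.cong) auto
    finally show ?thesis using F(1) that by simp
  qed
  have ss: "ip ?s ?s = (\<Sum>i\<in>F. (c i)\<^sup>2 * ip (e i) (e i))"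
    using ip_sum[of F e ?s c] F s es by (simp add: power2_eq_square mult.assoc)
  have "ip u u - 2 * ip u ?s + ip ?s ?s =
    ip u u - (\<Sum>i\<in>F. 2 * (c i * ip u (e i)) - (c i)\<^sup>2 * ip (e i) (e i))"
    by (simp add: us ss sum_subtractf sum_distrib_left)
  also have "(\<Sum>i\<in>F. 2 * (c i * ip u (e i)) - (c i)\<^sup>2 * ip (e i) (e i)) =
     (\<Sum>i\<in>F. (a i)\<^sup>2 * ip (e i) (e i) - (a i - c i)\<^sup>2 * ip (e i) (e i))"
    using ne by (intro sum.cong) (auto simp: a_def field_simps power2_eq_square)
  finally show ?thesis
    using ip_diff_self[OF F(3) s] by (simp add: sum_subtractf)
qed

lemma Bessel_identity:
  assumes "finite F" "\<And>i. i \<in> F \<Longrightarrow> e i \<in> V" "u \<in> V"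
    and "\<And>i. i \<in> F \<Longrightarrow> ip (e i) (e i) \<noteq> 0"
    and "\<And>i k. i \<in> F \<Longrightarrow> k \<in> F \<Longrightarrow> i \<noteq> k \<Longrightarrow> ip (e i) (e k) = 0"
  defines "a \<equiv> \<lambda>i. ip u (e i) / ip (e i) (e i)"
  shows "ip (\<lambda>x. u x - (\<Sum>i\<in>F. a i *\<^sub>R e i x)) (\<lambda>x. u x - (\<Sum>i\<in>F. a i *\<^sub>R e i x))
       = ip u u - (\<Sum>i\<in>F. (a i)\<^sup>2 * ip (e i) (e i))"
  using residual_expansion[OF assms(1-5), where c = a] by (simp add: a_def)

lemma Bessel_inequality:
  assumes "finite F" "\<And>i. i \<in> F \<Longrightarrow> e i \<in> V" "u \<in> V"
    and "\<And>i. i \<in> F \<Longrightarrow> ip (e i) (e i) \<noteq> 0"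
    and "\<And>i k. i \<in> F \<Longrightarrow> k \<in> F \<Longrightarrow> i \<noteq> k \<Longrightarrow> ip (e i) (e k) = 0"
  shows "(\<Sum>i\<in>F. (ip u (e i) / ip (e i) (e i))\<^sup>2 * ip (e i) (e i)) \<le> ip u u"
proof -
  have "(\<lambda>x. u x - (\<Sum>i\<in>F. (ip u (e i) / ip (e i) (e i)) *\<^sub>R e i x)) \<in> V"
    using assms by (intro diff_mem sum_mem)
  from ip_nonneg[OF this] Bessel_identity[of F e, OF assms(1-5)] show ?thesis by simp
qed

text \<open>Density alone suffices, without completeness of \<open>V\<close>: the Fourier partial
  sum over \<open>F\<close> beats every combination over \<open>F\<close>, in particular a good
  combination over a subset \<open>G\<close>. Hence the residual stays small for all finite
  \<open>F\<close> above \<open>G\<close>, which is unconditional convergence.\<close>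

lemma complete_basisI:
  assumes "complete_orthogonal_system V ip I e"
  shows "complete_basis V ip I e"
  unfolding complete_basis_def sum_of_fourier_series_def
proof (intro conjI ballI assms)
  fix u assume u: "u \<in> V"
  let ?a = "\<lambda>i. ip u (e i) / ip (e i) (e i)"
  let ?r = "\<lambda>c F x. u x - (\<Sum>i\<in>F. c i *\<^sub>R e i x)"
  have e: "e i \<in> V" "ip (e i) (e i) \<noteq> 0" if "i \<in> I" for i
    using assms that by (auto simp: complete_orthogonal_system_def ip_norm_def)
  have orth: "ip (e i) (e k) = 0" if "i \<in> I" "k \<in> I" "i \<noteq> k" for i k
    using assms that by (auto simp: complete_orthogonal_system_def)
  show "((\<lambda>F. ip_norm ip (?r ?a F)) \<longlongrightarrow> 0) (finite_subsets_at_top I)"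
  proof (rule tendstoI)
    fix \<epsilon> :: real assume "0 < \<epsilon>"
    then obtain G c where G: "finite G" "G \<subseteq> I" "ip_norm ip (?r c G) < \<epsilon>"
      using assms u unfolding complete_orthogonal_system_def by blast
    \<comment> \<open>Extension by zero turns the approximation over \<open>G\<close> into a
      competitor over \<open>F\<close> with the same residual.\<close>
    define c' where "c' = (\<lambda>i. if i \<in> G then c i else 0)"
    have "dist (ip_norm ip (?r ?a F)) 0 < \<epsilon>" if F: "finite F" "G \<subseteq> F" "F \<subseteq> I" for F
    proof -
      have eF: "\<And>i. i \<in> F \<Longrightarrow> e i \<in> V" "\<And>i. i \<in> F \<Longrightarrow> ip (e i) (e i) \<noteq> 0"
        "\<And>i k. i \<in> F \<Longrightarrow> k \<in> F \<Longrightarrow> i \<noteq> k \<Longrightarrow> ip (e i) (e k) = 0"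
        using e orth F by blast+
      have "?r c' F = ?r c G"
      proof
        fix x
        have "(\<Sum>i\<in>F. c' i *\<^sub>R e i x) = (\<Sum>i\<in>G. c i *\<^sub>R e i x)"
          using F by (intro sum.mono_neutral_cong_right) (auto simp: c'_def)
        then show "?r c' F x = ?r c G x" by simp
      qed
      moreover have "ip (?r ?a F) (?r ?a F) \<le> ip (?r c' F) (?r c' F)"
        using residual_expansion[OF F(1) eF(1) u eF(2,3), where c = c']
          Bessel_identity[OF F(1) eF(1) u eF(2,3)] eF(1)
        by (simp add: sum_nonneg ip_nonneg)
      ultimately have "ip_norm ip (?r ?a F) \<le> ip_norm ip (?r c G)"
        by (simp add: ip_norm_def)
      moreover have "0 \<le> ip_norm ip (?r ?a F)"
        using diff_mem[OF u sum_mem[OF eF(1), where c = ?a]] by (simp add: ip_norm_def ip_nonneg)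
      ultimately show ?thesis using G(3) by simp
    qed
    then show "\<forall>\<^sub>F F in finite_subsets_at_top I. dist (ip_norm ip (?r ?a F)) 0 < \<epsilon>"
      using G unfolding eventually_finite_subsets_at_top by blast
  qed
qed

end

section \<open>Weighted square integrable functions\<close>

lemma mult_le_sum_squares: "a * b \<le> a\<^sup>2 + b\<^sup>2" for a b :: real
proof -
  have "2 * (a * b) \<le> a\<^sup>2 + b\<^sup>2" using sum_squares_bound[of a b] by simp
  moreover have "0 \<le> a\<^sup>2 + b\<^sup>2" by simp
  ultimately show ?thesis by linarith
qed

lemma (in semi_inner_space) semi_inner_subspace:
  assumes "W \<subseteq> V" "(\<lambda>x. 0) \<in> W"
    and "\<And>u v. u \<in> W \<Longrightarrow> v \<in> W \<Longrightarrow> (\<lambda>x. u x + v x) \<in> W"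
    and "\<And>u c. u \<in> W \<Longrightarrow> (\<lambda>x. c *\<^sub>R u x) \<in> W"
  shows "semi_inner_space W ip"
  using assms by unfold_locales (auto simp: subset_iff ip_add ip_scale ip_nonneg ip_commute)

lemma integrable_norm_square_add:
  fixes u v :: "'a \<Rightarrow> 'b::euclidean_space"
  assumes [measurable]: "u \<in> borel_measurable M" "v \<in> borel_measurable M"
    and "integrable M (\<lambda>x. (norm (u x))\<^sup>2)" "integrable M (\<lambda>x. (norm (v x))\<^sup>2)"
  shows "integrable M (\<lambda>x. (norm (u x + v x))\<^sup>2)"
proof (rule Bochner_Integration.integrable_bound)
  show "integrable M (\<lambda>x. 2 * (norm (u x))\<^sup>2 + 2 * (norm (v x))\<^sup>2)"
    using assms by simp
  have "(norm (a + b))\<^sup>2 \<le> 2 * (norm a)\<^sup>2 + 2 * (norm b)\<^sup>2" for a b :: 'b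
  proof -
    have "(norm (a + b))\<^sup>2 \<le> (norm a + norm b)\<^sup>2"
      by (intro power_mono norm_triangle_ineq) simp
    moreover have "0 \<le> (norm a - norm b)\<^sup>2" by simp
    ultimately show ?thesis by (simp add: power2_sum power2_diff)
  qed
  then show "AE x in M. norm ((norm (u x + v x))\<^sup>2) \<le> norm (2 * (norm (u x))\<^sup>2 + 2 * (norm (v x))\<^sup>2)"
    by (simp add: add_nonneg_nonneg)
qed simp

lemma integrable_inner_of_square:
  fixes u v :: "'a \<Rightarrow> 'b::euclidean_space"
  assumes [measurable]: "u \<in> borel_measurable M" "v \<in> borel_measurable M"
    and "integrable M (\<lambda>x. (norm (u x))\<^sup>2)" "integrable M (\<lambda>x. (norm (v x))\<^sup>2)"
  shows "integrable M (\<lambda>x. u x \<bullet> v x)"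
proof (rule Bochner_Integration.integrable_bound)
  show "integrable M (\<lambda>x. (norm (u x))\<^sup>2 + (norm (v x))\<^sup>2)"
    using assms by simp
  have "\<bar>a \<bullet> b\<bar> \<le> (norm a)\<^sup>2 + (norm b)\<^sup>2" for a b :: 'b
    using Cauchy_Schwarz_ineq2[of a b] mult_le_sum_squares[of "norm a" "norm b"] by linarith
  then show "AE x in M. norm (u x \<bullet> v x) \<le> norm ((norm (u x))\<^sup>2 + (norm (v x))\<^sup>2)"
    by simp
qed simp

lemma L2D:
  assumes "v \<in> L2 S"
  shows "v \<in> borel_measurable (lebesgue_on S)" "integrable (lebesgue_on S) (\<lambda>x. (norm (v x))\<^sup>2)"
  using assms by (auto simp: L2_def)

lemma L2_zero: "(\<lambda>x. 0) \<in> L2 S"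
  by (simp add: L2_def)

lemma L2_add: "u \<in> L2 S \<Longrightarrow> v \<in> L2 S \<Longrightarrow> (\<lambda>x. u x + v x) \<in> L2 S"
  by (auto simp: L2_def intro!: integrable_norm_square_add)

lemma L2_scale: "u \<in> L2 S \<Longrightarrow> (\<lambda>x. c *\<^sub>R u x) \<in> L2 S"
  by (auto simp: L2_def power_mult_distrib)

lemma L2_inner_integrable: "u \<in> L2 S \<Longrightarrow> v \<in> L2 S \<Longrightarrow> integrable (lebesgue_on S) (\<lambda>x. u x \<bullet> v x)"
  by (auto simp: L2_def intro!: integrable_inner_of_square)

lemma L2_mult_bounded:
  assumes v: "v \<in> L2 S" and [measurable]: "w \<in> borel_measurable (lebesgue_on S)"
    and C: "AE x in lebesgue_on S. \<bar>w x\<bar> \<le> C"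
  shows "(\<lambda>x. w x *\<^sub>R v x) \<in> L2 S"
proof -
  note L2D(1)[OF v, measurable]
  have "integrable (lebesgue_on S) (\<lambda>x. (norm (w x *\<^sub>R v x))\<^sup>2)"
  proof (rule Bochner_Integration.integrable_bound)
    show "integrable (lebesgue_on S) (\<lambda>x. C\<^sup>2 * (norm (v x))\<^sup>2)"
      using L2D(2)[OF v] by simp
    show "AE x in lebesgue_on S. norm ((norm (w x *\<^sub>R v x))\<^sup>2) \<le> norm (C\<^sup>2 * (norm (v x))\<^sup>2)"
      using C
    proof eventually_elim
      case (elim x)
      then have "\<bar>w x\<bar>\<^sup>2 \<le> C\<^sup>2" by (intro power_mono) auto
      then show ?case by (simp add: power_mult_distrib mult_right_mono)
    qed
  qed simp
  then show ?thesis by (simp add: L2_def)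
qed

lemma semi_inner_space_L2_weighted:
  assumes w: "w \<in> borel_measurable (lebesgue_on S)" "AE x in lebesgue_on S. \<bar>w x\<bar> \<le> C"
    and nn: "AE x in lebesgue_on S. 0 \<le> w x"
  shows "semi_inner_space (L2 S) (\<lambda>u v :: _ \<Rightarrow> 'b::euclidean_space. L2_inner S (\<lambda>x. w x *\<^sub>R u x) v)"
proof
  fix u v z :: "_ \<Rightarrow> 'b" and c
  assume u: "u \<in> L2 S" and v: "v \<in> L2 S" and z: "z \<in> L2 S"
  note i = L2_inner_integrable[OF L2_mult_bounded[OF _ w]]
  show "L2_inner S (\<lambda>x. w x *\<^sub>R u x) v = L2_inner S (\<lambda>x. w x *\<^sub>R v x) u"
    unfolding L2_inner_def by (simp add: inner_commute)
  show "L2_inner S (\<lambda>x. w x *\<^sub>R (u x + v x)) z =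
      L2_inner S (\<lambda>x. w x *\<^sub>R u x) z + L2_inner S (\<lambda>x. w x *\<^sub>R v x) z"
    unfolding L2_inner_def using i[OF u z] i[OF v z]
    by (simp add: scaleR_add_right inner_add_left)
  show "L2_inner S (\<lambda>x. w x *\<^sub>R c *\<^sub>R u x) z = c * L2_inner S (\<lambda>x. w x *\<^sub>R u x) z"
    unfolding L2_inner_def integral_mult_right_zero[symmetric]
    by (intro Bochner_Integration.integral_cong) auto
  show "0 \<le> L2_inner S (\<lambda>x. w x *\<^sub>R u x) u"
    unfolding L2_inner_def
    by (rule integral_nonneg_AE, use nn in eventually_elim) simp
qed (auto intro: L2_zero L2_add L2_scale)

lemma semi_inner_space_L2: "semi_inner_space (L2 S) (L2_inner S :: (_ \<Rightarrow> 'b::euclidean_space) \<Rightarrow> _)"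
  using semi_inner_space_L2_weighted[of "\<lambda>_. 1" S 1] by simp

lemma L2_norm_eq_ip_norm: "L2_norm S = ip_norm (L2_inner S)"
  by (auto simp: L2_norm_def ip_norm_def)

lemma L2_norm_eq: "L2_norm S v = sqrt (LINT x|lebesgue_on S. (norm (v x))\<^sup>2)"
  by (simp add: L2_norm_def L2_inner_def power2_norm_eq_inner)

lemma L2_norm_power2: "(L2_norm S v)\<^sup>2 = (LINT x|lebesgue_on S. (norm (v x))\<^sup>2)"
  by (simp add: L2_norm_eq)

lemma L2_norm_nonneg [simp]: "0 \<le> L2_norm S v"
  by (simp add: L2_norm_eq)

lemma L2_const:
  assumes "S \<in> lmeasurable"
  shows "(\<lambda>x. c) \<in> L2 S"
proof -
  interpret finite_measure "lebesgue_on S"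
    using assms by (rule finite_measure_lebesgue_on)
  show ?thesis by (simp add: L2_def)
qed

lemma L1_norm_le_L2_norm:
  fixes v :: "'a::euclidean_space \<Rightarrow> 'b::euclidean_space"
  assumes S: "S \<in> lmeasurable" and v: "v \<in> L2 S"
  shows "integrable (lebesgue_on S) v"
    and "(LINT x|lebesgue_on S. norm (v x)) \<le> L2_norm S v * sqrt (measure lebesgue S)"
proof -
  have n: "(\<lambda>x. norm (v x)) \<in> L2 S"
    using v by (auto simp: L2_def)
  interpret semi_inner_space "L2 S" "L2_inner S :: ('a \<Rightarrow> real) \<Rightarrow> _" by (rule semi_inner_space_L2)
  have "integrable (lebesgue_on S) (\<lambda>x. norm (v x))"
    using L2_inner_integrable[OF n L2_const[OF S, of 1]] by simp
  then show "integrable (lebesgue_on S) v"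
    using L2D(1)[OF v] by (simp add: integrable_norm_iff)
  have "L2_norm S (\<lambda>x. 1::real) = sqrt (measure lebesgue S)"
    using S by (simp add: L2_norm_eq measure_restrict_space fmeasurableD)
  then show "(LINT x|lebesgue_on S. norm (v x)) \<le> L2_norm S v * sqrt (measure lebesgue S)"
    using Cauchy_Schwarz[OF n L2_const[OF S, of 1]]
    by (simp add: L2_norm_eq_ip_norm[symmetric]) (simp add: L2_norm_eq L2_inner_def)
qed

text \<open>The Riesz--Fischer argument. Along a subsequence with geometrically small steps the
  increments are summable in L1, because \<open>S\<close> has finite measure, so the subsequence
  converges almost everywhere; Fatou's lemma then carries the Cauchy estimate over to the
  limit.\<close>

theorem L2_complete:
  fixes v :: "nat \<Rightarrow> 'a::euclidean_space \<Rightarrow> 'b::euclidean_space"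
  assumes S: "S \<in> lmeasurable" and v: "\<And>n. v n \<in> L2 S"
    and Cauchy: "\<And>\<epsilon>. 0 < \<epsilon> \<Longrightarrow> \<exists>N. \<forall>m\<ge>N. \<forall>n\<ge>N. L2_norm S (\<lambda>x. v m x - v n x) < \<epsilon>"
  obtains w where "w \<in> L2 S" "(\<lambda>n. L2_norm S (\<lambda>x. v n x - w x)) \<longlonglongrightarrow> 0"
proof -
  let ?M = "lebesgue_on S"
  interpret semi_inner_space "L2 S" "L2_inner S :: ('a \<Rightarrow> 'b) \<Rightarrow> _" by (rule semi_inner_space_L2)
  have [measurable]: "v n \<in> borel_measurable ?M" for n using L2D(1)[OF v] .
  have "\<forall>k. \<exists>N. \<forall>m\<ge>N. \<forall>n\<ge>N. L2_norm S (\<lambda>x. v m x - v n x) < (1/2)^k"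
    using Cauchy by simp
  then obtain N where N: "\<And>k m n. m \<ge> N k \<Longrightarrow> n \<ge> N k \<Longrightarrow> L2_norm S (\<lambda>x. v m x - v n x) < (1/2)^k"
    by metis
  \<comment> \<open>Summing the thresholds makes \<open>r\<close> monotone and at least
    \<open>N k\<close> at \<open>k\<close>; the extra summand \<open>k\<close> makes it
    unbounded.\<close>
  define r where "r k = k + (\<Sum>i\<le>k. N i)" for k
  have rN: "N k \<le> r k" for k
    unfolding r_def using member_le_sum[of k "{..k}" N] by simp
  have rk: "k \<le> r k" for k unfolding r_def by simp
  have rS: "r k \<le> r (Suc k)" for k unfolding r_def by simp
  define d where "d k x = norm (v (r (Suc k)) x - v (r k) x)" for k x
  have [measurable]: "d k \<in> borel_measurable ?M" for k unfolding d_def by measurable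
  have dint: "(\<integral>\<^sup>+x. ennreal (d k x) \<partial>?M) \<le> ennreal (sqrt (measure lebesgue S) * (1/2)^k)" for k
  proof -
    have L: "(\<lambda>x. v (r (Suc k)) x - v (r k) x) \<in> L2 S" by (intro diff_mem v)
    have i: "integrable ?M (d k)"
      unfolding d_def using L1_norm_le_L2_norm(1)[OF S L] by (rule integrable_norm)
    have e: "(\<integral>\<^sup>+x. ennreal (d k x) \<partial>?M) = ennreal (LINT x|?M. d k x)"
      by (rule nn_integral_eq_integral[OF i]) (simp add: d_def)
    have "(LINT x|?M. d k x) \<le> L2_norm S (\<lambda>x. v (r (Suc k)) x - v (r k) x) * sqrt (measure lebesgue S)"
      unfolding d_def by (rule L1_norm_le_L2_norm(2)[OF S L])
    also have "\<dots> \<le> (1/2)^k * sqrt (measure lebesgue S)"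
      using N[of k "r (Suc k)" "r k"] rN[of k] rS[of k] by (intro mult_right_mono) auto
    finally show ?thesis unfolding e by (intro ennreal_leI) (simp add: mult.commute)
  qed
  have "(\<integral>\<^sup>+x. (\<Sum>k. ennreal (d k x)) \<partial>?M) = (\<Sum>k. \<integral>\<^sup>+x. ennreal (d k x) \<partial>?M)"
    by (rule nn_integral_suminf) simp
  also have "\<dots> \<le> (\<Sum>k. ennreal (sqrt (measure lebesgue S) * (1/2)^k))"
    by (intro suminf_le dint) auto
  also have "\<dots> = ennreal (\<Sum>k. sqrt (measure lebesgue S) * (1/2)^k)"
    by (intro suminf_ennreal2) (auto intro!: summable_mult)
  also have "\<dots> < \<infinity>" by simp
  finally have "AE x in ?M. (\<Sum>k. ennreal (d k x)) \<noteq> \<infinity>"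
    by (intro nn_integral_PInf_AE) auto
  then have conv: "AE x in ?M. (\<lambda>k. v (r k) x) \<longlonglongrightarrow> lim (\<lambda>k. v (r k) x)"
  proof eventually_elim
    case (elim x)
    then have "summable (\<lambda>k. d k x)"
      by (intro summable_suminf_not_top) (auto simp: d_def)
    then have "summable (\<lambda>k. v (r (Suc k)) x - v (r k) x)"
      unfolding d_def by (rule summable_norm_cancel)
    then have "convergent (\<lambda>n. \<Sum>k<n. v (r (Suc k)) x - v (r k) x)"
      by (simp add: summable_iff_convergent)
    then have "convergent (\<lambda>n. v (r n) x - v (r 0) x)"
      using sum_lessThan_telescope[of "\<lambda>k. v (r k) x"] by simp
    then have "convergent (\<lambda>n. (v (r n) x - v (r 0) x) + v (r 0) x)"
      by (intro convergent_add convergent_const)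
    then show ?case by (simp add: convergent_LIMSEQ_iff)
  qed
  define w where "w x = lim (\<lambda>k. v (r k) x)" for x
  have [measurable]: "w \<in> borel_measurable ?M"
    unfolding w_def by (rule borel_measurable_lim_metric) simp
  \<comment> \<open>With \<open>n\<close> fixed, only the second index of the Cauchy estimate runs
    along the subsequence, so the whole sequence and not merely a subsequence is controlled.\<close>
  have Fatou: "(\<integral>\<^sup>+x. ennreal ((norm (v n x - w x))\<^sup>2) \<partial>?M) \<le> ennreal (\<epsilon>\<^sup>2)"
    if \<epsilon>: "0 < \<epsilon>" and M: "\<And>m. m \<ge> M \<Longrightarrow> L2_norm S (\<lambda>x. v n x - v m x) < \<epsilon>" for n \<epsilon> M
  proof -
    have "(\<integral>\<^sup>+x. ennreal ((norm (v n x - w x))\<^sup>2) \<partial>?M) =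
       (\<integral>\<^sup>+x. liminf (\<lambda>k. ennreal ((norm (v n x - v (r k) x))\<^sup>2)) \<partial>?M)"
    proof (rule nn_integral_cong_AE, use conv in eventually_elim)
      case (elim x)
      then have "(\<lambda>k. ennreal ((norm (v n x - v (r k) x))\<^sup>2)) \<longlonglongrightarrow> ennreal ((norm (v n x - w x))\<^sup>2)"
        unfolding w_def by (intro tendsto_intros)
      then show ?case by (intro lim_imp_Liminf[symmetric]) auto
    qed
    also have "\<dots> \<le> liminf (\<lambda>k. \<integral>\<^sup>+x. ennreal ((norm (v n x - v (r k) x))\<^sup>2) \<partial>?M)"
      by (rule nn_integral_liminf) simp
    also have "\<dots> \<le> liminf (\<lambda>k. ennreal (\<epsilon>\<^sup>2))"
    proof (rule Liminf_mono, rule eventually_sequentiallyI[of M])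
      fix k assume "M \<le> k"
      then have "L2_norm S (\<lambda>x. v n x - v (r k) x) \<le> \<epsilon>"
        using M[of "r k"] rk[of k] by simp
      then have "(L2_norm S (\<lambda>x. v n x - v (r k) x))\<^sup>2 \<le> \<epsilon>\<^sup>2"
        by (intro power_mono) auto
      moreover have "(\<integral>\<^sup>+x. ennreal ((norm (v n x - v (r k) x))\<^sup>2) \<partial>?M) =
          ennreal ((L2_norm S (\<lambda>x. v n x - v (r k) x))\<^sup>2)"
        unfolding L2_norm_power2
        using L2D(2)[OF diff_mem[OF v[of n] v[of "r k"]]] by (rule nn_integral_eq_integral) simp
      ultimately show "(\<integral>\<^sup>+x. ennreal ((norm (v n x - v (r k) x))\<^sup>2) \<partial>?M) \<le> ennreal (\<epsilon>\<^sup>2)"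
        by simp
    qed
    finally show ?thesis by (simp add: Liminf_const)
  qed
  have bound: "(\<lambda>x. v n x - w x) \<in> L2 S \<and> L2_norm S (\<lambda>x. v n x - w x) \<le> \<epsilon>"
    if \<epsilon>: "0 < \<epsilon>" and M: "\<And>m. m \<ge> M \<Longrightarrow> L2_norm S (\<lambda>x. v n x - v m x) < \<epsilon>" for n \<epsilon> M
  proof -
    have F: "(\<integral>\<^sup>+x. ennreal ((norm (v n x - w x))\<^sup>2) \<partial>?M) \<le> ennreal (\<epsilon>\<^sup>2)"
      using that by (rule Fatou)
    have i: "integrable ?M (\<lambda>x. (norm (v n x - w x))\<^sup>2)"
      using le_less_trans[OF F ennreal_less_top] by (intro integrableI_bounded) auto
    then have "(\<integral>\<^sup>+x. ennreal ((norm (v n x - w x))\<^sup>2) \<partial>?M) =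
          ennreal ((L2_norm S (\<lambda>x. v n x - w x))\<^sup>2)"
      unfolding L2_norm_power2 by (rule nn_integral_eq_integral) simp
    with F have "(L2_norm S (\<lambda>x. v n x - w x))\<^sup>2 \<le> \<epsilon>\<^sup>2" by simp
    then have "L2_norm S (\<lambda>x. v n x - w x) \<le> \<epsilon>"
      using \<epsilon> by (simp add: power2_le_iff_abs_le)
    then show ?thesis using i by (simp add: L2_def)
  qed
  obtain N1 where "\<forall>m\<ge>N1. \<forall>n\<ge>N1. L2_norm S (\<lambda>x. v m x - v n x) < 1"
    using Cauchy[of 1] by auto
  then have "(\<lambda>x. v N1 x - w x) \<in> L2 S"
    using bound[of 1 N1 N1] by simp
  from diff_mem[OF v[of N1] this] have "w \<in> L2 S" by simp
  moreover have "(\<lambda>n. L2_norm S (\<lambda>x. v n x - w x)) \<longlonglongrightarrow> 0"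
  proof (rule LIMSEQ_I)
    fix \<epsilon> :: real assume "0 < \<epsilon>"
    then obtain M where M: "\<forall>m\<ge>M. \<forall>n\<ge>M. L2_norm S (\<lambda>x. v m x - v n x) < \<epsilon>/2"
      using Cauchy[of "\<epsilon>/2"] by auto
    have "L2_norm S (\<lambda>x. v n x - w x) \<le> \<epsilon>/2" if "n \<ge> M" for n
      using bound[of "\<epsilon>/2" M n] M that \<open>0 < \<epsilon>\<close> by simp
    then show "\<exists>no. \<forall>n\<ge>no. norm (L2_norm S (\<lambda>x. v n x - w x) - 0) < \<epsilon>"
      using \<open>0 < \<epsilon>\<close> by (intro exI[of _ M]) fastforce
  qed
  ultimately show thesis by (rule that)
qed

section \<open>The Newton kernel\<close>

text \<open>Dyadic shells replace polar coordinates: where the norm lies between (1/2)^(k+1) and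
  (1/2)^k the integrand is at most 4^(k+1), while the ball has volume proportional to 8^(-k). The
  products form a geometric series of ratio 1/2.\<close>

lemma nn_integral_inverse_square_ball:
  "(\<integral>\<^sup>+y. ennreal (1 / (norm (y::R3))\<^sup>2) * indicator (ball 0 1) y \<partial>lborel) < \<infinity>"
proof -
  let ?c = "unit_ball_vol 3"
  have c0: "0 \<le> ?c" by simp
  have "(\<integral>\<^sup>+y. ennreal (1 / (norm (y::R3))\<^sup>2) * indicator (ball 0 1) y \<partial>lborel)
    \<le> (\<integral>\<^sup>+y. (\<Sum>k. ennreal (4 ^ Suc k) * indicator (ball 0 ((1/2) ^ k)) (y::R3)) \<partial>lborel)"
  proof (rule nn_integral_mono)
    fix y :: R3
    show "ennreal (1 / (norm y)\<^sup>2) * indicator (ball 0 1) y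
       \<le> (\<Sum>k. ennreal (4 ^ Suc k) * indicator (ball 0 ((1/2) ^ k)) y)"
    proof (cases "0 < norm y \<and> norm y < 1")
      case True
      define n where "n = (LEAST n. (1/2) ^ n \<le> norm y)"
      have "\<exists>n. (1/2) ^ n \<le> norm y"
        using real_arch_pow_inv[of "norm y" "1/2"] True by (auto intro: less_imp_le)
      then have n: "(1/2) ^ n \<le> norm y"
        unfolding n_def by (rule LeastI_ex)
      then have "n \<noteq> 0" using True by (intro notI) simp
      then obtain k where k: "n = Suc k" by (cases n) auto
      have lt: "norm y < (1/2) ^ k"
        using not_less_Least[of k "\<lambda>n. (1/2) ^ n \<le> norm y"] k unfolding n_def[symmetric] by simp
      have "((1/2) ^ n)\<^sup>2 \<le> (norm y)\<^sup>2"
        using n by (intro power_mono) auto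
      then have "1 / (norm y)\<^sup>2 \<le> 1 / ((1/2) ^ n)\<^sup>2"
        using True by (intro divide_left_mono) auto
      also have "1 / ((1/2::real) ^ n)\<^sup>2 = 4 ^ n"
        by (simp add: power_mult[symmetric] mult.commute[of n] power_mult power_divide)
      finally have "ennreal (1 / (norm y)\<^sup>2) * indicator (ball 0 1) y
          \<le> ennreal (4 ^ Suc k) * indicator (ball 0 ((1/2) ^ k)) y"
        using lt True k by (auto simp: ennreal_leI)
      also have "\<dots> \<le> (\<Sum>k. ennreal (4 ^ Suc k) * indicator (ball 0 ((1/2) ^ k)) y)"
      proof -
        have "g k \<le> suminf g" for g :: "nat \<Rightarrow> ennreal"
          using sum_le_suminf[of g "{k}"] by simp
        then show ?thesis .
      qed
      finally show ?thesis .
    qed auto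
  qed
  also have "\<dots> = (\<Sum>k. \<integral>\<^sup>+y. ennreal (4 ^ Suc k) * indicator (ball 0 ((1/2) ^ k)) (y::R3) \<partial>lborel)"
    by (intro nn_integral_suminf borel_measurable_times_ennreal borel_measurable_const borel_measurable_indicator) simp
  also have "\<dots> = (\<Sum>k. ennreal (4 * ?c * (1/2) ^ k))"
  proof (rule suminf_cong)
    fix k :: nat
    have "((1/2::real) ^ k) ^ 3 = ((1/2) ^ 3) ^ k"
      by (simp only: power_mult[symmetric] mult.commute)
    then have e: "(4::real) ^ k * ((1/2) ^ k) ^ 3 = (1/2) ^ k"
      by (simp only: power_mult_distrib[symmetric]) (simp add: power3_eq_cube)
    have "(\<integral>\<^sup>+y. ennreal (4 ^ Suc k) * indicator (ball 0 ((1/2) ^ k)) (y::R3) \<partial>lborel)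
       = ennreal (4 ^ Suc k) * ennreal (?c * ((1/2) ^ k) ^ 3)"
      by (subst nn_integral_cmult_indicator) (auto simp: emeasure_ball)
    also have "\<dots> = ennreal (4 ^ Suc k * (?c * ((1/2) ^ k) ^ 3))"
      using c0 by (subst ennreal_mult) auto
    also have "4 ^ Suc k * (?c * ((1/2) ^ k) ^ 3) = 4 * ?c * (1/2) ^ k"
      using e by (simp only: power_Suc mult.assoc mult.left_commute[of _ ?c])
    finally show "(\<integral>\<^sup>+y. ennreal (4 ^ Suc k) * indicator (ball 0 ((1/2) ^ k)) (y::R3) \<partial>lborel)
       = ennreal (4 * ?c * (1/2) ^ k)" .
  qed
  also have "\<dots> = ennreal (\<Sum>k. 4 * ?c * (1/2) ^ k)"
    using c0 by (intro suminf_ennreal2) (auto intro!: summable_mult)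
  also have "\<dots> < \<infinity>" by simp
  finally show ?thesis .
qed

text \<open>Uniformity in the pole \<open>x\<close> is the point. Inside the unit ball about
  \<open>x\<close> a translation reduces to the pole 0; outside it the kernel is at most 1 and
  contributes no more than the volume of \<open>\<Omega>\<close>.\<close>

lemma nn_integral_inverse_square_bound:
  fixes \<Omega> :: "R3 set"
  assumes [measurable]: "\<Omega> \<in> sets borel" and fin: "emeasure lborel \<Omega> < \<infinity>"
  obtains C where "0 \<le> C"
    "\<And>x. (\<integral>\<^sup>+y. ennreal (1 / (norm (x - y))\<^sup>2) * indicator \<Omega> y \<partial>lborel) \<le> ennreal C"
proof -
  let ?I = "(\<integral>\<^sup>+y. ennreal (1 / (norm (y::R3))\<^sup>2) * indicator (ball 0 1) y \<partial>lborel)"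
  have "(\<integral>\<^sup>+y. ennreal (1 / (norm (x - y))\<^sup>2) * indicator \<Omega> y \<partial>lborel) \<le> ?I + emeasure lborel \<Omega>" for x
  proof -
    have "(\<integral>\<^sup>+y. ennreal (1 / (norm (x - y))\<^sup>2) * indicator \<Omega> y \<partial>lborel)
      \<le> (\<integral>\<^sup>+y. ennreal (1 / (norm (x - y))\<^sup>2) * indicator (ball x 1) y + indicator \<Omega> y \<partial>lborel)"
    proof (rule nn_integral_mono)
      fix y :: R3
      show "ennreal (1 / (norm (x - y))\<^sup>2) * indicator \<Omega> y
        \<le> ennreal (1 / (norm (x - y))\<^sup>2) * indicator (ball x 1) y + indicator \<Omega> y"
      proof (cases "y \<in> ball x 1")
        case False
        then have "1 \<le> norm (x - y)" by (simp add: dist_norm)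
        then have "1 \<le> (norm (x - y))\<^sup>2" by (rule one_le_power)
        then have "1 / (norm (x - y))\<^sup>2 \<le> 1" by (simp add: divide_le_eq_1)
        then have "ennreal (1 / (norm (x - y))\<^sup>2) \<le> 1"
          by (simp add: ennreal_le_1)
        then show ?thesis using False by (simp split: split_indicator)
      qed (simp split: split_indicator)
    qed
    also have "\<dots> = (\<integral>\<^sup>+y. ennreal (1 / (norm (x - y))\<^sup>2) * indicator (ball x 1) y \<partial>lborel) + emeasure lborel \<Omega>"
    proof (subst nn_integral_add)
      show "(\<lambda>y. ennreal (1 / (norm (x - y))\<^sup>2) * indicator (ball x 1) y) \<in> borel_measurable lborel"
        by (intro borel_measurable_times_ennreal borel_measurable_indicator) simp_all
      show "indicator \<Omega> \<in> borel_measurable lborel" using assms(1) by simp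
      show "(\<integral>\<^sup>+y. ennreal (1 / (norm (x - y))\<^sup>2) * indicator (ball x 1) y \<partial>lborel) + integral\<^sup>N lborel (indicator \<Omega>) =
        (\<integral>\<^sup>+y. ennreal (1 / (norm (x - y))\<^sup>2) * indicator (ball x 1) y \<partial>lborel) + emeasure lborel \<Omega>"
        using assms(1) by (subst nn_integral_indicator) simp_all
    qed
    also have "(\<integral>\<^sup>+y. ennreal (1 / (norm (x - y))\<^sup>2) * indicator (ball x 1) y \<partial>lborel) =
       (\<integral>\<^sup>+y. ennreal (1 / (norm (x - y))\<^sup>2) * indicator (ball x 1) y \<partial>distr lborel borel ((+) x))"
      by (simp add: lborel_distr_plus)
    also have "\<dots> = (\<integral>\<^sup>+y. ennreal (1 / (norm y)\<^sup>2) * indicator (ball x 1) (x + y) \<partial>lborel)"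
    proof -
      have "(\<lambda>y. ennreal (1 / (norm (x - y))\<^sup>2) * indicator (ball x 1) y) \<in> borel_measurable borel"
        by (intro borel_measurable_times_ennreal borel_measurable_indicator) simp_all
      then show ?thesis by (subst nn_integral_distr) simp_all
    qed
    also have "\<dots> = ?I"
      by (intro nn_integral_cong) (simp add: indicator_def dist_norm)
    finally show ?thesis .
  qed
  moreover have "?I + emeasure lborel \<Omega> < \<infinity>"
    using nn_integral_inverse_square_ball fin by simp
  then have "?I + emeasure lborel \<Omega> = ennreal (enn2real (?I + emeasure lborel \<Omega>))"
    by simp
  ultimately show thesis
    by (intro that[of "enn2real (?I + emeasure lborel \<Omega>)"]) (auto simp del: ennreal_enn2real_if)
qed

section \<open>The Fefferman--de la Llave formula for the kernel 1 / |x - y|\<close>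

definition ball_kernel :: "R3 \<Rightarrow> R3 \<Rightarrow> ennreal" where
  "ball_kernel x y = (\<integral>\<^sup>+r. ennreal (if 0 < r then 1 / r ^ 5 else 0) * emeasure lborel (ball x r \<inter> ball y r) \<partial>lborel)"

text \<open>A similarity carries the balls of radius \<open>r\<close> about 0 and the first unit
  vector to those of radius \<open>dist x y * r\<close> about \<open>x\<close> and \<open>y\<close>:
  an orthogonal map turns the unit vector into the direction of \<open>y - x\<close>, then one
  dilates and translates. Only the dilation changes volume, by the cube of its factor.\<close>

lemma emeasure_ball_inter_scale:
  fixes x y :: R3
  assumes "x \<noteq> y"
  shows "emeasure lborel (ball x (dist x y * r) \<inter> ball y (dist x y * r)) =
    ennreal (dist x y ^ 3) * emeasure lborel (ball 0 r \<inter> ball (axis 1 1 :: R3) r)"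
proof -
  let ?d = "dist x y" and ?e = "axis 1 1 :: R3"
  let ?B = "ball 0 r \<inter> ball ?e r"
  have d: "0 < ?d" using assms by simp
  have "norm ?e = norm ((1 / ?d) *\<^sub>R (y - x))"
    using d by (simp add: dist_norm norm_minus_commute)
  then obtain f where f: "orthogonal_transformation f" "f ?e = (1 / ?d) *\<^sub>R (y - x)"
    by (rule orthogonal_transformation_exists)
  have lin: "linear f" using f(1) by (rule orthogonal_transformation_linear)
  have y: "?d *\<^sub>R f ?e + x = y" using f(2) d by simp
  have im: "(\<lambda>z. ?d *\<^sub>R z + x) ` f ` ball a r = ball (?d *\<^sub>R f a + x) (?d * r)" for a
  proof -
    have "f ` ball a r = ball (f a) r"
      using f(1) by (rule image_orthogonal_transformation_ball)
    then have "(\<lambda>z. ?d *\<^sub>R z + x) ` f ` ball a r = (\<lambda>z. x + z) ` ((\<lambda>z. ?d *\<^sub>R z) ` ball (f a) r)"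
      by (simp add: image_image add.commute)
    also have "(\<lambda>z. ?d *\<^sub>R z) ` ball (f a) r = ball (?d *\<^sub>R f a) (?d * r)"
      using ball_scale[of ?d "f a" r] d by simp
    finally show ?thesis by (simp add: ball_translation add.commute)
  qed
  have inj: "inj (\<lambda>z. ?d *\<^sub>R f z + x)"
    using d f(1) by (auto simp: inj_def dest: orthogonal_transformation_inj[THEN injD])
  have "ball x (?d * r) \<inter> ball y (?d * r) = (\<lambda>z. ?d *\<^sub>R z + x) ` f ` ?B"
  proof -
    have "(\<lambda>z. ?d *\<^sub>R z + x) ` f ` ?B = (\<lambda>z. ?d *\<^sub>R f z + x) ` ?B"
      by (simp add: image_image)
    also have "\<dots> = (\<lambda>z. ?d *\<^sub>R f z + x) ` ball 0 r \<inter> (\<lambda>z. ?d *\<^sub>R f z + x) ` ball ?e r"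
      using inj by (rule image_Int)
    also have "\<dots> = ball x (?d * r) \<inter> ball y (?d * r)"
      using im[of 0] im[of ?e] y by (simp add: image_image linear_0[OF lin])
    finally show ?thesis ..
  qed
  moreover have "emeasure lborel (ball x (?d * r) \<inter> ball y (?d * r)) =
     emeasure lebesgue (ball x (?d * r) \<inter> ball y (?d * r))" by simp
  ultimately have "emeasure lborel (ball x (?d * r) \<inter> ball y (?d * r)) =
     emeasure lebesgue ((\<lambda>z. ?d *\<^sub>R z + x) ` f ` ?B)" by metis
  also have "\<dots> = ennreal (?d ^ 3) * emeasure lebesgue (f ` ?B)"
    using emeasure_lebesgue_affine[of ?d x "f ` ?B"] d by (simp add: ennreal_power)
  also have "emeasure lebesgue (f ` ?B) = emeasure lebesgue ?B"
  proof -
    have B: "?B \<in> lmeasurable" by (intro bounded_set_imp_lmeasurable) auto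
    show ?thesis
      using measurable_orthogonal_image[OF f(1) B] measure_orthogonal_image[OF f(1) B] B
      by (simp add: emeasure_eq_measure2)
  qed
  also have "emeasure lebesgue ?B = emeasure lborel ?B" by simp
  finally show ?thesis .
qed

text \<open>The intersection is the slice at \<open>r\<close> of an open set of pairs
  \<open>(r, z)\<close>, and the measure of slices is a measurable function.\<close>

lemma measurable_emeasure_ball_inter [measurable]:
  "(\<lambda>r. emeasure lborel (ball (x::R3) r \<inter> ball y r)) \<in> borel_measurable borel"
proof -
  have "(\<lambda>r. emeasure lborel (ball x r \<inter> ball y r)) =
     (\<lambda>r. \<integral>\<^sup>+z. indicator {p. dist x (snd p) < fst p \<and> dist y (snd p) < fst p} (r, z) \<partial>lborel)"
  proof
    fix r
    show "emeasure lborel (ball x r \<inter> ball y r) =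
      (\<integral>\<^sup>+z. indicator {p. dist x (snd p) < fst p \<and> dist y (snd p) < fst p} (r, z) \<partial>lborel)"
      by (subst nn_integral_indicator[symmetric], simp, intro nn_integral_cong)
        (simp add: indicator_def)
  qed
  moreover have "{p. dist x (snd p) < fst p \<and> dist y (snd p) < fst p} \<in> sets (borel \<Otimes>\<^sub>M borel)"
    unfolding borel_prod by (intro borel_open open_Collect_conj open_Collect_less continuous_intros)
  ultimately show ?thesis by simp
qed

text \<open>The constant \<open>\<kappa>\<close> of the overview. As \<open>enn2real\<close> sends
  an infinite value to 0, the finiteness that follows is what ties it to the kernel.\<close>

definition kernel_const :: real where
  "kernel_const = enn2real (ball_kernel 0 (axis 1 1))"

text \<open>Balls of radius below 1/2 whose centres have distance 1 are disjoint, which removes the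
  singularity of the weight at 0. For larger radii the intersection has volume at most that of one
  ball, which leaves a multiple of 1 / r^2, integrable at infinity.\<close>

lemma ball_kernel_unit_finite: "ball_kernel 0 (axis 1 1) < \<infinity>"
proof -
  let ?c = "unit_ball_vol 3"
  have "ball_kernel 0 (axis 1 1) \<le> (\<integral>\<^sup>+r. ennreal (?c / r\<^sup>2) * indicator {1/2..} r \<partial>lborel)"
    unfolding ball_kernel_def
  proof (rule nn_integral_mono)
    fix r :: real
    show "ennreal (if 0 < r then 1 / r ^ 5 else 0) * emeasure lborel (ball 0 r \<inter> ball (axis 1 1 :: R3) r)
      \<le> ennreal (?c / r\<^sup>2) * indicator {1/2..} r"
    proof (cases "1/2 \<le> r")
      case True
      have "emeasure lborel (ball 0 r \<inter> ball (axis 1 1 :: R3) r) \<le> emeasure lborel (ball (0::R3) r)"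
        by (rule emeasure_mono) auto
      also have "\<dots> = ennreal (?c * r ^ 3)"
        using True by (simp add: emeasure_ball)
      finally have "ennreal (1 / r ^ 5) * emeasure lborel (ball 0 r \<inter> ball (axis 1 1 :: R3) r)
          \<le> ennreal (1 / r ^ 5) * ennreal (?c * r ^ 3)"
        by (rule mult_left_mono) simp
      also have "\<dots> = ennreal (?c / r\<^sup>2)"
        using True by (subst ennreal_mult[symmetric])
          (auto simp: field_simps power2_eq_square power3_eq_cube eval_nat_numeral)
      finally show ?thesis using True by simp
    next
      case False
      have "ball 0 r \<inter> ball (axis 1 1 :: R3) r = {}"
      proof (rule ccontr)
        assume "ball 0 r \<inter> ball (axis 1 1 :: R3) r \<noteq> {}"
        then obtain z where z: "dist 0 z < r" "dist (axis 1 1 :: R3) z < r" by auto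
        then have "dist 0 (axis 1 1 :: R3) < r + r"
          by (rule dist_triangle_less_add)
        then show False using False by simp
      qed
      then show ?thesis by simp
    qed
  qed
  also have "\<dots> = ennreal (0 - (- ?c / (1/2)))"
  proof (rule nn_integral_FTC_atLeast)
    show "((\<lambda>r. - ?c / r) has_real_derivative ?c / r\<^sup>2) (at r)" if "1/2 \<le> r" for r
      using that by (auto intro!: derivative_eq_intros simp: power2_eq_square)
    show "((\<lambda>r. - ?c / r) \<longlongrightarrow> 0) at_top"
      by (intro tendsto_divide_0[OF tendsto_const] filterlim_at_top_imp_at_infinity filterlim_ident)
  qed simp_all
  also have "\<dots> < \<infinity>" by simp
  finally show ?thesis .
qed

text \<open>The substitution of \<open>dist x y * r\<close> for \<open>r\<close> reduces to the
  reference pair 0 and \<open>axis 1 1\<close>. On the diagonal the formula fails: the left side is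
  infinite and the right side is \<open>1 / 0 = 0\<close> times a constant, so later uses discard
  this null set.\<close>

lemma ball_kernel_eq:
  assumes "x \<noteq> y"
  shows "ball_kernel x y = ennreal (kernel_const / norm (x - y))"
proof -
  let ?d = "dist x y" and ?K = "ball_kernel 0 (axis 1 1)"
  let ?p = "\<lambda>r. if 0 < r then 1 / r ^ 5 else (0::real)"
  have d: "0 < ?d" using assms by simp
  have "ball_kernel x y = ennreal \<bar>?d\<bar> * (\<integral>\<^sup>+r. ennreal (?p (0 + ?d * r)) *
      emeasure lborel (ball x (0 + ?d * r) \<inter> ball y (0 + ?d * r)) \<partial>lborel)"
    unfolding ball_kernel_def using d by (intro nn_integral_real_affine borel_measurable_times_ennreal
        measurable_emeasure_ball_inter) auto
  also have "(\<integral>\<^sup>+r. ennreal (?p (0 + ?d * r)) *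
      emeasure lborel (ball x (0 + ?d * r) \<inter> ball y (0 + ?d * r)) \<partial>lborel) =
      (\<integral>\<^sup>+r. ennreal (1 / ?d\<^sup>2) * (ennreal (?p r) * emeasure lborel (ball 0 r \<inter> ball (axis 1 1 :: R3) r)) \<partial>lborel)"
  proof (intro nn_integral_cong)
    fix r :: real
    have "ennreal (?p (0 + ?d * r)) * ennreal (?d ^ 3) = ennreal (1 / ?d\<^sup>2) * ennreal (?p r)"
      using d by (subst (1 2) ennreal_mult[symmetric])
        (auto simp: field_simps zero_less_mult_iff eval_nat_numeral)
    then show "ennreal (?p (0 + ?d * r)) * emeasure lborel (ball x (0 + ?d * r) \<inter> ball y (0 + ?d * r)) =
      ennreal (1 / ?d\<^sup>2) * (ennreal (?p r) * emeasure lborel (ball 0 r \<inter> ball (axis 1 1 :: R3) r))"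
      using emeasure_ball_inter_scale[OF assms, of r] by (simp only: add_0 mult.assoc[symmetric])
  qed
  also have "\<dots> = ennreal (1 / ?d\<^sup>2) * ?K"
    unfolding ball_kernel_def by (intro nn_integral_cmult borel_measurable_times_ennreal)
      (auto simp: measurable_emeasure_ball_inter)
  also have "?K = ennreal kernel_const"
    using ball_kernel_unit_finite by (simp add: kernel_const_def)
  also have "ennreal \<bar>?d\<bar> * (ennreal (1 / ?d\<^sup>2) * ennreal kernel_const) = ennreal (kernel_const / norm (x - y))"
    using d by (simp add: ennreal_mult[symmetric] kernel_const_def dist_norm power2_eq_square)
  finally show ?thesis .
qed

text \<open>By Vitali's theorem an open set is, up to a null set, a disjoint union of balls on which the
  integral vanishes.\<close>

lemma AE_zero_of_ball_integrals:
  fixes w :: "'a::euclidean_space \<Rightarrow> 'b::euclidean_space"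
  assumes w: "integrable lborel w"
    and ae: "AE z in lborel. AE r in lborel. 0 < r \<longrightarrow> (LINT x:ball z r|lborel. w x) = 0"
  shows "AE x in lborel. w x = 0"
proof -
  define good where "good z r \<longleftrightarrow> (LINT x:ball z r|lborel. w x) = 0" for z r
  define Z where "Z = {z. AE r in lborel. 0 < r \<longrightarrow> good z r}"
  have "AE z in lborel. z \<in> Z"
    using ae by (simp add: Z_def good_def)
  then have "AE z in lebesgue. z \<in> Z"
    by (rule AE_completion)
  then have negZ: "negligible (- Z)"
    by (simp add: negligible_iff_null_sets AE_iff_null_sets null_sets_completion_iff2 completion.AE_iff_null_sets)
       (metis Compl_eq)
  have si: "set_integrable lborel A w" if "A \<in> sets borel" for A
    using w that unfolding set_integrable_def by (intro integrable_mult_indicator) auto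
  then have sm: "set_borel_measurable lborel A w" if "A \<in> sets borel" for A
    using that unfolding set_integrable_def set_borel_measurable_def
    by (metis borel_measurable_integrable)
  have opn: "(LINT x:U|lborel. w x) = 0" if U: "open U" for U
  proof -
    \<comment> \<open>The Vitali family: balls inside \<open>U\<close> over which the integral
      vanishes. Centres outside \<open>Z\<close> may admit no such ball, but they are negligible, so
      covering \<open>U \<inter> Z\<close> is enough.\<close>
    define K where "K = {(z, r). 0 < r \<and> ball z r \<subseteq> U \<and> good z r}"
    have cov: "\<exists>i. i \<in> K \<and> x \<in> ball (fst i) (snd i) \<and> snd i < d"
      if x: "x \<in> U \<inter> Z" and d: "0 < d" for x d
    proof -
      obtain e where e: "0 < e" "ball x e \<subseteq> U" using U x by (auto elim: openE)
      \<comment> \<open>Bad radii at a centre in \<open>Z\<close> form a null set, which cannot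
        contain an interval of positive length; hence there are good balls of arbitrarily small
        radius.\<close>
      have "\<exists>r. 0 < r \<and> r < min d e \<and> good x r"
      proof (rule ccontr)
        assume no: "\<not> ?thesis"
        have "AE r in lborel. 0 < r \<longrightarrow> good x r" using x by (simp add: Z_def)
        then have "AE r in lborel. r \<notin> {0<..<min d e}"
          by eventually_elim (use no in auto)
        then have "emeasure lborel {0<..<min d e} = 0"
          by (subst (asm) AE_iff_measurable[of "{0<..<min d e}"]) auto
        then show False using d e(1) by auto
      qed
      then obtain r where "0 < r" "r < min d e" "good x r" by blast
      then show ?thesis using e by (intro exI[of _ "(x, r)"]) (auto simp: K_def)
    qed
    obtain C where C: "countable C" "C \<subseteq> K"
      "pairwise (\<lambda>i j. disjnt (ball (fst i) (snd i)) (ball (fst j) (snd j))) C"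
      "negligible (U \<inter> Z - (\<Union>i\<in>C. ball (fst i) (snd i)))"
      using Vitali_covering_theorem_balls[of "U \<inter> Z" K fst snd] cov by blast
    \<comment> \<open>Countable additivity is applied over the naturals: the countable family is
      enumerated, with empty sets at indices that are not hit.\<close>
    define B where "B n = (if n \<in> to_nat_on C ` C
        then ball (fst (from_nat_into C n)) (snd (from_nat_into C n)) else {})" for n
    have Bball: "B (to_nat_on C i) = ball (fst i) (snd i)" if "i \<in> C" for i
      using that C(1) by (simp add: B_def)
    have UB: "(\<Union>n. B n) = (\<Union>i\<in>C. ball (fst i) (snd i))"
    proof -
      have "(\<Union>n. B n) = (\<Union>n\<in>to_nat_on C ` C. B n)" by (auto simp: B_def)
      then show ?thesis using Bball by simp
    qed
    have Bm: "B n \<in> sets borel" for n by (simp add: B_def)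
    have disj: "B m \<inter> B n = {}" if "m \<noteq> n" for m n
    proof (cases "m \<in> to_nat_on C ` C \<and> n \<in> to_nat_on C ` C")
      case True
      then obtain i k where "i \<in> C" "k \<in> C" "m = to_nat_on C i" "n = to_nat_on C k" by auto
      moreover then have "i \<noteq> k" using that by auto
      ultimately show ?thesis using C(3) Bball by (simp add: pairwise_def disjnt_def)
    qed (auto simp: B_def)
    have Bz: "(LINT x:B n|lborel. w x) = 0" for n
    proof (cases "n \<in> to_nat_on C ` C")
      case True
      then obtain i where "i \<in> C" "n = to_nat_on C i" by auto
      then show ?thesis using C(2) Bball by (auto simp: K_def good_def)
    qed (simp add: B_def set_lebesgue_integral_def)
    have "(LINT x:(\<Union>n. B n)|lborel. w x) = (\<Sum>n. LINT x:B n|lborel. w x)"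
      using Bm by (intro lebesgue_integral_countable_add disj si) auto
    then have z: "(LINT x:(\<Union>n. B n)|lborel. w x) = 0" by (simp add: Bz)
    have sub: "(\<Union>n. B n) \<subseteq> U" using C(2) unfolding UB by (force simp: K_def)
    have "U - (\<Union>n. B n) \<subseteq> (U \<inter> Z - (\<Union>n. B n)) \<union> - Z" by auto
    then have "negligible (U - (\<Union>n. B n))"
      using C(4) negZ unfolding UB by (metis negligible_Un negligible_subset)
    moreover have "U - (\<Union>n. B n) \<in> sets borel" using U Bm by auto
    ultimately have "U - (\<Union>n. B n) \<in> null_sets lborel"
      by (simp add: negligible_iff_null_sets null_sets_completion_iff)
    then have "AE x in lborel. x \<notin> U - (\<Union>n. B n)" by (rule AE_not_in)
    then have "AE x in lborel. x \<in> U \<longleftrightarrow> x \<in> (\<Union>n. B n)"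
      by eventually_elim (use sub in auto)
    then have "(LINT x:U|lborel. w x) = (LINT x:(\<Union>n. B n)|lborel. w x)"
      using U Bm by (intro set_integral_cong_set[symmetric] sm) auto
    with z show ?thesis by simp
  qed
  \<comment> \<open>Open sets form an intersection-stable generator of the Borel sets, so vanishing
    passes to all of these by Dynkin induction; a density that integrates to 0 over every Borel set
    is 0 almost everywhere.\<close>
  have "(LINT x:A|lborel. w x) = 0" if A: "A \<in> sets lborel" for A
  proof -
    have "Int_stable {S :: 'a set. open S}" "{S :: 'a set. open S} \<subseteq> Pow UNIV"
      "A \<in> sigma_sets UNIV {S. open S}" using A by (auto simp: borel_def Int_stable_def)
    then show ?thesis
    proof (induction rule: sigma_sets_induct_disjoint)
      case (compl A)
      then have A: "A \<in> sets borel" by (simp add: borel_def)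
      have "(LINT x:(A \<union> (UNIV - A))|lborel. w x) = (LINT x:A|lborel. w x) + (LINT x:UNIV - A|lborel. w x)"
        using A by (intro set_integral_Un si) auto
      then show ?case using compl opn[of UNIV] by simp
    next
      case (union A)
      then have A: "A n \<in> sets borel" for n by (auto simp: borel_def)
      have "(LINT x:(\<Union>n. A n)|lborel. w x) = (\<Sum>n. LINT x:A n|lborel. w x)"
        using A union(1) by (intro lebesgue_integral_countable_add si) (auto simp: disjoint_family_on_def)
      then show ?case using union by simp
    qed (use opn[of "{}"] in \<open>auto intro: opn\<close>)
  qed
  then show ?thesis by (intro sigma_finite_measure.density_zero[OF sigma_finite_lborel w])
qed

section \<open>Positive definiteness of the Newton energy\<close>

lemma le_one_plus_square: "t \<le> 1 + t\<^sup>2" for t :: real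
proof -
  have "0 \<le> (t - 1/2)\<^sup>2" by simp
  then show ?thesis by (simp add: power2_diff) (simp add: field_simps power2_eq_square)
qed

text \<open>The indicator of a ball, written as a function of centre, point and radius together so
  that joint measurability in all three is immediate from the comparison of distances.\<close>

definition ball_ind :: "R3 \<Rightarrow> R3 \<Rightarrow> real \<Rightarrow> real" where
  "ball_ind z x r = (if dist z x < r then 1 else 0)"

definition radial_weight :: "real \<Rightarrow> real" where
  "radial_weight r = (if 0 < r then 1 / r ^ 5 else 0)"

lemma ball_ind_measurable [measurable (raw)]:
  assumes [measurable]: "f \<in> M \<rightarrow>\<^sub>M borel" "g \<in> M \<rightarrow>\<^sub>M borel" "h \<in> M \<rightarrow>\<^sub>M borel"
  shows "(\<lambda>x. ball_ind (f x) (g x) (h x)) \<in> borel_measurable M"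
  unfolding ball_ind_def by measurable

lemma radial_weight_measurable [measurable]: "radial_weight \<in> borel_measurable borel"
  unfolding radial_weight_def by measurable

lemma radial_weight_nonneg [simp]: "0 \<le> radial_weight r"
  by (simp add: radial_weight_def)

lemma ball_ind_nonneg [simp]: "0 \<le> ball_ind z x r"
  by (simp add: ball_ind_def)

text \<open>The volume of an intersection of balls is an integral over \<open>z\<close> of two
  indicators, and by symmetry of the distance \<open>z\<close> lies in the ball about
  \<open>x\<close> exactly if \<open>x\<close> lies in the ball about \<open>z\<close>. For fixed
  \<open>(z, r)\<close> the variables \<open>x\<close> and \<open>y\<close> are thereby
  separated.\<close>

lemma ball_kernel_eq_nn_integral:
  "(\<integral>\<^sup>+q. ennreal (radial_weight (snd q) * (ball_ind (fst q) x (snd q) * ball_ind (fst q) y (snd q)))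
      \<partial>(lborel \<Otimes>\<^sub>M lborel)) = ball_kernel x y"
proof -
  have "(\<integral>\<^sup>+q. ennreal (radial_weight (snd q) * (ball_ind (fst q) x (snd q) * ball_ind (fst q) y (snd q)))
      \<partial>(lborel \<Otimes>\<^sub>M lborel)) =
    (\<integral>\<^sup>+r. \<integral>\<^sup>+z. ennreal (radial_weight r * (ball_ind z x r * ball_ind z y r)) \<partial>lborel \<partial>lborel)"
    by (subst lborel_pair.nn_integral_snd[symmetric]) (simp_all)
  also have "\<dots> = (\<integral>\<^sup>+r. ennreal (radial_weight r) * emeasure lborel (ball x r \<inter> ball y r) \<partial>lborel)"
  proof (rule nn_integral_cong)
    fix r :: real
    have "(\<integral>\<^sup>+z. ennreal (radial_weight r * (ball_ind z x r * ball_ind z y r)) \<partial>lborel) =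
      (\<integral>\<^sup>+z. ennreal (radial_weight r) * indicator (ball x r \<inter> ball y r) z \<partial>lborel)"
      by (intro nn_integral_cong) (auto simp: ball_ind_def indicator_def dist_commute)
    also have "\<dots> = ennreal (radial_weight r) * emeasure lborel (ball x r \<inter> ball y r)"
      by (rule nn_integral_cmult_indicator) simp
    finally show "(\<integral>\<^sup>+z. ennreal (radial_weight r * (ball_ind z x r * ball_ind z y r)) \<partial>lborel) =
      ennreal (radial_weight r) * emeasure lborel (ball x r \<inter> ball y r)" .
  qed
  finally show ?thesis by (simp add: ball_kernel_def radial_weight_def)
qed

text \<open>A Borel field extended by zero to the whole space. Integrals over the domain become
  integrals against \<open>lborel\<close>, for whose products Fubini's theorem holds without
  completions.\<close>

locale square_integrable_field =
  fixes \<Omega> :: "R3 set" and w :: "R3 \<Rightarrow> R3"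
  assumes Om [measurable]: "\<Omega> \<in> sets borel" and fin: "emeasure lborel \<Omega> < \<infinity>"
    and w [measurable]: "w \<in> borel_measurable borel"
    and sq: "integrable lborel (\<lambda>x. (norm (w x))\<^sup>2)"
    and supp: "\<And>x. x \<notin> \<Omega> \<Longrightarrow> w x = 0"
begin

lemma newton_integrable: "integrable lborel (\<lambda>y. (1 / norm (x - y)) *\<^sub>R w y)"
proof (rule Bochner_Integration.integrable_bound)
  obtain C where C: "\<And>x. (\<integral>\<^sup>+y. ennreal (1 / (norm (x - y))\<^sup>2) * indicator \<Omega> y \<partial>lborel) \<le> ennreal C"
    using nn_integral_inverse_square_bound[OF Om fin] by blast
  have "(\<integral>\<^sup>+y. ennreal (norm (1 / (norm (x - y))\<^sup>2 * indicator \<Omega> y)) \<partial>lborel) =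
      (\<integral>\<^sup>+y. ennreal (1 / (norm (x - y))\<^sup>2) * indicator \<Omega> y \<partial>lborel)"
    by (intro nn_integral_cong) (auto simp: indicator_def)
  also have "\<dots> < \<infinity>" using C[of x] by (rule le_less_trans) simp
  finally have "integrable lborel (\<lambda>y. 1 / (norm (x - y))\<^sup>2 * indicator \<Omega> y)"
    by (intro integrableI_bounded) auto
  then show "integrable lborel (\<lambda>y. 1 / (norm (x - y))\<^sup>2 * indicator \<Omega> y + (norm (w y))\<^sup>2)"
    using sq by (rule Bochner_Integration.integrable_add)
  show "AE y in lborel. norm ((1 / norm (x - y)) *\<^sub>R w y) \<le>
      norm (1 / (norm (x - y))\<^sup>2 * indicator \<Omega> y + (norm (w y))\<^sup>2)"
  proof (rule AE_I2)
    fix y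
    have "1 / norm (x - y) * norm (w y) \<le> (1 / norm (x - y))\<^sup>2 + (norm (w y))\<^sup>2"
      by (rule mult_le_sum_squares)
    then show "norm ((1 / norm (x - y)) *\<^sub>R w y) \<le>
      norm (1 / (norm (x - y))\<^sup>2 * indicator \<Omega> y + (norm (w y))\<^sup>2)"
      by (cases "y \<in> \<Omega>") (auto simp: supp power_divide)
  qed
qed measurable

lemma field_integrable: "integrable lborel w"
proof (rule Bochner_Integration.integrable_bound)
  show "integrable lborel (\<lambda>x. indicator \<Omega> x + (norm (w x))\<^sup>2 :: real)"
    using fin sq by (intro Bochner_Integration.integrable_add) auto
  show "AE x in lborel. norm (w x) \<le> norm (indicator \<Omega> x + (norm (w x))\<^sup>2 :: real)"
  proof (rule AE_I2)
    fix x
    show "norm (w x) \<le> norm (indicator \<Omega> x + (norm (w x))\<^sup>2 :: real)"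
      using le_one_plus_square[of "norm (w x)"] by (cases "x \<in> \<Omega>") (auto simp: supp)
  qed
qed measurable

text \<open>The absolute convergence on which Fubini rests. The integrand is dominated by
  \<open>g x y + g y x\<close>, where \<open>g\<close> carries the square of \<open>w\<close> in one
  variable and the kernel in the other: integrating the kernel variable first gives a bound uniform
  in the pole, and the second term equals the first by Tonelli.\<close>

lemma newton_energy_finite:
  "(\<integral>\<^sup>+x. \<integral>\<^sup>+y. ennreal (norm (w x) * norm (w y) / norm (x - y)) \<partial>lborel \<partial>lborel) < \<infinity>"
proof -
  obtain C where C: "0 \<le> C"
    "\<And>x. (\<integral>\<^sup>+y. ennreal (1 / (norm (x - y))\<^sup>2) * indicator \<Omega> y \<partial>lborel) \<le> ennreal C"
    using nn_integral_inverse_square_bound[OF Om fin] by blast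
  define g where "g x y = (norm (w x))\<^sup>2 * indicator \<Omega> y * (1 + 1 / (norm (x - y))\<^sup>2)" for x y
  have gm [measurable]: "(\<lambda>(x, y). ennreal (g x y)) \<in> borel_measurable (lborel \<Otimes>\<^sub>M lborel)"
    unfolding g_def by measurable
  have g0: "0 \<le> g x y" for x y by (simp add: g_def)
  have gi: "(\<integral>\<^sup>+x. \<integral>\<^sup>+y. ennreal (g x y) \<partial>lborel \<partial>lborel) < \<infinity>"
  proof -
    have "(\<integral>\<^sup>+y. ennreal (g x y) \<partial>lborel) \<le> ennreal ((norm (w x))\<^sup>2) * (emeasure lborel \<Omega> + ennreal C)" for x
    proof -
      have "(\<integral>\<^sup>+y. ennreal (g x y) \<partial>lborel) = (\<integral>\<^sup>+y. ennreal ((norm (w x))\<^sup>2) *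
          (indicator \<Omega> y + ennreal (1 / (norm (x - y))\<^sup>2) * indicator \<Omega> y) \<partial>lborel)"
        by (intro nn_integral_cong) (auto simp: g_def indicator_def ennreal_mult)
      also have "\<dots> = ennreal ((norm (w x))\<^sup>2) * (emeasure lborel \<Omega> +
          (\<integral>\<^sup>+y. ennreal (1 / (norm (x - y))\<^sup>2) * indicator \<Omega> y \<partial>lborel))"
      proof -
        have k: "(\<lambda>y. ennreal (1 / (norm (x - y))\<^sup>2) * indicator \<Omega> y) \<in> borel_measurable lborel"
          using Om by (intro borel_measurable_times_ennreal borel_measurable_indicator) simp_all
        have i: "indicator \<Omega> \<in> borel_measurable lborel" using Om by simp
        show ?thesis
          unfolding nn_integral_cmult[OF borel_measurable_add[OF i k]] nn_integral_add[OF i k]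
          using Om by simp
      qed
      also have "\<dots> \<le> ennreal ((norm (w x))\<^sup>2) * (emeasure lborel \<Omega> + ennreal C)"
        using C(2) by (intro mult_left_mono add_left_mono) auto
      finally show ?thesis .
    qed
    then have "(\<integral>\<^sup>+x. \<integral>\<^sup>+y. ennreal (g x y) \<partial>lborel \<partial>lborel) \<le>
       (\<integral>\<^sup>+x. ennreal ((norm (w x))\<^sup>2) * (emeasure lborel \<Omega> + ennreal C) \<partial>lborel)"
      by (rule nn_integral_mono)
    also have "\<dots> = (\<integral>\<^sup>+x. ennreal ((norm (w x))\<^sup>2) \<partial>lborel) * (emeasure lborel \<Omega> + ennreal C)"
      by (rule nn_integral_multc) measurable
    also have "\<dots> < \<infinity>"
      using fin sq by (simp add: integrable_iff_bounded ennreal_mult_less_top)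
    finally show ?thesis .
  qed
  have "(\<integral>\<^sup>+x. \<integral>\<^sup>+y. ennreal (norm (w x) * norm (w y) / norm (x - y)) \<partial>lborel \<partial>lborel) \<le>
      (\<integral>\<^sup>+x. \<integral>\<^sup>+y. ennreal (g x y) + ennreal (g y x) \<partial>lborel \<partial>lborel)"
  proof (intro nn_integral_mono)
    fix x y
    have "norm (w x) * norm (w y) / norm (x - y) \<le> g x y + g y x"
    proof (cases "x \<in> \<Omega> \<and> y \<in> \<Omega>")
      case True
      have "norm (w x) * norm (w y) \<le> (norm (w x))\<^sup>2 + (norm (w y))\<^sup>2"
        by (rule mult_le_sum_squares)
      moreover have "1 / norm (x - y) \<le> 1 + 1 / (norm (x - y))\<^sup>2"
        using le_one_plus_square[of "1 / norm (x - y)"] by (simp add: power_divide)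
      ultimately have "norm (w x) * norm (w y) * (1 / norm (x - y)) \<le>
         ((norm (w x))\<^sup>2 + (norm (w y))\<^sup>2) * (1 + 1 / (norm (x - y))\<^sup>2)"
        by (intro mult_mono) auto
      then show ?thesis using True by (simp add: g_def norm_minus_commute distrib_right)
    qed (use g0[of x y] g0[of y x] in \<open>auto simp: supp\<close>)
    then show "ennreal (norm (w x) * norm (w y) / norm (x - y)) \<le> ennreal (g x y) + ennreal (g y x)"
      using g0 by (simp add: ennreal_leI flip: ennreal_plus)
  qed
  also have "\<dots> = (\<integral>\<^sup>+x. \<integral>\<^sup>+y. ennreal (g x y) \<partial>lborel \<partial>lborel) +
       (\<integral>\<^sup>+x. \<integral>\<^sup>+y. ennreal (g y x) \<partial>lborel \<partial>lborel)"
  proof -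
    have gm': "(\<lambda>(x, y). ennreal (g y x)) \<in> borel_measurable (lborel \<Otimes>\<^sub>M lborel)"
      unfolding g_def by measurable
    have m: "(\<lambda>y. ennreal (g x y)) \<in> borel_measurable lborel" "(\<lambda>y. ennreal (g y x)) \<in> borel_measurable lborel" for x
      unfolding g_def by measurable
    have M: "(\<lambda>x. \<integral>\<^sup>+y. ennreal (g x y) \<partial>lborel) \<in> borel_measurable lborel"
      "(\<lambda>x. \<integral>\<^sup>+y. ennreal (g y x) \<partial>lborel) \<in> borel_measurable lborel"
      using gm gm' by (auto intro: lborel.borel_measurable_nn_integral)
    show ?thesis unfolding nn_integral_add[OF m] nn_integral_add[OF M] ..
  qed
  also have "(\<integral>\<^sup>+x. \<integral>\<^sup>+y. ennreal (g y x) \<partial>lborel \<partial>lborel) =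
      (\<integral>\<^sup>+x. \<integral>\<^sup>+y. ennreal (g x y) \<partial>lborel \<partial>lborel)"
    using lborel_pair.Fubini'[of "\<lambda>x y. ennreal (g x y)"] gm by simp
  finally show ?thesis by (rule le_less_trans) (use gi in \<open>simp add: ennreal_add_eq_top less_top\<close>)
qed

text \<open>The function \<open>F\<close> is integrated in two orders: over
  \<open>q = (z, r)\<close> first it yields the energy density \<open>k\<close>, over
  \<open>p = (x, y)\<close> first a nonnegative multiple of the square of a ball integral. A
  nonpositive total then forces the latter to vanish almost everywhere.\<close>

theorem newton_energy_nonpos_imp_zero:
  assumes neg: "(LINT x|lborel. w x \<bullet> (LINT y|lborel. (1 / norm (x - y)) *\<^sub>R w y)) \<le> 0"
  shows "AE x in lborel. w x = 0"
proof -
  let ?L = "lborel \<Otimes>\<^sub>M lborel :: (R3 \<times> R3) measure"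
  let ?P = "lborel \<Otimes>\<^sub>M lborel :: (R3 \<times> real) measure"
  interpret XP: pair_sigma_finite ?L ?P
    unfolding lborel_prod ..
  have sfP: "sigma_finite_measure ?P"
    unfolding lborel_prod by (rule sigma_finite_lborel)
  define F where "F p q = radial_weight (snd q) * (ball_ind (fst q) (fst p) (snd q) * ball_ind (fst q) (snd p) (snd q))
      * (w (fst p) \<bullet> w (snd p))" for p :: "R3 \<times> R3" and q :: "R3 \<times> real"
  define u where "u q = (LINT x|lborel. ball_ind (fst q) x (snd q) *\<^sub>R w x)" for q
  define k where "k p = kernel_const * (w (fst p) \<bullet> w (snd p)) / norm (fst p - snd p)" for p
  have Fm [measurable]: "case_prod F \<in> borel_measurable (?L \<Otimes>\<^sub>M ?P)"
    unfolding F_def by measurable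
  have kc: "0 \<le> kernel_const" by (simp add: kernel_const_def)
  \<comment> \<open>The sign of \<open>F (x, y) q\<close> is that of
    \<open>w x \<bullet> w y\<close>, independent of \<open>q\<close>, so absolute values cost
    nothing in the integral over \<open>q\<close>.\<close>
  have inner: "(\<integral>\<^sup>+q. ennreal (norm (F (x, y) q)) \<partial>?P) = ennreal \<bar>k (x, y)\<bar>" if "x \<noteq> y" for x y
  proof -
    have "(\<integral>\<^sup>+q. ennreal (norm (F (x, y) q)) \<partial>?P) =
      (\<integral>\<^sup>+q. ennreal (radial_weight (snd q) * (ball_ind (fst q) x (snd q) * ball_ind (fst q) y (snd q))) *
        ennreal \<bar>w x \<bullet> w y\<bar> \<partial>?P)"
      by (intro nn_integral_cong) (simp add: F_def abs_mult ennreal_mult[symmetric])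
    also have "\<dots> = ball_kernel x y * ennreal \<bar>w x \<bullet> w y\<bar>"
      unfolding ball_kernel_eq_nn_integral[symmetric] by (rule nn_integral_multc) measurable
    also have "\<dots> = ennreal \<bar>k (x, y)\<bar>"
      using kc by (simp add: ball_kernel_eq[OF that] k_def abs_mult ennreal_mult[symmetric])
    finally show ?thesis .
  qed
  have Fi: "integrable (?L \<Otimes>\<^sub>M ?P) (case_prod F)"
  proof (rule integrableI_bounded)
    have "(\<integral>\<^sup>+r. ennreal (norm (case_prod F r)) \<partial>(?L \<Otimes>\<^sub>M ?P)) =
        (\<integral>\<^sup>+p. \<integral>\<^sup>+q. ennreal (norm (F p q)) \<partial>?P \<partial>?L)"
      by (subst sigma_finite_measure.nn_integral_fst[OF sfP, symmetric]) (auto simp: case_prod_beta)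
    also have "\<dots> = (\<integral>\<^sup>+x. \<integral>\<^sup>+y. \<integral>\<^sup>+q. ennreal (norm (F (x, y) q)) \<partial>?P \<partial>lborel \<partial>lborel)"
      by (subst lborel.nn_integral_fst[symmetric]) auto
    also have "\<dots> = (\<integral>\<^sup>+x. \<integral>\<^sup>+y. ennreal \<bar>k (x, y)\<bar> \<partial>lborel \<partial>lborel)"
    proof (rule nn_integral_cong, rule nn_integral_cong_AE)
      fix x
      show "AE y in lborel. (\<integral>\<^sup>+q. ennreal (norm (F (x, y) q)) \<partial>?P) = ennreal \<bar>k (x, y)\<bar>"
        using AE_lborel_singleton[of x] by eventually_elim (metis inner)
    qed
    also have "\<dots> \<le> (\<integral>\<^sup>+x. \<integral>\<^sup>+y. ennreal kernel_const * ennreal (norm (w x) * norm (w y) / norm (x - y))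
        \<partial>lborel \<partial>lborel)"
    proof (intro nn_integral_mono)
      fix x y
      have "\<bar>k (x, y)\<bar> = kernel_const * (\<bar>w x \<bullet> w y\<bar> / norm (x - y))"
        using kc by (simp add: k_def abs_mult)
      also have "\<dots> \<le> kernel_const * (norm (w x) * norm (w y) / norm (x - y))"
        by (intro mult_left_mono divide_right_mono Cauchy_Schwarz_ineq2 kc) simp
      finally have "ennreal \<bar>k (x, y)\<bar> \<le> ennreal (kernel_const * (norm (w x) * norm (w y) / norm (x - y)))"
        by (rule ennreal_leI)
      also have "\<dots> = ennreal kernel_const * ennreal (norm (w x) * norm (w y) / norm (x - y))"
        using kc by (intro ennreal_mult) auto
      finally show "ennreal \<bar>k (x, y)\<bar> \<le> ennreal kernel_const * ennreal (norm (w x) * norm (w y) / norm (x - y))" .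
    qed
    also have "\<dots> = ennreal kernel_const *
        (\<integral>\<^sup>+x. \<integral>\<^sup>+y. ennreal (norm (w x) * norm (w y) / norm (x - y)) \<partial>lborel \<partial>lborel)"
      by (simp add: nn_integral_cmult)
    also have "\<dots> < \<infinity>"
      using newton_energy_finite by (simp add: ennreal_mult_less_top)
    finally show "(\<integral>\<^sup>+r. ennreal (norm (case_prod F r)) \<partial>(?L \<Otimes>\<^sub>M ?P)) < \<infinity>" .
  qed measurable
  have Fk: "(LINT q|?P. F (x, y) q) = k (x, y)" if "x \<noteq> y" for x y
  proof -
    have "(LINT q|?P. radial_weight (snd q) * (ball_ind (fst q) x (snd q) * ball_ind (fst q) y (snd q))) =
        enn2real (ball_kernel x y)"
      unfolding ball_kernel_eq_nn_integral[symmetric] by (intro integral_eq_nn_integral) auto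
    then show ?thesis
      using kc by (simp add: F_def k_def ball_kernel_eq[OF that])
  qed
  have km [measurable]: "k \<in> borel_measurable ?L"
    unfolding k_def by measurable
  have "AE p in ?L. fst p \<noteq> snd p"
  proof (rule lborel_pair.AE_pair_measure)
    show "{p \<in> space ?L. fst p \<noteq> snd p} \<in> sets ?L" by measurable
    show "AE x in lborel. AE y in lborel. fst (x, y) \<noteq> snd (x, y :: R3)"
    proof (rule AE_I2)
      fix x :: R3
      show "AE y in lborel. fst (x, y) \<noteq> snd (x, y)"
        using AE_lborel_singleton[of x] by eventually_elim auto
    qed
  qed
  then have AEk: "AE p in ?L. (LINT q|?P. F p q) = k p"
  proof eventually_elim
    case (elim p)
    from Fk[OF this] show ?case by simp
  qed
  note iF = XP.integrable_fst[OF Fi]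
  have ki: "integrable ?L k"
    using iF integrable_cong_AE[OF borel_measurable_integrable[OF iF] km AEk] by simp
  have "(LINT p|?L. k p) = kernel_const * (LINT x|lborel. w x \<bullet> (LINT y|lborel. (1 / norm (x - y)) *\<^sub>R w y))"
  proof -
    have "(LINT p|?L. k p) = (LINT x|lborel. LINT y|lborel. k (x, y))"
      using lborel_pair.integral_fst'[OF ki] by simp
    also have "\<dots> = (LINT x|lborel. kernel_const * (w x \<bullet> (LINT y|lborel. (1 / norm (x - y)) *\<^sub>R w y)))"
    proof (intro Bochner_Integration.integral_cong refl)
      fix x
      have "(LINT y|lborel. k (x, y)) = (LINT y|lborel. (kernel_const *\<^sub>R w x) \<bullet> ((1 / norm (x - y)) *\<^sub>R w y))"
        by (simp add: k_def)
      also have "\<dots> = (kernel_const *\<^sub>R w x) \<bullet> (LINT y|lborel. (1 / norm (x - y)) *\<^sub>R w y)"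
        using newton_integrable by (intro integral_inner_right) auto
      finally show "(LINT y|lborel. k (x, y)) = kernel_const * (w x \<bullet> (LINT y|lborel. (1 / norm (x - y)) *\<^sub>R w y))"
        by simp
    qed
    finally show ?thesis by simp
  qed
  then have k_neg: "(LINT p|?L. k p) \<le> 0"
    using neg kc by (simp add: mult_nonneg_nonpos)
  have "(LINT p|?L. LINT q|?P. F p q) = (LINT p|?L. k p)"
    by (rule integral_cong_AE[OF borel_measurable_integrable[OF iF] km AEk])
  then have R_neg: "(LINT q|?P. LINT p|?L. F p q) \<le> 0"
    using XP.Fubini_integral[OF Fi] k_neg by simp
  \<comment> \<open>For fixed \<open>q\<close> the integrand is a product of a function of
    \<open>x\<close> and one of \<open>y\<close>, so the double integral is the weighted square of
    the ball integral \<open>u q\<close>. Iterating it needs an integrable slice, which is available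
    for almost every \<open>q\<close>.\<close>
  have Fu: "AE q in ?P. (LINT p|?L. F p q) = radial_weight (snd q) * (u q \<bullet> u q)"
    using XP.AE_integrable_snd[OF Fi]
  proof eventually_elim
    case (elim q)
    have wi: "integrable lborel (\<lambda>x. ball_ind (fst q) x (snd q) *\<^sub>R w x)"
      using field_integrable by (rule Bochner_Integration.integrable_bound) (auto simp: ball_ind_def)
    have "(LINT p|?L. F p q) = (LINT x|lborel. LINT y|lborel. F (x, y) q)"
      using lborel_pair.integral_fst'[OF elim] by simp
    also have "\<dots> = (LINT x|lborel. LINT y|lborel. (radial_weight (snd q) *\<^sub>R (ball_ind (fst q) x (snd q) *\<^sub>R w x)) \<bullet>
        (ball_ind (fst q) y (snd q) *\<^sub>R w y))"
      by (simp add: F_def mult_ac)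
    also have "\<dots> = (LINT x|lborel. (radial_weight (snd q) *\<^sub>R (ball_ind (fst q) x (snd q) *\<^sub>R w x)) \<bullet> u q)"
      unfolding u_def by (subst integral_inner_right) (use wi in auto)
    also have "\<dots> = (radial_weight (snd q) *\<^sub>R u q) \<bullet> u q"
      by (subst integral_inner_left[OF integrable_scaleR_right[OF wi]]) (simp only: integral_scaleR_right u_def)
    finally show ?case by simp
  qed
  have Ri: "integrable ?P (\<lambda>q. LINT p|?L. F p q)"
    using XP.integrable_snd[OF Fi] .
  have nn: "AE q in ?P. 0 \<le> (LINT p|?L. F p q)"
    using Fu by eventually_elim simp
  have "(LINT q|?P. LINT p|?L. F p q) = 0"
    using R_neg integral_nonneg_AE[OF nn] by simp
  then have "AE q in ?P. (LINT p|?L. F p q) = 0"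
    using integral_nonneg_eq_0_iff_AE[OF Ri nn] by simp
  \<comment> \<open>The weight is strictly positive for positive radii and can be cancelled
    there.\<close>
  with Fu have "AE q in ?P. 0 < snd q \<longrightarrow> u q = 0"
    by eventually_elim (auto simp: radial_weight_def)
  then have "AE z in lborel. AE r in lborel. 0 < snd (z, r) \<longrightarrow> u (z, r) = 0"
    by (rule lborel_pair.AE_pair)
  moreover have "u (z, r) = (LINT x:ball z r|lborel. w x)" for z r
    unfolding u_def set_lebesgue_integral_def
    by (intro Bochner_Integration.integral_cong) (auto simp: ball_ind_def indicator_def)
  ultimately show ?thesis
    by (intro AE_zero_of_ball_integrals field_integrable) simp
qed

end

section \<open>The operator A on a bounded open domain\<close>

lemma integral_lebesgue_on_eq_lborel:
  fixes F :: "'a::euclidean_space \<Rightarrow> 'b::{banach, second_countable_topology}"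
  assumes "S \<in> sets lebesgue" "F \<in> borel_measurable borel" "\<And>x. x \<notin> S \<Longrightarrow> F x = 0"
  shows "(LINT x|lebesgue_on S. F x) = (LINT x|lborel. F x)"
    and "integrable (lebesgue_on S) F \<longleftrightarrow> integrable lborel F"
proof -
  have F: "(\<lambda>x. indicator S x *\<^sub>R F x) = F"
    using assms(3) by (auto simp: indicator_def)
  show "(LINT x|lebesgue_on S. F x) = (LINT x|lborel. F x)"
    using assms(1,2) F by (simp add: integral_restrict_space integral_completion)
  show "integrable (lebesgue_on S) F \<longleftrightarrow> integrable lborel F"
    using assms(1,2) F by (simp add: integrable_restrict_space integrable_completion)
qed

lemma AE_lborel_imp_AE_lebesgue_on:
  assumes "S \<in> sets lebesgue" "AE x in lborel. P x"
  shows "AE x in lebesgue_on S. P x"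
  using AE_completion[OF assms(2)] assms(1) by (auto simp: AE_restrict_space_iff elim: eventually_mono)

text \<open>A Lebesgue measurable real function equals a Borel function almost everywhere; this is
  applied to each coordinate of the extension of \<open>v\<close> by zero.\<close>

lemma ex_borel_representative:
  fixes v :: "'a::euclidean_space \<Rightarrow> real ^ 'n"
  assumes S: "S \<in> sets borel" and v: "v \<in> borel_measurable (lebesgue_on S)"
  obtains w where "w \<in> borel_measurable borel" "\<And>x. x \<notin> S \<Longrightarrow> w x = 0"
    "AE x in lebesgue_on S. w x = v x"
proof -
  have SL: "S \<in> sets lebesgue" using S by simp
  have "\<exists>g\<in>borel_measurable lborel. AE x in lborel. (if x \<in> S then v x $ i else 0) = g x" for i
  proof (rule completion_ex_borel_measurable_real)
    have "(\<lambda>x. v x $ i) \<in> borel_measurable (lebesgue_on S)"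
      using v by (simp add: cart_eq_inner_axis)
    then show "(\<lambda>x. if x \<in> S then v x $ i else 0) \<in> borel_measurable lebesgue"
      by (subst borel_measurable_if[OF SL])
  qed
  then have "\<forall>i. \<exists>g. g \<in> borel_measurable lborel \<and> (AE x in lborel. (if x \<in> S then v x $ i else 0) = g x)"
    by blast
  from choice[OF this] obtain g where g: "\<And>i. g i \<in> borel_measurable lborel"
    "\<And>i. AE x in lborel. (if x \<in> S then v x $ i else 0) = g i x"
    by blast
  \<comment> \<open>The \<open>g i\<close> vanish outside \<open>S\<close> only almost everywhere,
    whereas vanishing at every point is wanted; hence the second cut-off.\<close>
  define w where "w x = (if x \<in> S then \<chi> i. g i x else 0)" for x
  have "AE x in lborel. \<forall>i. (if x \<in> S then v x $ i else 0) = g i x"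
    using g(2) by (simp add: AE_all_countable)
  then have "AE x in lebesgue_on S. \<forall>i. (if x \<in> S then v x $ i else 0) = g i x"
    by (rule AE_lborel_imp_AE_lebesgue_on[OF SL])
  moreover have "AE x in lebesgue_on S. x \<in> S"
    using SL by (intro AE_I2) (simp add: space_restrict_space)
  ultimately have "AE x in lebesgue_on S. w x = v x"
    by eventually_elim (simp add: w_def vec_eq_iff)
  moreover have "w \<in> borel_measurable borel"
    unfolding w_def
  proof (rule measurable_If_set)
    show "(\<lambda>x. \<chi> i. g i x) \<in> borel_measurable borel"
      using g(1) by (subst borel_measurable_euclidean_space) (auto simp: Basis_vec_def inner_axis)
  qed (use S in auto)
  ultimately show thesis using that[of w] by (simp add: w_def)
qed

lemma Linf_plusE:
  assumes "\<eta> \<in> Linf_plus \<Omega>"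
  obtains c C where "0 < c" "AE x in lebesgue_on \<Omega>. c \<le> \<eta> x" "AE x in lebesgue_on \<Omega>. \<bar>\<eta> x\<bar> \<le> C"
    "\<eta> \<in> borel_measurable (lebesgue_on \<Omega>)"
  using assms unfolding Linf_plus_def by blast

locale bounded_open_domain =
  fixes \<Omega> :: "R3 set"
  assumes open_domain: "open \<Omega>" and bounded_domain: "bounded \<Omega>"
begin

lemma domain_borel [measurable]: "\<Omega> \<in> sets borel"
  using open_domain by simp

lemma domain_lebesgue [measurable]: "\<Omega> \<in> sets lebesgue"
  using open_domain by simp

lemma domain_lmeasurable: "\<Omega> \<in> lmeasurable"
  using bounded_domain domain_lebesgue by (rule bounded_set_imp_lmeasurable)

lemma domain_finite: "emeasure lborel \<Omega> < \<infinity>"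
  using emeasure_bounded_finite[OF bounded_domain] by simp

lemma L2_field_representative:
  assumes v: "v \<in> L2 \<Omega>"
  obtains w where "square_integrable_field \<Omega> w" "AE x in lebesgue_on \<Omega>. w x = v x"
proof -
  obtain w where w: "w \<in> borel_measurable borel" "\<And>x. x \<notin> \<Omega> \<Longrightarrow> w x = 0"
    "AE x in lebesgue_on \<Omega>. w x = v x"
    using ex_borel_representative[OF domain_borel L2D(1)[OF v]] by blast
  have wl: "w \<in> borel_measurable (lebesgue_on \<Omega>)"
    using w(1) by (simp add: measurable_restrict_space1 measurable_completion)
  have "integrable (lebesgue_on \<Omega>) (\<lambda>x. (norm (w x))\<^sup>2) \<longleftrightarrow> integrable (lebesgue_on \<Omega>) (\<lambda>x. (norm (v x))\<^sup>2)"
    by (rule integrable_cong_AE) (use wl L2D(1)[OF v] w(3) in auto)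
  then have "integrable lborel (\<lambda>x. (norm (w x))\<^sup>2)"
    using integral_lebesgue_on_eq_lborel(2)[OF domain_lebesgue, of "\<lambda>x. (norm (w x))\<^sup>2"] w(1,2) L2D(2)[OF v]
    by simp
  then have "square_integrable_field \<Omega> w"
    using w domain_finite by unfold_locales auto
  then show thesis using w(3) by (rule that)
qed

lemma A_op_representative:
  assumes w: "square_integrable_field \<Omega> w" and v: "v \<in> L2 \<Omega>" and ae: "AE x in lebesgue_on \<Omega>. w x = v x"
  shows "A_op \<mu> \<Omega> v x = (\<mu> / (4 * pi)) *\<^sub>R (LINT y|lborel. (1 / norm (x - y)) *\<^sub>R w y)"
proof -
  interpret square_integrable_field \<Omega> w by fact
  have wl: "w \<in> borel_measurable (lebesgue_on \<Omega>)"
    using w by (simp add: measurable_restrict_space1 measurable_completion)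
  have k: "(\<lambda>y. 1 / norm (x - y)) \<in> borel_measurable (lebesgue_on \<Omega>)"
    by (intro measurable_restrict_space1 measurable_completion) simp
  have "(LINT y|lebesgue_on \<Omega>. (1 / norm (x - y)) *\<^sub>R v y) = (LINT y|lebesgue_on \<Omega>. (1 / norm (x - y)) *\<^sub>R w y)"
    using ae by (intro integral_cong_AE borel_measurable_scaleR k wl L2D(1)[OF v]) auto
  also have "\<dots> = (LINT y|lborel. (1 / norm (x - y)) *\<^sub>R w y)"
    by (intro integral_lebesgue_on_eq_lborel domain_lebesgue) (auto simp: supp)
  finally show ?thesis by (simp add: A_op_def)
qed

lemma newton_borel:
  assumes "square_integrable_field \<Omega> w"
  shows "(\<lambda>x. LINT y|lborel. (1 / norm (x - y)) *\<^sub>R w y) \<in> borel_measurable borel"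
proof -
  interpret square_integrable_field \<Omega> w by fact
  have "(\<lambda>x. LINT y|lborel. (1 / norm (x - y)) *\<^sub>R w y) \<in> borel_measurable lborel"
    by (rule lborel.borel_measurable_lebesgue_integral) measurable
  then show ?thesis by simp
qed

lemma A_op_measurable:
  assumes v: "v \<in> L2 \<Omega>"
  shows "A_op \<mu> \<Omega> v \<in> borel_measurable (lebesgue_on \<Omega>)"
proof -
  obtain w where rep: "square_integrable_field \<Omega> w" "AE x in lebesgue_on \<Omega>. w x = v x"
    using L2_field_representative[OF v] by blast
  have "A_op \<mu> \<Omega> v = (\<lambda>x. (\<mu> / (4 * pi)) *\<^sub>R (LINT y|lborel. (1 / norm (x - y)) *\<^sub>R w y))"
    using A_op_representative[OF rep(1) v rep(2)] by auto
  also have "\<dots> \<in> borel_measurable (lebesgue_on \<Omega>)"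
    using newton_borel[OF rep(1)] by (intro measurable_restrict_space1 measurable_completion) simp
  finally show ?thesis .
qed

lemma A_op_nonpos_imp_zero:
  assumes v: "v \<in> L2 \<Omega>" and \<mu>: "0 < \<mu>" and neg: "L2_inner \<Omega> (A_op \<mu> \<Omega> v) v \<le> 0"
  shows "AE x in lebesgue_on \<Omega>. v x = 0"
proof -
  obtain w where rep: "square_integrable_field \<Omega> w" "AE x in lebesgue_on \<Omega>. w x = v x"
    using L2_field_representative[OF v] by blast
  interpret square_integrable_field \<Omega> w by fact
  let ?N = "\<lambda>x. LINT y|lborel. (1 / norm (x - y)) *\<^sub>R w y"
  have wl: "w \<in> borel_measurable (lebesgue_on \<Omega>)"
    by (simp add: measurable_restrict_space1 measurable_completion)
  have "L2_inner \<Omega> (A_op \<mu> \<Omega> v) v = (LINT x|lebesgue_on \<Omega>. A_op \<mu> \<Omega> v x \<bullet> w x)"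
    unfolding L2_inner_def using rep(2)
    by (intro integral_cong_AE borel_measurable_inner A_op_measurable wl v L2D(1)[OF v]) auto
  also have "\<dots> = (LINT x|lebesgue_on \<Omega>. (\<mu> / (4 * pi)) * (w x \<bullet> ?N x))"
    by (simp add: A_op_representative[OF rep(1) v rep(2)] inner_commute)
  also have "\<dots> = (\<mu> / (4 * pi)) * (LINT x|lebesgue_on \<Omega>. w x \<bullet> ?N x)"
    by simp
  also have "(LINT x|lebesgue_on \<Omega>. w x \<bullet> ?N x) = (LINT x|lborel. w x \<bullet> ?N x)"
    using newton_borel[OF rep(1)]
    by (intro integral_lebesgue_on_eq_lborel domain_lebesgue) (auto simp: supp)
  finally have le: "(\<mu> / (4 * pi)) * (LINT x|lborel. w x \<bullet> ?N x) \<le> 0" using neg by simp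
  have "0 < \<mu> / (4 * pi)" using \<mu> by simp
  from mult_pos_pos[OF this] le have "(LINT x|lborel. w x \<bullet> ?N x) \<le> 0"
    by (meson not_le)
  then have "AE x in lborel. w x = 0"
    by (rule newton_energy_nonpos_imp_zero)
  from AE_lborel_imp_AE_lebesgue_on[OF domain_lebesgue this] rep(2)
  show ?thesis by eventually_elim simp
qed

lemma newton_kernel_L2:
  obtains B where "\<And>x. (\<lambda>y. 1 / norm (x - y)) \<in> L2 \<Omega>"
    "\<And>x. (L2_norm \<Omega> (\<lambda>y. 1 / norm (x - y)))\<^sup>2 \<le> B"
proof -
  obtain C where C: "0 \<le> C"
    "\<And>x. (\<integral>\<^sup>+y. ennreal (1 / (norm (x - y))\<^sup>2) * indicator \<Omega> y \<partial>lborel) \<le> ennreal C"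
    using nn_integral_inverse_square_bound[OF domain_borel domain_finite] by blast
  have m: "(\<lambda>y. 1 / norm (x - y)) \<in> borel_measurable (lebesgue_on \<Omega>)" for x
    by (intro measurable_restrict_space1 measurable_completion) simp
  have le: "(\<integral>\<^sup>+y. ennreal ((norm (1 / norm (x - y)))\<^sup>2) \<partial>lebesgue_on \<Omega>) \<le> ennreal C" for x
  proof -
    have "(\<lambda>y. ennreal (1 / (norm (x - y))\<^sup>2) * indicator \<Omega> y) \<in> borel_measurable borel"
      by (intro borel_measurable_times_ennreal borel_measurable_indicator) simp_all
    then show ?thesis
      using C(2)[of x] by (simp add: nn_integral_restrict_space nn_integral_completion power_divide)
  qed
  have i: "integrable (lebesgue_on \<Omega>) (\<lambda>y. (norm (1 / norm (x - y)))\<^sup>2)" for x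
  proof (rule integrableI_bounded)
    show "(\<integral>\<^sup>+y. ennreal (norm ((norm (1 / norm (x - y)))\<^sup>2)) \<partial>lebesgue_on \<Omega>) < \<infinity>"
      using le_less_trans[OF le[of x] ennreal_less_top] by simp
  qed (use m in measurable)
  have "ennreal ((L2_norm \<Omega> (\<lambda>y. 1 / norm (x - y)))\<^sup>2) \<le> ennreal C" for x
    unfolding L2_norm_power2 using le[of x] by (subst nn_integral_eq_integral[OF i, symmetric]) auto
  then have "(L2_norm \<Omega> (\<lambda>y. 1 / norm (x - y)))\<^sup>2 \<le> C" for x
    using C(1) by simp
  moreover have "(\<lambda>y. 1 / norm (x - y)) \<in> L2 \<Omega>" for x
    using m i by (simp add: L2_def)
  ultimately show thesis by (rule that[rotated])
qed

end

section \<open>The space of solenoidal fields\<close>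

lemma H_L_subset_L2: "H_L \<Omega> \<subseteq> L2 \<Omega>"
  by (auto simp: H_L_def)

lemma L2_of_continuous:
  fixes g :: "R3 \<Rightarrow> 'b::euclidean_space"
  assumes "bounded_open_domain \<Omega>" and g: "continuous_on UNIV g"
  shows "g \<in> L2 \<Omega>"
proof -
  interpret bounded_open_domain \<Omega> by fact
  interpret finite_measure "lebesgue_on \<Omega>"
    using domain_lmeasurable by (rule finite_measure_lebesgue_on)
  have m: "g \<in> borel_measurable (lebesgue_on \<Omega>)"
    using borel_measurable_continuous_onI[OF g] by (simp add: measurable_restrict_space1 measurable_completion)
  have "compact (closure \<Omega>)" using bounded_domain by simp
  then have "bounded (g ` closure \<Omega>)"
    using g by (intro compact_imp_bounded compact_continuous_image) (auto intro: continuous_on_subset)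
  then obtain B where B: "\<And>x. x \<in> closure \<Omega> \<Longrightarrow> norm (g x) \<le> B"
    by (auto simp: bounded_iff)
  have "integrable (lebesgue_on \<Omega>) (\<lambda>x. (norm (g x))\<^sup>2)"
  proof (rule integrable_const_bound)
    show "AE x in lebesgue_on \<Omega>. norm ((norm (g x))\<^sup>2) \<le> B\<^sup>2"
    proof (rule AE_I2)
      fix x assume "x \<in> space (lebesgue_on \<Omega>)"
      then have "norm (g x) \<le> B" using B closure_subset by (auto simp: space_restrict_space)
      then show "norm ((norm (g x))\<^sup>2) \<le> B\<^sup>2" by (simp add: power_mono)
    qed
  qed (use m in measurable)
  with m show ?thesis by (simp add: L2_def)
qed

lemma grad_test_function_L2:
  assumes "bounded_open_domain \<Omega>" "\<psi> \<in> test_functions \<Omega>"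
  shows "grad \<psi> \<in> L2 \<Omega>"
proof (rule L2_of_continuous[OF assms(1)])
  have "C_k (Suc 0) \<psi>" using assms(2) unfolding test_functions_def by blast
  then have "continuous_on UNIV (partial i \<psi>)" for i by simp
  then show "continuous_on UNIV (grad \<psi>)"
    unfolding grad_def[abs_def] by (intro continuous_on_vec_lambda) auto
qed

text \<open>The constraints cutting out \<open>H_L\<close> are orthogonality relations in \<open>L2\<close>.\<close>

definition H_L_tests :: "R3 set \<Rightarrow> (R3 \<Rightarrow> R3) set" where
  "H_L_tests \<Omega> = grad ` test_functions \<Omega> \<union> {g \<in> L2 \<Omega>. \<exists>\<phi>\<in>L2 \<Omega>. has_weak_grad \<Omega> \<phi> g}"

lemma H_L_tests_L2: "bounded_open_domain \<Omega> \<Longrightarrow> H_L_tests \<Omega> \<subseteq> L2 \<Omega>"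
  by (auto simp: H_L_tests_def grad_test_function_L2)

text \<open>With divergence 0 the term \<open>d x * \<phi> x\<close> drops out of Green's formula,
  so both constraints become orthogonality to gradients.\<close>

lemma H_L_iff: "v \<in> H_L \<Omega> \<longleftrightarrow> v \<in> L2 \<Omega> \<and> (\<forall>g\<in>H_L_tests \<Omega>. L2_inner \<Omega> v g = 0)"
  unfolding H_L_def H_L_tests_def has_weak_div_def normal_trace_zero_def L2_inner_def by auto

context bounded_open_domain
begin

sublocale L2: semi_inner_space "L2 \<Omega>" "L2_inner \<Omega> :: (R3 \<Rightarrow> R3) \<Rightarrow> _"
  by (rule semi_inner_space_L2)

lemma H_L_zero: "(\<lambda>x. 0) \<in> H_L \<Omega>"
  by (auto simp: H_L_iff L2_zero L2_inner_def)

lemma H_L_add: "u \<in> H_L \<Omega> \<Longrightarrow> v \<in> H_L \<Omega> \<Longrightarrow> (\<lambda>x. u x + v x) \<in> H_L \<Omega>"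
  using H_L_tests_L2[OF bounded_open_domain_axioms] by (auto simp: H_L_iff L2_add L2.ip_add subset_iff)

lemma H_L_scale: "u \<in> H_L \<Omega> \<Longrightarrow> (\<lambda>x. c *\<^sub>R u x) \<in> H_L \<Omega>"
  using H_L_tests_L2[OF bounded_open_domain_axioms] by (auto simp: H_L_iff L2_scale L2.ip_scale subset_iff)

text \<open>An intersection of kernels of functionals \<open>L2_inner \<Omega> v g\<close> in
  \<open>v\<close>, each of which is continuous by Cauchy--Schwarz.\<close>

lemma H_L_closed:
  assumes "\<And>n. v n \<in> H_L \<Omega>" and w: "w \<in> L2 \<Omega>"
    and lim: "(\<lambda>n. L2_norm \<Omega> (\<lambda>x. v n x - w x)) \<longlonglongrightarrow> 0"
  shows "w \<in> H_L \<Omega>"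
  unfolding H_L_iff
proof (intro conjI ballI w)
  fix g assume g: "g \<in> H_L_tests \<Omega>"
  then have gL: "g \<in> L2 \<Omega>" using H_L_tests_L2[OF bounded_open_domain_axioms] by blast
  have vL: "v n \<in> L2 \<Omega>" for n using assms(1) H_L_subset_L2 by blast
  have "\<bar>L2_inner \<Omega> w g\<bar> \<le> L2_norm \<Omega> (\<lambda>x. v n x - w x) * L2_norm \<Omega> g" for n
  proof -
    have "L2_inner \<Omega> (\<lambda>x. v n x - w x) g = - L2_inner \<Omega> w g"
      using assms(1)[of n] g by (simp add: L2.ip_diff vL w gL H_L_iff)
    then show ?thesis
      using L2.Cauchy_Schwarz[OF L2.diff_mem[OF vL[of n] w] gL] by (simp add: L2_norm_eq_ip_norm)
  qed
  moreover have "(\<lambda>n. L2_norm \<Omega> (\<lambda>x. v n x - w x) * L2_norm \<Omega> g) \<longlonglongrightarrow> 0 * L2_norm \<Omega> g"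
    by (intro tendsto_mult lim tendsto_const)
  ultimately have "\<bar>L2_inner \<Omega> w g\<bar> \<le> 0"
    by (intro LIMSEQ_le_const) auto
  then show "L2_inner \<Omega> w g = 0" by simp
qed

end

section \<open>The inner product weighted by \<open>\<eta>\<close>\<close>

locale weighted_domain = bounded_open_domain +
  fixes \<eta> :: "R3 \<Rightarrow> real"
  assumes weight: "\<eta> \<in> Linf_plus \<Omega>"
begin

definition wip :: "(R3 \<Rightarrow> R3) \<Rightarrow> (R3 \<Rightarrow> R3) \<Rightarrow> real" where
  "wip u v = L2_inner \<Omega> (\<lambda>x. \<eta> x *\<^sub>R u x) v"

lemma weight_nonneg: "AE x in lebesgue_on \<Omega>. 0 \<le> \<eta> x"
proof -
  obtain c C where c: "0 < c" "AE x in lebesgue_on \<Omega>. c \<le> \<eta> x" "AE x in lebesgue_on \<Omega>. \<bar>\<eta> x\<bar> \<le> C"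
    "\<eta> \<in> borel_measurable (lebesgue_on \<Omega>)"
    using Linf_plusE[OF weight] .
  from c(2) show ?thesis by eventually_elim (use c(1) in simp)
qed

lemma weight_measurable: "\<eta> \<in> borel_measurable (lebesgue_on \<Omega>)"
  using weight by (simp add: Linf_plus_def)

lemma weight_L2: "u \<in> L2 \<Omega> \<Longrightarrow> (\<lambda>x. \<eta> x *\<^sub>R u x) \<in> L2 \<Omega>" for u :: "R3 \<Rightarrow> 'b::euclidean_space"
proof -
  assume u: "u \<in> L2 \<Omega>"
  obtain C where "AE x in lebesgue_on \<Omega>. \<bar>\<eta> x\<bar> \<le> C"
    using weight unfolding Linf_plus_def by blast
  with u show ?thesis by (intro L2_mult_bounded weight_measurable)
qed

sublocale W: semi_inner_space "L2 \<Omega>" wip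
proof -
  obtain C where "AE x in lebesgue_on \<Omega>. \<bar>\<eta> x\<bar> \<le> C"
    using weight unfolding Linf_plus_def by blast
  then show "semi_inner_space (L2 \<Omega>) wip"
    unfolding wip_def[abs_def] using weight_measurable weight_nonneg by (intro semi_inner_space_L2_weighted)
qed

lemma eta_norm_eq: "eta_norm \<Omega> \<eta> v = ip_norm wip v"
  by (simp add: eta_norm_def ip_norm_def wip_def)

lemma wip_eq_integral: "wip u v = (LINT x|lebesgue_on \<Omega>. \<eta> x * (u x \<bullet> v x))"
  by (simp add: wip_def L2_inner_def)

lemma wip_alt: "L2_inner \<Omega> u (\<lambda>x. \<eta> x *\<^sub>R v x) = wip u v"
  by (simp add: wip_def L2_inner_def)

text \<open>Equivalence of the weighted and the plain norm, through which completeness, closedness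
  and measurability are moved from one to the other.\<close>

lemma wip_bounds:
  obtains c C where "0 < c" "\<And>u. u \<in> L2 \<Omega> \<Longrightarrow> c * (L2_norm \<Omega> u)\<^sup>2 \<le> wip u u"
    "\<And>u. u \<in> L2 \<Omega> \<Longrightarrow> wip u u \<le> C * (L2_norm \<Omega> u)\<^sup>2"
proof -
  obtain c C where c: "0 < c" "AE x in lebesgue_on \<Omega>. c \<le> \<eta> x" "AE x in lebesgue_on \<Omega>. \<bar>\<eta> x\<bar> \<le> C"
    "\<eta> \<in> borel_measurable (lebesgue_on \<Omega>)"
    using Linf_plusE[OF weight] .
  have i: "integrable (lebesgue_on \<Omega>) (\<lambda>x. \<eta> x * (norm (u x))\<^sup>2)" if u: "u \<in> L2 \<Omega>" for u :: "R3 \<Rightarrow> R3"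
    using L2_inner_integrable[OF weight_L2[OF u] u] by (simp add: power2_norm_eq_inner)
  have eq: "wip u u = (LINT x|lebesgue_on \<Omega>. \<eta> x * (norm (u x))\<^sup>2)" for u
    by (simp add: wip_eq_integral power2_norm_eq_inner)
  show thesis
  proof (rule that[OF c(1)])
    fix u :: "R3 \<Rightarrow> R3" assume u: "u \<in> L2 \<Omega>"
    show "c * (L2_norm \<Omega> u)\<^sup>2 \<le> wip u u"
      unfolding L2_norm_power2 eq integral_mult_right_zero[symmetric]
      by (intro integral_mono_AE i u integrable_mult_right L2D(2))
        (use c(2) in eventually_elim, simp add: mult_right_mono)
    show "wip u u \<le> C * (L2_norm \<Omega> u)\<^sup>2"
      unfolding L2_norm_power2 eq integral_mult_right_zero[symmetric]
      by (intro integral_mono_AE i u integrable_mult_right L2D(2))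
        (use c(3) in eventually_elim, simp add: mult_right_mono)
  qed
qed

text \<open>One limit serves both norms: plain convergence keeps it in the closed space
  \<open>H_L\<close>, weighted convergence is what the expansion in the \<open>j n\<close>
  uses.\<close>

lemma wip_complete:
  fixes v :: "nat \<Rightarrow> R3 \<Rightarrow> R3"
  assumes v: "\<And>n. v n \<in> L2 \<Omega>"
    and Cauchy: "\<And>\<epsilon>. 0 < \<epsilon> \<Longrightarrow> \<exists>N. \<forall>m\<ge>N. \<forall>n\<ge>N. wip (\<lambda>x. v m x - v n x) (\<lambda>x. v m x - v n x) < \<epsilon>"
  obtains w where "w \<in> L2 \<Omega>" "(\<lambda>n. L2_norm \<Omega> (\<lambda>x. v n x - w x)) \<longlonglongrightarrow> 0"
    "(\<lambda>n. ip_norm wip (\<lambda>x. v n x - w x)) \<longlonglongrightarrow> 0"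
proof -
  obtain c C where c: "0 < c" "\<And>u. u \<in> L2 \<Omega> \<Longrightarrow> c * (L2_norm \<Omega> u)\<^sup>2 \<le> wip u u"
    "\<And>u. u \<in> L2 \<Omega> \<Longrightarrow> wip u u \<le> C * (L2_norm \<Omega> u)\<^sup>2"
    by (rule wip_bounds) blast
  have "\<exists>N. \<forall>m\<ge>N. \<forall>n\<ge>N. L2_norm \<Omega> (\<lambda>x. v m x - v n x) < \<epsilon>" if \<epsilon>: "0 < \<epsilon>" for \<epsilon>
  proof -
    obtain N where N: "\<forall>m\<ge>N. \<forall>n\<ge>N. wip (\<lambda>x. v m x - v n x) (\<lambda>x. v m x - v n x) < c * \<epsilon>\<^sup>2"
      using Cauchy[of "c * \<epsilon>\<^sup>2"] c(1) \<epsilon> by auto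
    have "L2_norm \<Omega> (\<lambda>x. v m x - v n x) < \<epsilon>" if mn: "m \<ge> N" "n \<ge> N" for m n
    proof -
      have "c * (L2_norm \<Omega> (\<lambda>x. v m x - v n x))\<^sup>2 < c * \<epsilon>\<^sup>2"
        using c(2)[OF L2.diff_mem[OF v[of m] v[of n]]] N mn by (meson le_less_trans)
      then have "(L2_norm \<Omega> (\<lambda>x. v m x - v n x))\<^sup>2 < \<epsilon>\<^sup>2" using c(1) by simp
      then show ?thesis by (rule power2_less_imp_less) (use \<epsilon> in simp)
    qed
    then show ?thesis by blast
  qed
  from L2_complete[where v = v, OF domain_lmeasurable v this]
  obtain w where w: "w \<in> L2 \<Omega>" "(\<lambda>n. L2_norm \<Omega> (\<lambda>x. v n x - w x)) \<longlonglongrightarrow> 0" .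
  have "(\<lambda>n. sqrt (C * (L2_norm \<Omega> (\<lambda>x. v n x - w x))\<^sup>2)) \<longlonglongrightarrow> sqrt (C * 0\<^sup>2)"
    by (intro tendsto_intros w(2))
  then have "(\<lambda>n. sqrt (C * (L2_norm \<Omega> (\<lambda>x. v n x - w x))\<^sup>2)) \<longlonglongrightarrow> 0" by simp
  then have "(\<lambda>n. ip_norm wip (\<lambda>x. v n x - w x)) \<longlonglongrightarrow> 0"
  proof (rule tendsto_sandwich[rotated 2, OF tendsto_const])
    show "\<forall>\<^sub>F n in sequentially. ip_norm wip (\<lambda>x. v n x - w x) \<le> sqrt (C * (L2_norm \<Omega> (\<lambda>x. v n x - w x))\<^sup>2)"
      using c(3)[OF L2.diff_mem[OF v w(1)]] by (simp add: ip_norm_def)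
    show "\<forall>\<^sub>F n in sequentially. 0 \<le> ip_norm wip (\<lambda>x. v n x - w x)"
      using W.ip_nonneg[OF L2.diff_mem[OF v w(1)]] by (simp add: ip_norm_def)
  qed
  with w show thesis by (rule that)
qed

end

section \<open>Completeness of the maximizers\<close>

locale weighted_maximizers = weighted_domain +
  fixes \<mu> :: real and j :: "nat \<Rightarrow> R3 \<Rightarrow> R3"
  assumes mu_pos: "0 < \<mu>" and maximizers: "successive_maximizers \<mu> \<Omega> \<eta> j"
begin

abbreviation energy :: "(R3 \<Rightarrow> R3) \<Rightarrow> real" where
  "energy v \<equiv> L2_inner \<Omega> (A_op \<mu> \<Omega> v) v"

lemma maximizer:
  assumes "1 \<le> n"
  shows "j n \<in> H_L \<Omega>" "\<And>m. 1 \<le> m \<Longrightarrow> m < n \<Longrightarrow> wip (j n) (j m) = 0" "wip (j n) (j n) = 1"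
    "\<And>v. v \<in> H_L \<Omega> \<Longrightarrow> (\<And>m. 1 \<le> m \<Longrightarrow> m < n \<Longrightarrow> wip v (j m) = 0) \<Longrightarrow> wip v v = 1 \<Longrightarrow> energy v \<le> energy (j n)"
proof -
  have *: "is_arg_max energy (\<lambda>v. v \<in> H_L_n \<Omega> \<eta> j n \<and> eta_norm \<Omega> \<eta> v = 1) (j n)"
    using maximizers assms unfolding successive_maximizers_def by blast
  then have "j n \<in> H_L_n \<Omega> \<eta> j n" "eta_norm \<Omega> \<eta> (j n) = 1"
    by (auto simp: is_arg_max_def)
  then show "j n \<in> H_L \<Omega>" "\<And>m. 1 \<le> m \<Longrightarrow> m < n \<Longrightarrow> wip (j n) (j m) = 0" "wip (j n) (j n) = 1"
    by (auto simp: H_L_n_def wip_alt eta_norm_eq ip_norm_def)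
  fix v assume "v \<in> H_L \<Omega>" "\<And>m. 1 \<le> m \<Longrightarrow> m < n \<Longrightarrow> wip v (j m) = 0" "wip v v = 1"
  then have "v \<in> H_L_n \<Omega> \<eta> j n" "eta_norm \<Omega> \<eta> v = 1"
    by (auto simp: H_L_n_def wip_alt eta_norm_eq ip_norm_def)
  with * show "energy v \<le> energy (j n)" by (auto simp: is_arg_max_def not_less)
qed

lemma j_L2: "1 \<le> n \<Longrightarrow> j n \<in> L2 \<Omega>"
  using maximizer(1) H_L_subset_L2 by blast

lemma j_orthonormal: "1 \<le> m \<Longrightarrow> 1 \<le> n \<Longrightarrow> wip (j m) (j n) = (if m = n then 1 else 0)"
  using maximizer(2)[of m n] maximizer(2)[of n m] maximizer(3)[of n] W.ip_commute[OF j_L2 j_L2]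
  by (cases m n rule: linorder_cases) auto

section \<open>Bessel's inequality and decay of the energies\<close>

lemma Bessel_j:
  assumes "u \<in> L2 \<Omega>"
  shows "(\<Sum>n\<in>{1..N}. (wip u (j n))\<^sup>2) \<le> wip u u"
  using W.Bessel_inequality[of "{1..N}" j u] assms j_L2 by (simp add: j_orthonormal)

lemma summable_coefficients:
  assumes "u \<in> L2 \<Omega>"
  shows "summable (\<lambda>n. (wip u (j (Suc n)))\<^sup>2)"
proof (rule summableI_nonneg_bounded)
  show "(\<Sum>i<n. (wip u (j (Suc i)))\<^sup>2) \<le> wip u u" for n
    using Bessel_j[OF assms, of n] sum.reindex[of Suc "{..<n}" "\<lambda>n. (wip u (j n))\<^sup>2"]
    by (simp add: image_Suc_lessThan)
qed simp

lemma coefficients_tendsto_zero: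
  assumes "u \<in> L2 \<Omega>"
  shows "(\<lambda>n. wip u (j (Suc n))) \<longlonglongrightarrow> 0"
  using summable_LIMSEQ_zero[OF summable_coefficients[OF assms]] by (simp add: power_tendsto_0_iff)

text \<open>Testing the Newton kernel against \<open>j n\<close> is a Fourier coefficient, so that \<open>A (j n)\<close> tends
  to \<open>0\<close> pointwise by Bessel's inequality, and boundedly since the kernel is uniformly in \<open>L2\<close>.\<close>

lemma A_op_maximizers_tendsto:
  obtains B where "\<And>x. (\<lambda>n. A_op \<mu> \<Omega> (j (Suc n)) x) \<longlonglongrightarrow> 0"
    "\<And>x n. norm (A_op \<mu> \<Omega> (j (Suc n)) x) \<le> B"
proof -
  obtain c C where c: "0 < c" "AE x in lebesgue_on \<Omega>. c \<le> \<eta> x" "AE x in lebesgue_on \<Omega>. \<bar>\<eta> x\<bar> \<le> C"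
    "\<eta> \<in> borel_measurable (lebesgue_on \<Omega>)"
    using Linf_plusE[OF weight] .
  obtain D where D: "\<And>x. (\<lambda>y. 1 / norm (x - y)) \<in> L2 \<Omega>"
    "\<And>x. (L2_norm \<Omega> (\<lambda>y. 1 / norm (x - y)))\<^sup>2 \<le> D"
    using newton_kernel_L2 by blast
  \<comment> \<open>Division by \<open>\<eta>\<close> cancels the weight in \<open>wip\<close>: the
    component along \<open>b\<close> of the Newton potential of \<open>v\<close> at \<open>x\<close>
    is the weighted inner product of \<open>h x b\<close> with \<open>v\<close>. As
    \<open>\<eta>\<close> is bounded below, \<open>h x b\<close> is again in
    \<open>L2\<close>.\<close>
  define h where "h x b y = (1 / \<eta> y) *\<^sub>R ((1 / norm (x - y)) *\<^sub>R b)" for x b y :: R3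
  have kb: "(\<lambda>y. (1 / norm (x - y)) *\<^sub>R b) \<in> L2 \<Omega>" for x b :: R3
  proof -
    have eq: "(\<lambda>y. (norm ((1 / norm (x - y)) *\<^sub>R b))\<^sup>2) = (\<lambda>y. (norm b)\<^sup>2 * (norm (1 / norm (x - y)))\<^sup>2)"
      by (simp add: power_divide)
    have "integrable (lebesgue_on \<Omega>) (\<lambda>y. (norm ((1 / norm (x - y)) *\<^sub>R b))\<^sup>2)"
      unfolding eq by (intro integrable_mult_right L2D(2) D(1))
    then show ?thesis using L2D(1)[OF D(1)[of x]] by (simp add: L2_def)
  qed
  have inv: "(\<lambda>y. 1 / \<eta> y) \<in> borel_measurable (lebesgue_on \<Omega>)" "AE y in lebesgue_on \<Omega>. \<bar>1 / \<eta> y\<bar> \<le> 1 / c"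
  proof -
    show "AE y in lebesgue_on \<Omega>. \<bar>1 / \<eta> y\<bar> \<le> 1 / c"
      using c(2) by eventually_elim (use c(1) in \<open>auto simp: frac_le\<close>)
  qed (use c(4) in measurable)
  have h: "h x b \<in> L2 \<Omega>" for x b
    unfolding h_def using L2_mult_bounded[OF kb inv] .
  have hip: "wip (h x b) v = (LINT y|lebesgue_on \<Omega>. ((1 / norm (x - y)) *\<^sub>R b) \<bullet> v y)" if "v \<in> L2 \<Omega>" for x b v
  proof -
    have "AE y in lebesgue_on \<Omega>. \<eta> y * (h x b y \<bullet> v y) = ((1 / norm (x - y)) *\<^sub>R b) \<bullet> v y"
      using c(2) by eventually_elim (use c(1) in \<open>simp add: h_def\<close>)
    then show ?thesis
      unfolding wip_eq_integral
      by (intro integral_cong_AE borel_measurable_times borel_measurable_inner c(4) L2D(1)[OF h] L2D(1)[OF kb] L2D(1)[OF that])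
  qed
  have comp: "A_op \<mu> \<Omega> (j (Suc n)) x \<bullet> b = (\<mu> / (4 * pi)) * wip (h x b) (j (Suc n))" for n x b
  proof -
    have jL: "j (Suc n) \<in> L2 \<Omega>" by (rule j_L2) simp
    have "integrable (lebesgue_on \<Omega>) (\<lambda>y. (1 / norm (x - y)) *\<^sub>R j (Suc n) y)"
    proof (rule Bochner_Integration.integrable_bound)
      show "integrable (lebesgue_on \<Omega>) (\<lambda>y. (norm (1 / norm (x - y)))\<^sup>2 + (norm (j (Suc n) y))\<^sup>2)"
        by (intro Bochner_Integration.integrable_add L2D(2) D(1) jL)
      show "(\<lambda>y. (1 / norm (x - y)) *\<^sub>R j (Suc n) y) \<in> borel_measurable (lebesgue_on \<Omega>)"
        by (intro borel_measurable_scaleR L2D(1) D(1) jL)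
      have "norm ((1 / norm (x - y)) *\<^sub>R j (Suc n) y) \<le> (norm (1 / norm (x - y)))\<^sup>2 + (norm (j (Suc n) y))\<^sup>2" for y
        using mult_le_sum_squares[of "norm (1 / norm (x - y))" "norm (j (Suc n) y)"] by simp
      then show "AE y in lebesgue_on \<Omega>. norm ((1 / norm (x - y)) *\<^sub>R j (Suc n) y)
          \<le> norm ((norm (1 / norm (x - y)))\<^sup>2 + (norm (j (Suc n) y))\<^sup>2)"
        by simp
    qed
    then have "(LINT y|lebesgue_on \<Omega>. (1 / norm (x - y)) *\<^sub>R j (Suc n) y) \<bullet> b =
       (LINT y|lebesgue_on \<Omega>. ((1 / norm (x - y)) *\<^sub>R j (Suc n) y) \<bullet> b)"
      by (intro integral_inner_left[symmetric])
    then show ?thesis by (simp add: A_op_def hip[OF jL] inner_commute)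
  qed
  have nb: "norm (A_op \<mu> \<Omega> (j (Suc n)) x) \<le> (\<Sum>b\<in>Basis. (\<mu> / (4 * pi)) * \<bar>wip (h x b) (j (Suc n))\<bar>)" for n x
    using norm_le_l1[of "A_op \<mu> \<Omega> (j (Suc n)) x"] mu_pos by (simp add: comp abs_mult)
  have lim: "(\<lambda>n. A_op \<mu> \<Omega> (j (Suc n)) x) \<longlonglongrightarrow> 0" for x
  proof (rule Lim_null_comparison)
    show "\<forall>\<^sub>F n in sequentially. norm (A_op \<mu> \<Omega> (j (Suc n)) x)
        \<le> (\<Sum>b\<in>Basis. (\<mu> / (4 * pi)) * \<bar>wip (h x b) (j (Suc n))\<bar>)"
      using nb by simp
    have "(\<lambda>n. \<Sum>b\<in>Basis. (\<mu> / (4 * pi)) * \<bar>wip (h x b) (j (Suc n))\<bar>) \<longlonglongrightarrow> (\<Sum>b\<in>(Basis::R3 set). (\<mu> / (4 * pi)) * \<bar>0\<bar>)"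
      by (intro tendsto_sum tendsto_mult tendsto_const tendsto_rabs coefficients_tendsto_zero h)
    then show "(\<lambda>n. \<Sum>b\<in>Basis. (\<mu> / (4 * pi)) * \<bar>wip (h x b) (j (Suc n))\<bar>) \<longlonglongrightarrow> 0" by simp
  qed
  \<comment> \<open>One of the two factors \<open>1 / \<eta> y\<close> is absorbed by the weight,
    the other is at most \<open>1 / c\<close>; what remains is the square of the kernel, bounded
    uniformly in \<open>x\<close>.\<close>
  have hb: "wip (h x b) (h x b) \<le> (1 / c) * D" if b: "norm b = 1" for x b
  proof -
    have "wip (h x b) (h x b) \<le> (LINT y|lebesgue_on \<Omega>. (1 / c) * (norm (1 / norm (x - y)))\<^sup>2)"
      unfolding wip_eq_integral
    proof (rule integral_mono_AE)
      show "integrable (lebesgue_on \<Omega>) (\<lambda>y. \<eta> y * (h x b y \<bullet> h x b y))"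
        using L2_inner_integrable[OF weight_L2[OF h[of x b]] h[of x b]] by simp
      show "integrable (lebesgue_on \<Omega>) (\<lambda>y. (1 / c) * (norm (1 / norm (x - y)))\<^sup>2)"
        by (intro integrable_mult_right L2D(2) D(1))
      show "AE y in lebesgue_on \<Omega>. \<eta> y * (h x b y \<bullet> h x b y) \<le> (1 / c) * (norm (1 / norm (x - y)))\<^sup>2"
        using c(2)
      proof eventually_elim
        case (elim y)
        then have e: "0 < \<eta> y" using c(1) by simp
        have "h x b y \<bullet> h x b y = (1 / \<eta> y)\<^sup>2 * (norm (1 / norm (x - y)))\<^sup>2"
          using b by (simp add: h_def power2_norm_eq_inner[symmetric] power_divide norm_divide power_mult_distrib)
        then have "\<eta> y * (h x b y \<bullet> h x b y) = (1 / \<eta> y) * (norm (1 / norm (x - y)))\<^sup>2"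
          using e by (simp add: power2_eq_square)
        also have "\<dots> \<le> (1 / c) * (norm (1 / norm (x - y)))\<^sup>2"
          using e elim c(1) by (intro mult_right_mono frac_le) auto
        finally show ?case .
      qed
    qed
    also have "\<dots> = (1 / c) * (L2_norm \<Omega> (\<lambda>y. 1 / norm (x - y)))\<^sup>2"
      by (simp add: L2_norm_power2)
    also have "\<dots> \<le> (1 / c) * D"
      using c(1) D(2) by (intro mult_left_mono) auto
    finally show ?thesis .
  qed
  have "norm (A_op \<mu> \<Omega> (j (Suc n)) x) \<le> (\<Sum>b\<in>(Basis::R3 set). (\<mu> / (4 * pi)) * sqrt ((1 / c) * D))" for x n
  proof (rule order_trans[OF nb], intro sum_mono mult_left_mono)
    fix b :: R3 assume b: "b \<in> Basis"
    have "(wip (h x b) (j (Suc n)))\<^sup>2 \<le> wip (h x b) (h x b) * wip (j (Suc n)) (j (Suc n))"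
      by (intro W.Cauchy_Schwarz_square h j_L2) simp
    also have "\<dots> \<le> (1 / c) * D" using hb[of b x] b by (simp add: j_orthonormal)
    finally show "\<bar>wip (h x b) (j (Suc n))\<bar> \<le> sqrt ((1 / c) * D)"
      by (metis real_sqrt_abs real_sqrt_le_iff)
  qed (use mu_pos in simp)
  with lim show thesis by (rule that)
qed

text \<open>This does the work of compactness of A. On a domain of finite measure the constant bound
  dominates, so the fields \<open>A (j n)\<close> tend to 0 in norm, while the \<open>j n\<close>
  stay bounded in \<open>L2\<close> because the weight is bounded below.\<close>

lemma energy_tendsto_zero: "(\<lambda>n. energy (j (Suc n))) \<longlonglongrightarrow> 0"
proof -
  obtain B where B: "\<And>x. (\<lambda>n. A_op \<mu> \<Omega> (j (Suc n)) x) \<longlonglongrightarrow> 0"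
    "\<And>x n. norm (A_op \<mu> \<Omega> (j (Suc n)) x) \<le> B"
    using A_op_maximizers_tendsto by blast
  obtain c C where c: "0 < c" "\<And>u. u \<in> L2 \<Omega> \<Longrightarrow> c * (L2_norm \<Omega> u)\<^sup>2 \<le> wip u u"
    "\<And>u. u \<in> L2 \<Omega> \<Longrightarrow> wip u u \<le> C * (L2_norm \<Omega> u)\<^sup>2"
    by (rule wip_bounds) blast
  interpret finite_measure "lebesgue_on \<Omega>"
    using domain_lmeasurable by (rule finite_measure_lebesgue_on)
  have jL: "j (Suc n) \<in> L2 \<Omega>" for n by (rule j_L2) simp
  have bnd: "norm ((norm (A_op \<mu> \<Omega> (j (Suc n)) x))\<^sup>2) \<le> B\<^sup>2" for n x
    using B(2)[of n x] by (simp add: power_mono)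
  have m: "(\<lambda>x. (norm (A_op \<mu> \<Omega> (j (Suc n)) x))\<^sup>2) \<in> borel_measurable (lebesgue_on \<Omega>)" for n
    using A_op_measurable[OF jL[of n]] by measurable
  have "(\<lambda>n. LINT x|lebesgue_on \<Omega>. (norm (A_op \<mu> \<Omega> (j (Suc n)) x))\<^sup>2) \<longlonglongrightarrow> (LINT x|lebesgue_on \<Omega>. 0)"
  proof (rule integral_dominated_convergence[where w = "\<lambda>_. B\<^sup>2"])
    show "AE x in lebesgue_on \<Omega>. (\<lambda>n. (norm (A_op \<mu> \<Omega> (j (Suc n)) x))\<^sup>2) \<longlonglongrightarrow> 0"
      using tendsto_power[OF tendsto_norm[OF B(1)], of _ 2] by simp
  qed (use m bnd in auto)
  then have n0: "(\<lambda>n. L2_norm \<Omega> (A_op \<mu> \<Omega> (j (Suc n)))) \<longlonglongrightarrow> 0"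
    unfolding L2_norm_eq using tendsto_real_sqrt by fastforce
  have AL: "A_op \<mu> \<Omega> (j (Suc n)) \<in> L2 \<Omega>" for n
  proof -
    have "integrable (lebesgue_on \<Omega>) (\<lambda>x. (norm (A_op \<mu> \<Omega> (j (Suc n)) x))\<^sup>2)"
      by (rule integrable_const_bound[OF AE_I2[OF bnd] m])
    then show ?thesis using A_op_measurable[OF jL] by (simp add: L2_def)
  qed
  have "norm (energy (j (Suc n))) \<le> L2_norm \<Omega> (A_op \<mu> \<Omega> (j (Suc n))) * sqrt (1 / c)" for n
  proof -
    have "c * (L2_norm \<Omega> (j (Suc n)))\<^sup>2 \<le> 1"
      using c(2)[OF jL[of n]] by (simp add: j_orthonormal)
    then have "(L2_norm \<Omega> (j (Suc n)))\<^sup>2 \<le> 1 / c"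
      using c(1) by (simp add: field_simps)
    then have "L2_norm \<Omega> (j (Suc n)) \<le> sqrt (1 / c)"
      by (rule real_le_rsqrt)
    then show ?thesis
      using L2.Cauchy_Schwarz[OF AL[of n] jL[of n]]
      by (simp add: L2_norm_eq_ip_norm[symmetric]) (meson L2_norm_nonneg mult_left_mono order_trans)
  qed
  moreover have "(\<lambda>n. L2_norm \<Omega> (A_op \<mu> \<Omega> (j (Suc n))) * sqrt (1 / c)) \<longlonglongrightarrow> 0 * sqrt (1 / c)"
    by (intro tendsto_mult n0 tendsto_const)
  ultimately show ?thesis
    by (intro Lim_null_comparison[of "\<lambda>n. energy (j (Suc n))"]) auto
qed

lemma orthogonal_imp_zero:
  assumes v: "v \<in> H_L \<Omega>" and orth: "\<And>n. 1 \<le> n \<Longrightarrow> wip v (j n) = 0"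
  shows "wip v v = 0"
proof (rule ccontr)
  assume ne: "wip v v \<noteq> 0"
  have vL: "v \<in> L2 \<Omega>" using v H_L_subset_L2 by blast
  have pos: "0 < wip v v" using ne W.ip_nonneg[OF vL] by simp
  let ?s = "1 / sqrt (wip v v)"
  let ?u = "\<lambda>x. ?s *\<^sub>R v x"
  have u: "?u \<in> H_L \<Omega>" "?u \<in> L2 \<Omega>" using v H_L_scale L2_scale vL by blast+
  have uu: "wip ?u ?u = 1"
    using pos by (simp add: W.ip_scale W.ip_scale_right vL u)
  have "energy ?u \<le> energy (j (Suc n))" for n
    by (rule maximizer(4)) (use u uu in \<open>auto simp: W.ip_scale vL j_L2 orth\<close>)
  then have "energy ?u \<le> 0"
    by (intro LIMSEQ_le_const[OF energy_tendsto_zero]) auto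
  from A_op_nonpos_imp_zero[OF u(2) mu_pos this]
  have "AE x in lebesgue_on \<Omega>. \<eta> x * (?u x \<bullet> ?u x) = 0"
    by eventually_elim auto
  then have "wip ?u ?u = 0"
    unfolding wip_eq_integral by (rule integral_eq_zero_AE)
  with uu show False by simp
qed

text \<open>Pythagoras, read off from the residual of the zero function; hence the minus signs,
  which also fit the differences of residuals it is applied to.\<close>

lemma wip_sum_j:
  assumes "finite F" "\<And>n. n \<in> F \<Longrightarrow> 1 \<le> n"
  shows "wip (\<lambda>x. - (\<Sum>n\<in>F. c n *\<^sub>R j n x)) (\<lambda>x. - (\<Sum>n\<in>F. c n *\<^sub>R j n x)) = (\<Sum>n\<in>F. (c n)\<^sup>2)"
  using W.residual_expansion[of F j "\<lambda>x. 0" c] assms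
  by (simp add: j_L2 j_orthonormal L2_zero W.ip_zero)

lemma wip_residual:
  assumes "v \<in> L2 \<Omega>"
  shows "wip (\<lambda>x. v x - (\<Sum>n\<in>{1..N}. c n *\<^sub>R j n x)) (\<lambda>x. v x - (\<Sum>n\<in>{1..N}. c n *\<^sub>R j n x)) =
    wip v v - (\<Sum>n\<in>{1..N}. (wip v (j n))\<^sup>2) + (\<Sum>n\<in>{1..N}. (wip v (j n) - c n)\<^sup>2)"
  using W.residual_expansion[of "{1..N}" j v c] assms by (simp add: j_L2 j_orthonormal)

text \<open>By Bessel the residuals form a Cauchy sequence. Their limit lies in \<open>H_L\<close>
  and is orthogonal to every \<open>j k\<close>, since the residual itself is from index
  \<open>k\<close> on, so it has norm 0.\<close>

theorem residual_tendsto_zero: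
  assumes v: "v \<in> H_L \<Omega>"
  shows "(\<lambda>N. ip_norm wip (\<lambda>x. v x - (\<Sum>n\<in>{1..N}. wip v (j n) *\<^sub>R j n x))) \<longlonglongrightarrow> 0"
proof -
  define r where "r N x = v x - (\<Sum>n\<in>{1..N}. wip v (j n) *\<^sub>R j n x)" for N x
  define T where "T N = (\<Sum>n\<in>{1..N}. (wip v (j n))\<^sup>2)" for N
  have vL: "v \<in> L2 \<Omega>" using v H_L_subset_L2 by blast
  interpret H: semi_inner_space "H_L \<Omega>" wip
    using H_L_subset_L2 H_L_zero H_L_add H_L_scale by (rule W.semi_inner_subspace)
  have r: "r N \<in> H_L \<Omega>" for N
    unfolding r_def[abs_def] by (intro H.diff_mem v H.sum_mem maximizer(1)) simp
  then have rL: "r N \<in> L2 \<Omega>" for N using H_L_subset_L2 by blast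
  \<comment> \<open>The difference of two residuals is a block of the orthonormal expansion, so its
    squared norm is an increment of the convergent series \<open>T\<close>.\<close>
  have diff: "wip (\<lambda>x. r n x - r m x) (\<lambda>x. r n x - r m x) = T n - T m" if "m \<le> n" for m n
  proof -
    have eq: "{1..n} = {1..m} \<union> {m<..n}" using that by auto
    have "(\<lambda>x. r n x - r m x) = (\<lambda>x. - (\<Sum>k\<in>{m<..n}. wip v (j k) *\<^sub>R j k x))"
      unfolding r_def eq by (subst sum.union_disjoint) auto
    moreover have "T n - T m = (\<Sum>k\<in>{m<..n}. (wip v (j k))\<^sup>2)"
      unfolding T_def eq by (subst sum.union_disjoint) auto
    moreover have "1 \<le> k" if "k \<in> {m<..n}" for k using that by simp
    ultimately show ?thesis by (simp only: wip_sum_j[OF finite_greaterThanAtMost])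
  qed
  have sym: "wip (\<lambda>x. r n x - r m x) (\<lambda>x. r n x - r m x) = wip (\<lambda>x. r m x - r n x) (\<lambda>x. r m x - r n x)" for m n
    using W.ip_diff_self[OF rL rL, of n m] W.ip_diff_self[OF rL rL, of m n] W.ip_commute[OF rL rL, of n m] by simp
  have "T = (\<lambda>N. \<Sum>n<N. (wip v (j (Suc n)))\<^sup>2)"
  proof
    show "T N = (\<Sum>n<N. (wip v (j (Suc n)))\<^sup>2)" for N
      unfolding T_def using sum.reindex[of Suc "{..<N}" "\<lambda>n. (wip v (j n))\<^sup>2"] by (simp add: image_Suc_lessThan)
  qed
  then have "convergent T"
    using summable_coefficients[OF vL] by (simp add: summable_iff_convergent)
  then have CT: "Cauchy T" by (rule convergent_Cauchy)
  have "\<exists>N. \<forall>m\<ge>N. \<forall>n\<ge>N. wip (\<lambda>x. r m x - r n x) (\<lambda>x. r m x - r n x) < \<epsilon>" if "0 < \<epsilon>" for \<epsilon>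
  proof -
    obtain N where N: "\<And>m n. m \<ge> N \<Longrightarrow> n \<ge> N \<Longrightarrow> \<bar>T m - T n\<bar> < \<epsilon>"
      using CauchyD[OF CT \<open>0 < \<epsilon>\<close>] by auto
    have eq: "wip (\<lambda>x. r m x - r n x) (\<lambda>x. r m x - r n x) = \<bar>T m - T n\<bar>" for m n
    proof (cases "m \<le> n")
      case True
      then show ?thesis using diff[OF True] sym[of m n] W.ip_nonneg[OF W.diff_mem[OF rL[of n] rL[of m]]] by simp
    next
      case False
      then show ?thesis using diff[of n m] W.ip_nonneg[OF W.diff_mem[OF rL[of m] rL[of n]]] by simp
    qed
    show ?thesis unfolding eq using N by blast
  qed
  then obtain w where w: "w \<in> L2 \<Omega>" "(\<lambda>n. L2_norm \<Omega> (\<lambda>x. r n x - w x)) \<longlonglongrightarrow> 0"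
    "(\<lambda>n. ip_norm wip (\<lambda>x. r n x - w x)) \<longlonglongrightarrow> 0"
    by (rule wip_complete[where v = r, OF rL]) blast+
  have wH: "w \<in> H_L \<Omega>" by (rule H_L_closed[OF r w(1,2)])
  have w_orth: "wip w (j k) = 0" if k: "1 \<le> k" for k
  proof -
    have le: "\<bar>wip w (j k)\<bar> \<le> ip_norm wip (\<lambda>x. r n x - w x)" if n: "k \<le> n" for n
    proof -
      have "wip (r n) (j k) = wip v (j k) - (\<Sum>i\<in>{1..n}. wip v (j i) * wip (j i) (j k))"
      proof -
        have mem: "(\<lambda>x. \<Sum>i\<in>{1..n}. wip v (j i) *\<^sub>R j i x) \<in> L2 \<Omega>"
          by (intro W.sum_mem j_L2) simp
        have "wip (\<lambda>x. \<Sum>i\<in>{1..n}. wip v (j i) *\<^sub>R j i x) (j k) = (\<Sum>i\<in>{1..n}. wip v (j i) * wip (j i) (j k))"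
          by (rule W.ip_sum) (use k j_L2 in auto)
        then show ?thesis
          unfolding r_def[abs_def] W.ip_diff[OF vL mem j_L2[OF k]] by simp
      qed
      also have "(\<Sum>i\<in>{1..n}. wip v (j i) * wip (j i) (j k)) = (\<Sum>i\<in>{1..n}. if i = k then wip v (j k) else 0)"
        using k by (intro sum.cong) (auto simp: j_orthonormal)
      also have "\<dots> = wip v (j k)" using k n by simp
      finally have "wip (\<lambda>x. r n x - w x) (j k) = - wip w (j k)"
        using W.ip_diff[OF rL w(1) j_L2[OF k]] by simp
      moreover have "ip_norm wip (j k) = 1" using k by (simp add: ip_norm_def j_orthonormal)
      ultimately show ?thesis
        using W.Cauchy_Schwarz[OF W.diff_mem[OF rL[of n] w(1)] j_L2[OF k]] by simp
    qed
    have "\<bar>wip w (j k)\<bar> \<le> 0"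
      using le by (intro LIMSEQ_le_const[OF w(3)]) blast
    then show ?thesis by simp
  qed
  \<comment> \<open>The limit is only known to have norm 0; the triangle inequality removes it from
    the estimate.\<close>
  have ww: "ip_norm wip w = 0"
    using orthogonal_imp_zero[OF wH w_orth] by (simp add: ip_norm_def)
  have "ip_norm wip (r n) \<le> ip_norm wip (\<lambda>x. r n x - w x)" for n
    using W.norm_triangle[OF W.diff_mem[OF rL[of n] w(1)] w(1)] ww by simp
  then have "(\<lambda>n. ip_norm wip (r n)) \<longlonglongrightarrow> 0"
    using W.ip_nonneg[OF rL]
    by (intro tendsto_sandwich[OF _ _ tendsto_const w(3)]) (auto simp: ip_norm_def)
  then show ?thesis by (simp add: r_def[abs_def])
qed

end

section \<open>Bochner square integrable fields\<close>

lemma (in semi_inner_space) ip_tendsto: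
  assumes a: "\<And>m. a m \<in> V" "l \<in> V" "(\<lambda>m. ip_norm ip (\<lambda>x. a m x - l x)) \<longlonglongrightarrow> 0"
    and b: "\<And>m. b m \<in> V" "k \<in> V" "(\<lambda>m. ip_norm ip (\<lambda>x. b m x - k x)) \<longlonglongrightarrow> 0"
  shows "(\<lambda>m. ip (a m) (b m)) \<longlonglongrightarrow> ip l k"
proof -
  let ?N = "ip_norm ip"
  let ?A = "\<lambda>m x. a m x - l x" and ?B = "\<lambda>m x. b m x - k x"
  have A: "?A m \<in> V" and B: "?B m \<in> V" for m using a b diff_mem by blast+
  have "\<bar>ip (a m) (b m) - ip l k\<bar> \<le> ?N (?A m) * ?N (?B m) + ?N (?A m) * ?N k + ?N l * ?N (?B m)" for m
  proof -
    have "ip (a m) (b m) - ip l k = ip (?A m) (?B m) + ip (?A m) k + ip l (?B m)"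
      by (simp add: ip_diff ip_diff_right a b A B)
    then show ?thesis
      using Cauchy_Schwarz[OF A[of m] B[of m]] Cauchy_Schwarz[OF A[of m] b(2)] Cauchy_Schwarz[OF a(2) B[of m]]
      by linarith
  qed
  moreover have "(\<lambda>m. ?N (?A m) * ?N (?B m) + ?N (?A m) * ?N k + ?N l * ?N (?B m)) \<longlonglongrightarrow> 0 * 0 + 0 * ?N k + ?N l * 0"
    by (intro tendsto_add tendsto_mult tendsto_const a(3) b(3))
  ultimately have "(\<lambda>m. ip (a m) (b m) - ip l k) \<longlonglongrightarrow> 0"
    by (intro Lim_null_comparison[where f = "\<lambda>m. ip (a m) (b m) - ip l k"]) auto
  then show ?thesis by (simp add: LIM_zero_iff)
qed

text \<open>Completeness of Lebesgue measure. It is used for functions of time that are identified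
  only on almost every slice.\<close>

lemma borel_measurable_lebesgue_on_AE:
  fixes f g :: "'a::euclidean_space \<Rightarrow> 'b::euclidean_space"
  assumes S: "S \<in> sets lebesgue" and f: "f \<in> borel_measurable (lebesgue_on S)"
    and ae: "AE x in lebesgue_on S. f x = g x"
  shows "g \<in> borel_measurable (lebesgue_on S)"
proof -
  have "AE x in lebesgue. (if x \<in> S then f x else 0) = (if x \<in> S then g x else 0)"
    using ae S by (auto simp: AE_restrict_space_iff elim: eventually_mono)
  moreover have "(\<lambda>x. if x \<in> S then f x else 0) \<in> borel_measurable lebesgue"
    using f by (subst borel_measurable_if[OF S])
  ultimately have "(\<lambda>x. if x \<in> S then g x else 0) \<in> borel_measurable lebesgue"
    by (rule borel_measurable_AE[rotated])
  then show ?thesis by (subst (asm) borel_measurable_if[OF S])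
qed

text \<open>Values that are not attained have empty level sets, so the condition over all
  \<open>w\<close> agrees with the one over the range. This gives access to the closure properties
  of \<open>simple_function\<close>.\<close>

lemma simple_into_iff:
  "simple_into T X s \<longleftrightarrow> simple_function (lebesgue_on {0<..<T}) s \<and> s ` {0<..<T} \<subseteq> X"
proof -
  have pre: "s -` {w} \<inter> {0<..<T} = {t \<in> {0<..<T}. s t = w}" for w by auto
  have empty: "{t \<in> {0<..<T}. s t = w} \<in> sets lebesgue" if "w \<notin> s ` {0<..<T}" for w
  proof -
    have "{t \<in> {0<..<T}. s t = w} = {}" using that by auto
    then show ?thesis by (simp only: sets.empty_sets)
  qed
  have sets: "A \<in> sets (lebesgue_on {0<..<T}) \<longleftrightarrow> A \<in> sets lebesgue" if "A \<subseteq> {0<..<T}" for A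
    using that by (auto simp: sets_restrict_space_iff)
  have "simple_function (lebesgue_on {0<..<T}) s \<longleftrightarrow>
      finite (s ` {0<..<T}) \<and> (\<forall>w\<in>s ` {0<..<T}. {t \<in> {0<..<T}. s t = w} \<in> sets lebesgue)"
  proof -
    have sp: "space (lebesgue_on {0<..<T}) = {0<..<T}" by (simp add: space_restrict_space)
    have "s -` {w} \<inter> {0<..<T} \<in> sets (lebesgue_on {0<..<T}) \<longleftrightarrow> {t \<in> {0<..<T}. s t = w} \<in> sets lebesgue" for w
      unfolding pre by (rule sets) auto
    then show ?thesis unfolding simple_function_def sp by simp
  qed
  also have "(\<forall>w\<in>s ` {0<..<T}. {t \<in> {0<..<T}. s t = w} \<in> sets lebesgue) \<longleftrightarrow>
      (\<forall>w. {t \<in> {0<..<T}. s t = w} \<in> sets lebesgue)"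
    using empty by blast
  finally show ?thesis unfolding simple_into_def by blast
qed

lemma simple_function_pair_compose:
  assumes "simple_function M s" "simple_function M s'"
  shows "simple_function M (\<lambda>t. F (s t) (s' t))"
  using simple_function_compose[OF simple_function_Pair[OF assms], of "\<lambda>p. F (fst p) (snd p)"]
  by (simp add: comp_def)

lemma strongly_measurableE:
  assumes "strongly_measurable_into T \<Omega> X u"
  obtains s where "\<And>m. simple_function (lebesgue_on {0<..<T}) (s m)"
    "\<And>m t. t \<in> {0<..<T} \<Longrightarrow> s m t \<in> X"
    "AE t in lebesgue_on {0<..<T}. u t \<in> X \<and> (\<lambda>m. L2_norm \<Omega> (\<lambda>x. s m t x - u t x)) \<longlonglongrightarrow> 0"
proof -
  from assms obtain s where s: "\<And>m. simple_into T X (s m)"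
    "AE t in lebesgue_on {0<..<T}. (\<lambda>m. L2_norm \<Omega> (\<lambda>x. s m t x - u t x)) \<longlonglongrightarrow> 0"
    "AE t in lebesgue_on {0<..<T}. u t \<in> X"
    unfolding strongly_measurable_into_def by blast
  show thesis
  proof (rule that)
    show "AE t in lebesgue_on {0<..<T}. u t \<in> X \<and> (\<lambda>m. L2_norm \<Omega> (\<lambda>x. s m t x - u t x)) \<longlonglongrightarrow> 0"
      using s(2,3) by eventually_elim simp
    show "simple_function (lebesgue_on {0<..<T}) (s m)" for m
      using s(1)[of m] by (simp add: simple_into_iff)
    show "s m t \<in> X" if "t \<in> {0<..<T}" for m t
      using s(1)[of m] that unfolding simple_into_iff by blast
  qed
qed

lemma strongly_measurableI:
  assumes "\<And>m. simple_function (lebesgue_on {0<..<T}) (s m)"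
    and "\<And>m t. t \<in> {0<..<T} \<Longrightarrow> s m t \<in> X"
    and ae: "AE t in lebesgue_on {0<..<T}. u t \<in> X \<and> (\<lambda>m. L2_norm \<Omega> (\<lambda>x. s m t x - u t x)) \<longlonglongrightarrow> 0"
  shows "strongly_measurable_into T \<Omega> X u"
proof -
  have "AE t in lebesgue_on {0<..<T}. u t \<in> X" using ae by eventually_elim simp
  moreover have "AE t in lebesgue_on {0<..<T}. (\<lambda>m. L2_norm \<Omega> (\<lambda>x. s m t x - u t x)) \<longlonglongrightarrow> 0"
    using ae by eventually_elim simp
  moreover have "simple_into T X (s m)" for m
    using assms(1,2) by (auto simp: simple_into_iff)
  ultimately show ?thesis unfolding strongly_measurable_into_def by blast
qed

lemma AE_interval: "AE t in lebesgue_on {0<..<T::real}. t \<in> {0<..<T}"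
  by (rule AE_I2) (simp add: space_restrict_space)

text \<open>The source of measurability in time: a functional \<open>G\<close> that is sequentially
  continuous in the \<open>L2\<close> norm turns simple approximants into simple scalar functions,
  and almost everywhere limits of these are measurable.\<close>

lemma strongly_measurable_real:
  fixes G :: "(R3 \<Rightarrow> R3) \<Rightarrow> (R3 \<Rightarrow> R3) \<Rightarrow> real"
  assumes u: "strongly_measurable_into T \<Omega> X u" and v: "strongly_measurable_into T \<Omega> X v"
    and G: "\<And>a b l k. (\<And>m. a m \<in> X) \<Longrightarrow> (\<And>m. b m \<in> X) \<Longrightarrow> l \<in> X \<Longrightarrow> k \<in> X \<Longrightarrow>
        (\<lambda>m::nat. L2_norm \<Omega> (\<lambda>x. a m x - l x)) \<longlonglongrightarrow> 0 \<Longrightarrow>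
        (\<lambda>m. L2_norm \<Omega> (\<lambda>x. b m x - k x)) \<longlonglongrightarrow> 0 \<Longrightarrow> (\<lambda>m. G (a m) (b m)) \<longlonglongrightarrow> G l k"
  shows "(\<lambda>t. G (u t) (v t)) \<in> borel_measurable (lebesgue_on {0<..<T})"
proof -
  let ?M = "lebesgue_on {0<..<T}"
  obtain s where s: "\<And>m. simple_function ?M (s m)" "\<And>m t. t \<in> {0<..<T} \<Longrightarrow> s m t \<in> X"
    "AE t in ?M. u t \<in> X \<and> (\<lambda>m. L2_norm \<Omega> (\<lambda>x. s m t x - u t x)) \<longlonglongrightarrow> 0"
    using strongly_measurableE[OF u] by blast
  obtain r where r: "\<And>m. simple_function ?M (r m)" "\<And>m t. t \<in> {0<..<T} \<Longrightarrow> r m t \<in> X"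
    "AE t in ?M. v t \<in> X \<and> (\<lambda>m. L2_norm \<Omega> (\<lambda>x. r m t x - v t x)) \<longlonglongrightarrow> 0"
    using strongly_measurableE[OF v] by blast
  have "(\<lambda>t. G (s m t) (r m t)) \<in> borel_measurable ?M" for m
    using simple_function_pair_compose[OF s(1) r(1), of G m m] by (rule borel_measurable_simple_function)
  then have m: "(\<lambda>t. lim (\<lambda>m. G (s m t) (r m t))) \<in> borel_measurable ?M"
    by (rule borel_measurable_lim_metric)
  show ?thesis
  proof (rule borel_measurable_lebesgue_on_AE[OF _ m])
    show "AE t in ?M. lim (\<lambda>m. G (s m t) (r m t)) = G (u t) (v t)"
      using s(3) r(3) AE_interval[of T]
    proof eventually_elim
      case (elim t)
      then have "(\<lambda>m. G (s m t) (r m t)) \<longlonglongrightarrow> G (u t) (v t)"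
        using s(2) r(2) by (intro G) auto
      then show ?case by (rule limI)
    qed
  qed simp
qed

lemma bochnerD:
  assumes "u \<in> bochner_L2_H_L T \<Omega>"
  shows "strongly_measurable_into T \<Omega> (H_L \<Omega>) (\<lambda>t x. u (t, x))"
    "integrable (lebesgue_on {0<..<T}) (\<lambda>t. (L2_norm \<Omega> (\<lambda>x. u (t, x)))\<^sup>2)"
    "AE t in lebesgue_on {0<..<T}. (\<lambda>x. u (t, x)) \<in> H_L \<Omega>"
  using assms by (auto simp: bochner_L2_H_L_def curry_def strongly_measurable_into_def)

lemma bochnerI:
  assumes "strongly_measurable_into T \<Omega> (H_L \<Omega>) (\<lambda>t x. u (t, x))"
    "integrable (lebesgue_on {0<..<T}) (\<lambda>t. (L2_norm \<Omega> (\<lambda>x. u (t, x)))\<^sup>2)"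
  shows "u \<in> bochner_L2_H_L T \<Omega>"
  using assms by (auto simp: bochner_L2_H_L_def curry_def)

context bounded_open_domain
begin

lemma strongly_measurable_norm_square:
  assumes "strongly_measurable_into T \<Omega> (H_L \<Omega>) u"
  shows "(\<lambda>t. (L2_norm \<Omega> (u t))\<^sup>2) \<in> borel_measurable (lebesgue_on {0<..<T})"
proof -
  have "(\<lambda>t. L2_inner \<Omega> (u t) (u t)) \<in> borel_measurable (lebesgue_on {0<..<T})"
  proof (rule strongly_measurable_real[OF assms assms], rule L2.ip_tendsto)
  qed (use H_L_subset_L2 in \<open>auto simp: L2_norm_eq_ip_norm\<close>)
  then show ?thesis by (simp add: L2_norm_power2 L2_inner_def power2_norm_eq_inner)
qed

lemma strongly_measurable_add:
  assumes u: "strongly_measurable_into T \<Omega> (H_L \<Omega>) u" and v: "strongly_measurable_into T \<Omega> (H_L \<Omega>) v"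
  shows "strongly_measurable_into T \<Omega> (H_L \<Omega>) (\<lambda>t x. u t x + v t x)"
proof -
  let ?M = "lebesgue_on {0<..<T}"
  obtain s where s: "\<And>m. simple_function ?M (s m)" "\<And>m t. t \<in> {0<..<T} \<Longrightarrow> s m t \<in> H_L \<Omega>"
    "AE t in ?M. u t \<in> H_L \<Omega> \<and> (\<lambda>m. L2_norm \<Omega> (\<lambda>x. s m t x - u t x)) \<longlonglongrightarrow> 0"
    using strongly_measurableE[OF u] by blast
  obtain r where r: "\<And>m. simple_function ?M (r m)" "\<And>m t. t \<in> {0<..<T} \<Longrightarrow> r m t \<in> H_L \<Omega>"
    "AE t in ?M. v t \<in> H_L \<Omega> \<and> (\<lambda>m. L2_norm \<Omega> (\<lambda>x. r m t x - v t x)) \<longlonglongrightarrow> 0"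
    using strongly_measurableE[OF v] by blast
  show ?thesis
  proof (rule strongly_measurableI[where s = "\<lambda>m t x. s m t x + r m t x"])
    show "simple_function ?M (\<lambda>t x. s m t x + r m t x)" for m
      by (rule simple_function_pair_compose[OF s(1) r(1)])
    show "(\<lambda>x. s m t x + r m t x) \<in> H_L \<Omega>" if "t \<in> {0<..<T}" for m t
      using H_L_add[OF s(2)[OF that] r(2)[OF that]] .
    show "AE t in ?M. (\<lambda>x. u t x + v t x) \<in> H_L \<Omega> \<and>
        (\<lambda>m. L2_norm \<Omega> (\<lambda>x. s m t x + r m t x - (u t x + v t x))) \<longlonglongrightarrow> 0"
      using s(3) r(3) AE_interval[of T]
    proof eventually_elim
      case (elim t)
      then have mem: "u t \<in> L2 \<Omega>" "v t \<in> L2 \<Omega>" "s m t \<in> L2 \<Omega>" "r m t \<in> L2 \<Omega>" for m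
        using s(2) r(2) H_L_subset_L2 by blast+
      have "(\<lambda>m. L2_norm \<Omega> (\<lambda>x. s m t x + r m t x - (u t x + v t x))) \<longlonglongrightarrow> 0"
      proof (rule Lim_null_comparison)
        have "(\<lambda>m. L2_norm \<Omega> (\<lambda>x. s m t x - u t x) + L2_norm \<Omega> (\<lambda>x. r m t x - v t x)) \<longlonglongrightarrow> 0 + 0"
          using elim by (intro tendsto_add) auto
        then show "(\<lambda>m. L2_norm \<Omega> (\<lambda>x. s m t x - u t x) + L2_norm \<Omega> (\<lambda>x. r m t x - v t x)) \<longlonglongrightarrow> 0" by simp
        have "L2_norm \<Omega> (\<lambda>x. s m t x + r m t x - (u t x + v t x)) \<le>
            L2_norm \<Omega> (\<lambda>x. s m t x - u t x) + L2_norm \<Omega> (\<lambda>x. r m t x - v t x)" for m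
          using L2.norm_triangle[OF L2.diff_mem[OF mem(3,1)] L2.diff_mem[OF mem(4,2)], of m m]
          by (simp add: L2_norm_eq_ip_norm algebra_simps)
        then show "\<forall>\<^sub>F m in sequentially. norm (L2_norm \<Omega> (\<lambda>x. s m t x + r m t x - (u t x + v t x))) \<le>
            L2_norm \<Omega> (\<lambda>x. s m t x - u t x) + L2_norm \<Omega> (\<lambda>x. r m t x - v t x)"
          by simp
      qed
      then show ?case using elim H_L_add by auto
    qed
  qed
qed

lemma L2_norm_scale: "L2_norm \<Omega> (\<lambda>x. c *\<^sub>R v x) = \<bar>c\<bar> * L2_norm \<Omega> v" for v :: "R3 \<Rightarrow> R3"
  by (simp add: L2_norm_eq power_mult_distrib real_sqrt_mult)

lemma strongly_measurable_scale:
  assumes u: "strongly_measurable_into T \<Omega> (H_L \<Omega>) u"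
  shows "strongly_measurable_into T \<Omega> (H_L \<Omega>) (\<lambda>t x. c *\<^sub>R u t x)"
proof -
  let ?M = "lebesgue_on {0<..<T}"
  obtain s where s: "\<And>m. simple_function ?M (s m)" "\<And>m t. t \<in> {0<..<T} \<Longrightarrow> s m t \<in> H_L \<Omega>"
    "AE t in ?M. u t \<in> H_L \<Omega> \<and> (\<lambda>m. L2_norm \<Omega> (\<lambda>x. s m t x - u t x)) \<longlonglongrightarrow> 0"
    using strongly_measurableE[OF u] by blast
  show ?thesis
  proof (rule strongly_measurableI[where s = "\<lambda>m t x. c *\<^sub>R s m t x"])
    show "simple_function ?M (\<lambda>t x. c *\<^sub>R s m t x)" for m
      using simple_function_pair_compose[OF s(1)[of m] s(1)[of m], of "\<lambda>v _ x. c *\<^sub>R v x"] .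
    show "(\<lambda>x. c *\<^sub>R s m t x) \<in> H_L \<Omega>" if "t \<in> {0<..<T}" for m t
      using H_L_scale[OF s(2)[OF that]] .
    show "AE t in ?M. (\<lambda>x. c *\<^sub>R u t x) \<in> H_L \<Omega> \<and>
        (\<lambda>m. L2_norm \<Omega> (\<lambda>x. c *\<^sub>R s m t x - c *\<^sub>R u t x)) \<longlonglongrightarrow> 0"
      using s(3) AE_interval[of T]
    proof eventually_elim
      case (elim t)
      have "L2_norm \<Omega> (\<lambda>x. c *\<^sub>R s m t x - c *\<^sub>R u t x) = \<bar>c\<bar> * L2_norm \<Omega> (\<lambda>x. s m t x - u t x)" for m
        using L2_norm_scale[of c "\<lambda>x. s m t x - u t x"] by (simp add: scaleR_diff_right)
      moreover have "(\<lambda>m. \<bar>c\<bar> * L2_norm \<Omega> (\<lambda>x. s m t x - u t x)) \<longlonglongrightarrow> \<bar>c\<bar> * 0"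
        using elim by (intro tendsto_mult tendsto_const) auto
      ultimately show ?case using elim H_L_scale by simp
    qed
  qed
qed

lemma bochner_add:
  assumes u: "u \<in> bochner_L2_H_L T \<Omega>" and v: "v \<in> bochner_L2_H_L T \<Omega>"
  shows "(\<lambda>p. u p + v p) \<in> bochner_L2_H_L T \<Omega>"
proof (rule bochnerI)
  note sm = strongly_measurable_add[OF bochnerD(1)[OF u] bochnerD(1)[OF v]]
  show "strongly_measurable_into T \<Omega> (H_L \<Omega>) (\<lambda>t x. u (t, x) + v (t, x))" by (rule sm)
  show "integrable (lebesgue_on {0<..<T}) (\<lambda>t. (L2_norm \<Omega> (\<lambda>x. u (t, x) + v (t, x)))\<^sup>2)"
  proof (rule Bochner_Integration.integrable_bound)
    show "integrable (lebesgue_on {0<..<T})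
        (\<lambda>t. 2 * (L2_norm \<Omega> (\<lambda>x. u (t, x)))\<^sup>2 + 2 * (L2_norm \<Omega> (\<lambda>x. v (t, x)))\<^sup>2)"
      using bochnerD(2)[OF u] bochnerD(2)[OF v] by simp
    show "(\<lambda>t. (L2_norm \<Omega> (\<lambda>x. u (t, x) + v (t, x)))\<^sup>2) \<in> borel_measurable (lebesgue_on {0<..<T})"
      using strongly_measurable_norm_square[OF sm] .
    show "AE t in lebesgue_on {0<..<T}. norm ((L2_norm \<Omega> (\<lambda>x. u (t, x) + v (t, x)))\<^sup>2) \<le>
        norm (2 * (L2_norm \<Omega> (\<lambda>x. u (t, x)))\<^sup>2 + 2 * (L2_norm \<Omega> (\<lambda>x. v (t, x)))\<^sup>2)"
      using bochnerD(3)[OF u] bochnerD(3)[OF v]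
    proof eventually_elim
      case (elim t)
      then have "L2_norm \<Omega> (\<lambda>x. u (t, x) + v (t, x)) \<le> L2_norm \<Omega> (\<lambda>x. u (t, x)) + L2_norm \<Omega> (\<lambda>x. v (t, x))"
        using L2.norm_triangle H_L_subset_L2 by (auto simp: L2_norm_eq_ip_norm)
      then have "(L2_norm \<Omega> (\<lambda>x. u (t, x) + v (t, x)))\<^sup>2 \<le>
          (L2_norm \<Omega> (\<lambda>x. u (t, x)) + L2_norm \<Omega> (\<lambda>x. v (t, x)))\<^sup>2"
        by (intro power_mono) auto
      also have "\<dots> \<le> 2 * (L2_norm \<Omega> (\<lambda>x. u (t, x)))\<^sup>2 + 2 * (L2_norm \<Omega> (\<lambda>x. v (t, x)))\<^sup>2"
        using sum_squares_bound[of "L2_norm \<Omega> (\<lambda>x. u (t, x))" "L2_norm \<Omega> (\<lambda>x. v (t, x))"]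
        by (simp add: power2_sum)
      finally show ?case by simp
    qed
  qed
qed

lemma bochner_scale:
  assumes u: "u \<in> bochner_L2_H_L T \<Omega>"
  shows "(\<lambda>p. c *\<^sub>R u p) \<in> bochner_L2_H_L T \<Omega>"
proof (rule bochnerI)
  show "strongly_measurable_into T \<Omega> (H_L \<Omega>) (\<lambda>t x. c *\<^sub>R u (t, x))"
    by (rule strongly_measurable_scale[OF bochnerD(1)[OF u]])
  have "integrable (lebesgue_on {0<..<T}) (\<lambda>t. c\<^sup>2 * (L2_norm \<Omega> (\<lambda>x. u (t, x)))\<^sup>2)"
    using bochnerD(2)[OF u] by simp
  then show "integrable (lebesgue_on {0<..<T}) (\<lambda>t. (L2_norm \<Omega> (\<lambda>x. c *\<^sub>R u (t, x)))\<^sup>2)"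
    by (simp add: L2_norm_scale power_mult_distrib)
qed

text \<open>Simple scalar approximants of \<open>g\<close>, multiplied by the fixed field
  \<open>w\<close>, are simple functions with values on the line through \<open>w\<close>.\<close>

lemma bochner_product:
  assumes g: "g \<in> L2 {0<..<T}" and w: "w \<in> H_L \<Omega>"
  shows "(\<lambda>(t, x). g t *\<^sub>R w x) \<in> bochner_L2_H_L T \<Omega>"
proof (rule bochnerI)
  let ?M = "lebesgue_on {0<..<T}"
  obtain F where F: "\<And>i. simple_function ?M (F i)" "\<And>t. t \<in> space ?M \<Longrightarrow> (\<lambda>i. F i t) \<longlonglongrightarrow> g t"
    using borel_measurable_implies_sequence_metric[OF L2D(1)[OF g], of 0] by blast
  show "strongly_measurable_into T \<Omega> (H_L \<Omega>) (\<lambda>t x. case (t, x) of (t, x) \<Rightarrow> g t *\<^sub>R w x)"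
  proof (rule strongly_measurableI[where s = "\<lambda>m t x. F m t *\<^sub>R w x"])
    show "simple_function ?M (\<lambda>t x. F m t *\<^sub>R w x)" for m
      using simple_function_pair_compose[OF F(1)[of m] F(1)[of m], of "\<lambda>a _ x. a *\<^sub>R w x"] .
    show "AE t in ?M. (\<lambda>x. case (t, x) of (t, x) \<Rightarrow> g t *\<^sub>R w x) \<in> H_L \<Omega> \<and>
        (\<lambda>m. L2_norm \<Omega> (\<lambda>x. F m t *\<^sub>R w x - (case (t, x) of (t, x) \<Rightarrow> g t *\<^sub>R w x))) \<longlonglongrightarrow> 0"
    proof (rule AE_I2)
      fix t assume t: "t \<in> space ?M"
      have "L2_norm \<Omega> (\<lambda>x. F m t *\<^sub>R w x - g t *\<^sub>R w x) = \<bar>F m t - g t\<bar> * L2_norm \<Omega> w" for m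
        using L2_norm_scale[of "F m t - g t" w] by (simp add: scaleR_diff_left)
      moreover have "(\<lambda>m. \<bar>F m t - g t\<bar> * L2_norm \<Omega> w) \<longlonglongrightarrow> \<bar>g t - g t\<bar> * L2_norm \<Omega> w"
        by (intro tendsto_intros F(2) t)
      ultimately show "(\<lambda>x. case (t, x) of (t, x) \<Rightarrow> g t *\<^sub>R w x) \<in> H_L \<Omega> \<and>
        (\<lambda>m. L2_norm \<Omega> (\<lambda>x. F m t *\<^sub>R w x - (case (t, x) of (t, x) \<Rightarrow> g t *\<^sub>R w x))) \<longlonglongrightarrow> 0"
        using H_L_scale[OF w] by simp
    qed
  qed (use H_L_scale[OF w] in simp)
  have "integrable ?M (\<lambda>t. (L2_norm \<Omega> w)\<^sup>2 * (norm (g t))\<^sup>2)"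
    by (intro integrable_mult_right L2D(2) g)
  then show "integrable ?M (\<lambda>t. (L2_norm \<Omega> (\<lambda>x. case (t, x) of (t, x) \<Rightarrow> g t *\<^sub>R w x))\<^sup>2)"
    by (simp add: L2_norm_scale power_mult_distrib mult.commute)
qed

end

section \<open>Products of time and space bases\<close>

context weighted_domain
begin

lemma bochner_eta_inner_eq:
  "bochner_eta_inner T \<Omega> \<eta> u v = (LINT t|lebesgue_on {0<..<T}. wip (\<lambda>x. u (t, x)) (\<lambda>x. v (t, x)))"
  by (simp add: bochner_eta_inner_def wip_eq_integral)

lemma wip_measurable:
  assumes "u \<in> bochner_L2_H_L T \<Omega>" "v \<in> bochner_L2_H_L T \<Omega>"
  shows "(\<lambda>t. wip (\<lambda>x. u (t, x)) (\<lambda>x. v (t, x))) \<in> borel_measurable (lebesgue_on {0<..<T})"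
proof (rule strongly_measurable_real[OF bochnerD(1)[OF assms(1)] bochnerD(1)[OF assms(2)]])
  obtain c C where c: "0 < c" "\<And>u. u \<in> L2 \<Omega> \<Longrightarrow> c * (L2_norm \<Omega> u)\<^sup>2 \<le> wip u u"
    "\<And>u. u \<in> L2 \<Omega> \<Longrightarrow> wip u u \<le> C * (L2_norm \<Omega> u)\<^sup>2"
    by (rule wip_bounds) blast
  have wn: "(\<lambda>m. ip_norm wip (\<lambda>x. a m x - l x)) \<longlonglongrightarrow> 0"
    if "\<And>m. a m \<in> H_L \<Omega>" "l \<in> H_L \<Omega>" "(\<lambda>m::nat. L2_norm \<Omega> (\<lambda>x. a m x - l x)) \<longlonglongrightarrow> 0" for a l
  proof (rule Lim_null_comparison)
    have "(\<lambda>m. sqrt (C * (L2_norm \<Omega> (\<lambda>x. a m x - l x))\<^sup>2)) \<longlonglongrightarrow> sqrt (C * 0\<^sup>2)"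
      by (intro tendsto_intros that)
    then show "(\<lambda>m. sqrt (C * (L2_norm \<Omega> (\<lambda>x. a m x - l x))\<^sup>2)) \<longlonglongrightarrow> 0" by simp
    have mem: "(\<lambda>x. a m x - l x) \<in> L2 \<Omega>" for m
      using that H_L_subset_L2 by (intro L2.diff_mem) blast+
    have "norm (ip_norm wip (\<lambda>x. a m x - l x)) \<le> sqrt (C * (L2_norm \<Omega> (\<lambda>x. a m x - l x))\<^sup>2)" for m
      using c(3)[OF mem] W.ip_nonneg[OF mem] by (simp add: ip_norm_def)
    then show "\<forall>\<^sub>F m in sequentially. norm (ip_norm wip (\<lambda>x. a m x - l x)) \<le> sqrt (C * (L2_norm \<Omega> (\<lambda>x. a m x - l x))\<^sup>2)"
      by simp
  qed
  fix a b l k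
  assume "\<And>m. a m \<in> H_L \<Omega>" "\<And>m. b m \<in> H_L \<Omega>" "l \<in> H_L \<Omega>" "k \<in> H_L \<Omega>"
    "(\<lambda>m::nat. L2_norm \<Omega> (\<lambda>x. a m x - l x)) \<longlonglongrightarrow> 0" "(\<lambda>m. L2_norm \<Omega> (\<lambda>x. b m x - k x)) \<longlonglongrightarrow> 0"
  then show "(\<lambda>m. wip (a m) (b m)) \<longlonglongrightarrow> wip l k"
    using H_L_subset_L2 by (intro W.ip_tendsto wn) blast+
qed

lemma wip_integrable:
  assumes u: "u \<in> bochner_L2_H_L T \<Omega>" and v: "v \<in> bochner_L2_H_L T \<Omega>"
  shows "integrable (lebesgue_on {0<..<T}) (\<lambda>t. wip (\<lambda>x. u (t, x)) (\<lambda>x. v (t, x)))"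
proof -
  obtain c C where c: "0 < c" "\<And>u. u \<in> L2 \<Omega> \<Longrightarrow> c * (L2_norm \<Omega> u)\<^sup>2 \<le> wip u u"
    "\<And>u. u \<in> L2 \<Omega> \<Longrightarrow> wip u u \<le> C * (L2_norm \<Omega> u)\<^sup>2"
    by (rule wip_bounds) blast
  show ?thesis
  proof (rule Bochner_Integration.integrable_bound)
    show "integrable (lebesgue_on {0<..<T})
        (\<lambda>t. C * (L2_norm \<Omega> (\<lambda>x. u (t, x)))\<^sup>2 + C * (L2_norm \<Omega> (\<lambda>x. v (t, x)))\<^sup>2)"
      by (intro Bochner_Integration.integrable_add integrable_mult_right bochnerD(2) u v)
    show "AE t in lebesgue_on {0<..<T}. norm (wip (\<lambda>x. u (t, x)) (\<lambda>x. v (t, x))) \<le>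
        norm (C * (L2_norm \<Omega> (\<lambda>x. u (t, x)))\<^sup>2 + C * (L2_norm \<Omega> (\<lambda>x. v (t, x)))\<^sup>2)"
      using bochnerD(3)[OF u] bochnerD(3)[OF v]
    proof eventually_elim
      case (elim t)
      let ?u = "\<lambda>x. u (t, x)" and ?v = "\<lambda>x. v (t, x)"
      have m: "?u \<in> L2 \<Omega>" "?v \<in> L2 \<Omega>" using elim H_L_subset_L2 by blast+
      have "\<bar>wip ?u ?v\<bar> \<le> ip_norm wip ?u * ip_norm wip ?v" by (rule W.Cauchy_Schwarz[OF m])
      also have "\<dots> \<le> (ip_norm wip ?u)\<^sup>2 + (ip_norm wip ?v)\<^sup>2" by (rule mult_le_sum_squares)
      also have "\<dots> = wip ?u ?u + wip ?v ?v" by (simp add: W.norm_power2 m)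
      also have "\<dots> \<le> C * (L2_norm \<Omega> ?u)\<^sup>2 + C * (L2_norm \<Omega> ?v)\<^sup>2"
        by (intro add_mono c(3) m)
      finally show ?case by simp
    qed
  qed (rule wip_measurable[OF u v])
qed

lemma semi_inner_space_bochner: "semi_inner_space (bochner_L2_H_L T \<Omega>) (bochner_eta_inner T \<Omega> \<eta>)"
proof
  have "(\<lambda>(t, x). (0::real) *\<^sub>R (0::R3)) \<in> bochner_L2_H_L T \<Omega>"
    by (rule bochner_product[OF L2_zero H_L_zero])
  moreover have "(\<lambda>(t :: real, x :: R3). (0::real) *\<^sub>R (0::R3)) = (\<lambda>p. 0)" by auto
  ultimately show "(\<lambda>p. 0) \<in> bochner_L2_H_L T \<Omega>" by metis
  fix u v and c :: real
  assume u: "u \<in> bochner_L2_H_L T \<Omega>"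
  show "(\<lambda>p. c *\<^sub>R u p) \<in> bochner_L2_H_L T \<Omega>" by (rule bochner_scale[OF u])
  show "0 \<le> bochner_eta_inner T \<Omega> \<eta> u u"
    unfolding bochner_eta_inner_eq
    by (rule integral_nonneg_AE, use bochnerD(3)[OF u] in eventually_elim, use H_L_subset_L2 in \<open>blast intro: W.ip_nonneg\<close>)
  assume v: "v \<in> bochner_L2_H_L T \<Omega>"
  show "(\<lambda>p. u p + v p) \<in> bochner_L2_H_L T \<Omega>" by (rule bochner_add[OF u v])
  show "bochner_eta_inner T \<Omega> \<eta> u v = bochner_eta_inner T \<Omega> \<eta> v u"
    by (simp add: bochner_eta_inner_def inner_commute)
next
  let ?M = "lebesgue_on {0<..<T}"
  fix u v w
  assume u: "u \<in> bochner_L2_H_L T \<Omega>" and v: "v \<in> bochner_L2_H_L T \<Omega>" and w: "w \<in> bochner_L2_H_L T \<Omega>"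
  have "bochner_eta_inner T \<Omega> \<eta> (\<lambda>p. u p + v p) w =
      (LINT t|?M. wip (\<lambda>x. u (t, x)) (\<lambda>x. w (t, x)) + wip (\<lambda>x. v (t, x)) (\<lambda>x. w (t, x)))"
    unfolding bochner_eta_inner_eq
  proof (rule integral_cong_AE)
    show "AE t in ?M. wip (\<lambda>x. u (t, x) + v (t, x)) (\<lambda>x. w (t, x)) =
        wip (\<lambda>x. u (t, x)) (\<lambda>x. w (t, x)) + wip (\<lambda>x. v (t, x)) (\<lambda>x. w (t, x))"
      using bochnerD(3)[OF u] bochnerD(3)[OF v] bochnerD(3)[OF w]
      by eventually_elim (intro W.ip_add H_L_subset_L2[THEN subsetD])
    show "(\<lambda>t. wip (\<lambda>x. u (t, x) + v (t, x)) (\<lambda>x. w (t, x))) \<in> borel_measurable ?M"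
      using wip_measurable[OF bochner_add[OF u v] w] .
  qed (intro borel_measurable_add wip_measurable u v w)
  then show "bochner_eta_inner T \<Omega> \<eta> (\<lambda>p. u p + v p) w =
      bochner_eta_inner T \<Omega> \<eta> u w + bochner_eta_inner T \<Omega> \<eta> v w"
    by (simp add: bochner_eta_inner_eq wip_integrable u v w)
next
  fix u w :: "real \<times> R3 \<Rightarrow> R3" and c :: real
  assume u: "u \<in> bochner_L2_H_L T \<Omega>" and w: "w \<in> bochner_L2_H_L T \<Omega>"
  show "bochner_eta_inner T \<Omega> \<eta> (\<lambda>p. c *\<^sub>R u p) w = c * bochner_eta_inner T \<Omega> \<eta> u w"
    by (simp add: bochner_eta_inner_def mult.left_commute[of _ c])
qed

end

context weighted_maximizers
begin

text \<open>Only scalar factors leave the integrals, which is valid for arbitrary functions because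
  the integral of a non-integrable function is 0.\<close>

lemma bochner_eta_inner_products:
  "bochner_eta_inner T \<Omega> \<eta> (\<lambda>(t, x). g t *\<^sub>R v x) (\<lambda>(t, x). h t *\<^sub>R w x) = L2_inner {0<..<T} g h * wip v w"
proof -
  have "wip (\<lambda>x. g t *\<^sub>R v x) (\<lambda>x. h t *\<^sub>R w x) = (g t * h t) * wip v w" for t
  proof -
    have "wip (\<lambda>x. g t *\<^sub>R v x) (\<lambda>x. h t *\<^sub>R w x) = (LINT x|lebesgue_on \<Omega>. (g t * h t) * (\<eta> x * (v x \<bullet> w x)))"
      unfolding wip_eq_integral by (intro Bochner_Integration.integral_cong) auto
    then show ?thesis by (simp add: wip_eq_integral)
  qed
  then show ?thesis by (simp add: bochner_eta_inner_eq L2_inner_def)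
qed

text \<open>The coefficients \<open>a n\<close> of \<open>u\<close> in the \<open>j n\<close> are functions of time, which are then expanded in
  the basis \<open>f\<close>; by orthogonality the two errors add up slicewise.\<close>

lemma products_dense:
  assumes f: "fourier_basis T f" and u: "u \<in> bochner_L2_H_L T \<Omega>" and \<epsilon>: "0 < \<epsilon>"
  shows "\<exists>F c. finite F \<and> F \<subseteq> {1..} \<times> {1..} \<and>
    ip_norm (bochner_eta_inner T \<Omega> \<eta>) (\<lambda>p. u p - (\<Sum>i\<in>F. c i *\<^sub>R (case i of (k, n) \<Rightarrow> \<lambda>(t, x). f k t *\<^sub>R j n x) p)) < \<epsilon>"
proof -
  let ?M = "lebesgue_on {0<..<T}"
  let ?u = "\<lambda>t x. u (t, x)"
  define a where "a n t = wip (?u t) (j n)" for n t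
  define U where "U t = wip (?u t) (?u t)" for t
  \<comment> \<open>The coefficient \<open>a n\<close> is the slicewise inner product of
    \<open>u\<close> with the field \<open>j n\<close> taken constant in time, itself an element of
    the Bochner space; this gives its measurability.\<close>
  have one: "(\<lambda>t. 1) \<in> L2 {0<..<T}" by (rule L2_const) simp
  have am: "a n \<in> borel_measurable ?M" if "1 \<le> n" for n
    using wip_measurable[OF u bochner_product[OF one maximizer(1)[OF that]]] by (simp add: a_def[abs_def])
  have Ui: "integrable ?M U" unfolding U_def by (rule wip_integrable[OF u u])
  have uL: "AE t in ?M. ?u t \<in> L2 \<Omega>"
    using bochnerD(3)[OF u] by eventually_elim (use H_L_subset_L2 in blast)
  have aU: "AE t in ?M. (a n t)\<^sup>2 \<le> U t" if "1 \<le> n" for n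
    using uL
  proof eventually_elim
    case (elim t)
    show ?case using W.Cauchy_Schwarz_square[OF elim j_L2[OF that]] that
      by (simp add: a_def U_def j_orthonormal)
  qed
  have a2: "integrable ?M (\<lambda>t. (a n t)\<^sup>2)" if n: "1 \<le> n" for n
  proof (rule Bochner_Integration.integrable_bound[OF Ui])
    show "AE t in ?M. norm ((a n t)\<^sup>2) \<le> norm (U t)"
      using aU[OF n] by eventually_elim simp
  qed (use am[OF n] in measurable)
  have aL: "a n \<in> L2 {0<..<T}" if "1 \<le> n" for n
    using am[OF that] a2[OF that] by (simp add: L2_def)
  \<comment> \<open>The squared distance of the slice at \<open>t\<close> from the span of the first
    \<open>N\<close> fields. Any other coefficients add exactly the sum of their squared errors,
    which separates the truncation in space from the approximation in time.\<close>
  define E where "E N t = U t - (\<Sum>n\<in>{1..N}. (a n t)\<^sup>2)" for N t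
  have E_eq: "wip (\<lambda>x. ?u t x - (\<Sum>n\<in>{1..N}. c n *\<^sub>R j n x)) (\<lambda>x. ?u t x - (\<Sum>n\<in>{1..N}. c n *\<^sub>R j n x)) =
      E N t + (\<Sum>n\<in>{1..N}. (a n t - c n)\<^sup>2)" if "?u t \<in> L2 \<Omega>" for N t c
    unfolding wip_residual[OF that] by (simp add: E_def U_def a_def)
  have Ei: "integrable ?M (E N)" for N
    unfolding E_def using a2 by (intro Bochner_Integration.integrable_diff Ui Bochner_Integration.integrable_sum) auto
  have "(\<lambda>N. LINT t|?M. E N t) \<longlonglongrightarrow> (LINT t|?M. 0)"
  proof (rule integral_dominated_convergence[where w = U])
    show "AE t in ?M. (\<lambda>N. E N t) \<longlonglongrightarrow> 0"
      using bochnerD(3)[OF u] uL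
    proof eventually_elim
      case (elim t)
      let ?r = "\<lambda>N x. ?u t x - (\<Sum>n\<in>{1..N}. wip (?u t) (j n) *\<^sub>R j n x)"
      have "(\<lambda>N. (ip_norm wip (?r N))\<^sup>2) \<longlonglongrightarrow> 0\<^sup>2"
        by (intro tendsto_power residual_tendsto_zero elim)
      moreover have "(ip_norm wip (?r N))\<^sup>2 = E N t" for N
      proof -
        have "?r N \<in> L2 \<Omega>" using elim by (intro W.diff_mem W.sum_mem j_L2) auto
        moreover have "wip (?r N) (?r N) = E N t + (\<Sum>n\<in>{1..N}. (a n t - wip (?u t) (j n))\<^sup>2)"
          by (rule E_eq[OF elim(2)])
        ultimately show ?thesis by (simp add: W.norm_power2 a_def)
      qed
      ultimately have "(\<lambda>N. E N t) \<longlonglongrightarrow> 0\<^sup>2" by (simp only:)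
      then show ?case by simp
    qed
    show "AE t in ?M. norm (E N t) \<le> U t" for N
      using uL
    proof eventually_elim
      case (elim t)
      have "(\<Sum>n\<in>{1..N}. (a n t)\<^sup>2) \<le> U t"
        unfolding a_def U_def by (rule Bessel_j[OF elim])
      moreover have "0 \<le> (\<Sum>n\<in>{1..N}. (a n t)\<^sup>2)" by (simp add: sum_nonneg)
      ultimately show ?case by (simp add: E_def)
    qed
  qed (use Ei Ui in auto)
  then have "(\<lambda>N. LINT t|?M. E N t) \<longlonglongrightarrow> 0" by simp
  moreover have "0 < \<epsilon>\<^sup>2 / 2" using \<epsilon> by simp
  ultimately have "\<forall>\<^sub>F N in sequentially. (LINT t|?M. E N t) < \<epsilon>\<^sup>2 / 2"
    by (rule order_tendstoD(2))
  then obtain N where N: "(LINT t|?M. E N t) < \<epsilon>\<^sup>2 / 2"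
    unfolding eventually_sequentially by blast
  \<comment> \<open>Each of the \<open>N\<close> coefficients contributes less than
    \<open>\<delta>\<^sup>2\<close>, in total at most half of \<open>\<epsilon>\<^sup>2\<close>; the
    other half is the truncation error. Writing \<open>real N + 1\<close> keeps the denominator
    positive when \<open>N = 0\<close>.\<close>
  define \<delta> where "\<delta> = sqrt (\<epsilon>\<^sup>2 / (2 * (real N + 1)))"
  have \<delta>: "0 < \<delta>" "\<delta>\<^sup>2 = \<epsilon>\<^sup>2 / (2 * (real N + 1))" using \<epsilon> by (auto simp: \<delta>_def)
  have "\<exists>G c. finite G \<and> G \<subseteq> {1..} \<and>
      ip_norm (L2_inner {0<..<T}) (\<lambda>t. a n t - (\<Sum>k\<in>G. c k *\<^sub>R f k t)) < \<delta>" if "1 \<le> n" for n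
    using f aL[OF that] \<delta>(1) unfolding fourier_basis_def complete_orthogonal_system_def by blast
  then have "\<forall>n. \<exists>p. 1 \<le> n \<longrightarrow> finite (fst p) \<and> fst p \<subseteq> {1..} \<and>
      ip_norm (L2_inner {0<..<T}) (\<lambda>t. a n t - (\<Sum>k\<in>fst p. snd p k *\<^sub>R f k t)) < \<delta>"
    by force
  from choice[OF this] obtain P where P: "\<And>n. 1 \<le> n \<Longrightarrow> finite (fst (P n)) \<and> fst (P n) \<subseteq> {1..} \<and>
      ip_norm (L2_inner {0<..<T}) (\<lambda>t. a n t - (\<Sum>k\<in>fst (P n). snd (P n) k *\<^sub>R f k t)) < \<delta>"
    by blast
  define G where "G n = fst (P n)" for n
  define c where "c n = snd (P n)" for n
  have G: "finite (G n)" "G n \<subseteq> {1..}"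
    "ip_norm (L2_inner {0<..<T}) (\<lambda>t. a n t - (\<Sum>k\<in>G n. c n k *\<^sub>R f k t)) < \<delta>" if "1 \<le> n" for n
    using P[OF that] unfolding G_def c_def by blast+
  define b where "b n t = (\<Sum>k\<in>G n. c n k * f k t)" for n t
  interpret T: semi_inner_space "L2 {0<..<T}" "L2_inner {0<..<T} :: (real \<Rightarrow> real) \<Rightarrow> _"
    by (rule semi_inner_space_L2)
  have fL: "f k \<in> L2 {0<..<T}" if "1 \<le> k" for k
    using f that unfolding fourier_basis_def complete_orthogonal_system_def by auto
  have abL: "(\<lambda>t. a n t - b n t) \<in> L2 {0<..<T}" if "1 \<le> n" for n
    using T.diff_mem[OF aL[OF that] T.sum_mem[of "G n" f "c n"]] fL G(2)[OF that] by (auto simp: b_def)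
  have ab: "(LINT t|?M. (a n t - b n t)\<^sup>2) < \<delta>\<^sup>2" if n: "1 \<le> n" for n
  proof -
    have "ip_norm (L2_inner {0<..<T}) (\<lambda>t. a n t - b n t) < \<delta>"
      using G(3)[OF n] by (simp add: b_def)
    then have "L2_norm {0<..<T} (\<lambda>t. a n t - b n t) < \<delta>"
      by (simp add: L2_norm_eq_ip_norm)
    then have "(L2_norm {0<..<T} (\<lambda>t. a n t - b n t))\<^sup>2 < \<delta>\<^sup>2"
      by (intro power_strict_mono) auto
    then show ?thesis by (simp add: L2_norm_power2)
  qed
  \<comment> \<open>The sets \<open>G n\<close> depend on the space index, so the sum runs over
    \<open>n\<close> first; the flip restores the order \<open>(k, n)\<close> of the basis
    indices.\<close>
  define F where "F = (\<lambda>(n, k). (k, n)) ` (SIGMA n:{1..N}. G n)"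
  define C where "C = (\<lambda>(k, n). c n k)"
  have inj: "inj_on (\<lambda>(n, k). (k, n)) (SIGMA n:{1..N}. G n)" by (auto simp: inj_on_def)
  have sum_eq: "(\<Sum>i\<in>F. C i *\<^sub>R (case i of (k, n) \<Rightarrow> \<lambda>(t, x). f k t *\<^sub>R j n x) (t, x)) =
      (\<Sum>n\<in>{1..N}. b n t *\<^sub>R j n x)" for t x
  proof -
    have "(\<Sum>i\<in>F. C i *\<^sub>R (case i of (k, n) \<Rightarrow> \<lambda>(t, x). f k t *\<^sub>R j n x) (t, x)) =
        (\<Sum>(n, k)\<in>(SIGMA n:{1..N}. G n). c n k *\<^sub>R f k t *\<^sub>R j n x)"
      unfolding F_def by (subst sum.reindex[OF inj]) (auto simp: C_def case_prod_beta intro!: sum.cong)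
    also have "\<dots> = (\<Sum>n\<in>{1..N}. \<Sum>k\<in>G n. c n k *\<^sub>R f k t *\<^sub>R j n x)"
      using G(1) by (intro sum.Sigma[symmetric]) auto
    also have "\<dots> = (\<Sum>n\<in>{1..N}. b n t *\<^sub>R j n x)"
      by (simp add: b_def scaleR_sum_left)
    finally show ?thesis .
  qed
  have "bochner_eta_inner T \<Omega> \<eta> (\<lambda>p. u p - (\<Sum>i\<in>F. C i *\<^sub>R (case i of (k, n) \<Rightarrow> \<lambda>(t, x). f k t *\<^sub>R j n x) p))
      (\<lambda>p. u p - (\<Sum>i\<in>F. C i *\<^sub>R (case i of (k, n) \<Rightarrow> \<lambda>(t, x). f k t *\<^sub>R j n x) p)) < \<epsilon>\<^sup>2"
  proof -
    let ?w = "\<lambda>t x. ?u t x - (\<Sum>n\<in>{1..N}. b n t *\<^sub>R j n x)"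
    have mono: "AE t in ?M. wip (?w t) (?w t) = E N t + (\<Sum>n\<in>{1..N}. (a n t - b n t)\<^sup>2)"
      using uL by eventually_elim (rule E_eq)
    have ab2: "integrable ?M (\<lambda>t. (a n t - b n t)\<^sup>2)" if "1 \<le> n" for n
      using L2D(2)[OF abL[OF that]] by simp
    have Ri: "integrable ?M (\<lambda>t. E N t + (\<Sum>n\<in>{1..N}. (a n t - b n t)\<^sup>2))"
      using ab2 by (intro Bochner_Integration.integrable_add Ei Bochner_Integration.integrable_sum) auto
    have "(LINT t|?M. wip (?w t) (?w t)) = (LINT t|?M. E N t + (\<Sum>n\<in>{1..N}. (a n t - b n t)\<^sup>2))"
    proof (rule integral_cong_AE[OF _ _ mono])
      show Rm: "(\<lambda>t. E N t + (\<Sum>n\<in>{1..N}. (a n t - b n t)\<^sup>2)) \<in> borel_measurable ?M"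
        using Ri by (rule borel_measurable_integrable)
      \<comment> \<open>Measurability is inherited through the almost everywhere equality
        \<open>mono\<close> with an explicitly integrable function.\<close>
      show "(\<lambda>t. wip (?w t) (?w t)) \<in> borel_measurable ?M"
        by (rule borel_measurable_lebesgue_on_AE[OF _ Rm]) (use mono in \<open>auto elim: eventually_mono\<close>)
    qed
    also have "\<dots> = (LINT t|?M. E N t) + (\<Sum>n\<in>{1..N}. LINT t|?M. (a n t - b n t)\<^sup>2)"
      using ab2 by (subst Bochner_Integration.integral_add[OF Ei])
        (auto intro!: Bochner_Integration.integral_sum Bochner_Integration.integrable_sum)
    also have "(\<Sum>n\<in>{1..N}. LINT t|?M. (a n t - b n t)\<^sup>2) \<le> (\<Sum>n\<in>{1..N}. \<delta>\<^sup>2)"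
      using ab by (intro sum_mono less_imp_le) auto
    also have "(\<Sum>n\<in>{1..N}. \<delta>\<^sup>2) \<le> \<epsilon>\<^sup>2 / 2"
      using \<epsilon> by (simp add: \<delta>(2) field_simps)
    finally have "(LINT t|?M. wip (?w t) (?w t)) < \<epsilon>\<^sup>2" using N by simp
    then show ?thesis by (simp only: bochner_eta_inner_eq sum_eq)
  qed
  then have "ip_norm (bochner_eta_inner T \<Omega> \<eta>)
      (\<lambda>p. u p - (\<Sum>i\<in>F. C i *\<^sub>R (case i of (k, n) \<Rightarrow> \<lambda>(t, x). f k t *\<^sub>R j n x) p)) < \<epsilon>"
    unfolding ip_norm_def using \<epsilon> by (intro real_less_lsqrt) auto
  moreover have "finite F"
    unfolding F_def using G(1) by (intro finite_imageI finite_SigmaI) auto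
  moreover have "F \<subseteq> {1..} \<times> {1..}"
    unfolding F_def using G(2) by fastforce
  ultimately show ?thesis by blast
qed

theorem complete_basis_products:
  assumes f: "fourier_basis T f"
  shows "complete_basis (bochner_L2_H_L T \<Omega>) (bochner_eta_inner T \<Omega> \<eta>)
    ({1..} \<times> {1..}) (\<lambda>(k, n) (t, x). f k t *\<^sub>R j n x)"
proof -
  interpret B: semi_inner_space "bochner_L2_H_L T \<Omega>" "bochner_eta_inner T \<Omega> \<eta>"
    by (rule semi_inner_space_bochner)
  let ?e = "\<lambda>(k, n) (t, x). f k t *\<^sub>R j n x"
  have f': "f k \<in> L2 {0<..<T}" "L2_inner {0<..<T} (f k) (f k) \<noteq> 0" if "1 \<le> k" for k
    using f that by (auto simp: fourier_basis_def complete_orthogonal_system_def ip_norm_def)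
  have f_orth: "L2_inner {0<..<T} (f k) (f l) = 0" if "1 \<le> k" "1 \<le> l" "k \<noteq> l" for k l
    using f that by (auto simp: fourier_basis_def complete_orthogonal_system_def)
  have "complete_orthogonal_system (bochner_L2_H_L T \<Omega>) (bochner_eta_inner T \<Omega> \<eta>) ({1..} \<times> {1..}) ?e"
    unfolding complete_orthogonal_system_def
  proof (intro conjI ballI allI impI)
    fix i :: "nat \<times> nat" assume i: "i \<in> {1..} \<times> {1..}"
    then obtain k n where [simp]: "i = (k, n)" and kn: "1 \<le> k" "1 \<le> n" by auto
    show "?e i \<in> bochner_L2_H_L T \<Omega>"
      using bochner_product[OF f'(1)[OF kn(1)] maximizer(1)[OF kn(2)]] by simp
    show "ip_norm (bochner_eta_inner T \<Omega> \<eta>) (?e i) \<noteq> 0"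
      using f'(2) kn by (simp add: ip_norm_def bochner_eta_inner_products j_orthonormal)
    fix i' :: "nat \<times> nat" assume i': "i' \<in> {1..} \<times> {1..}" and ne: "i \<noteq> i'"
    then obtain k' n' where [simp]: "i' = (k', n')" and kn': "1 \<le> k'" "1 \<le> n'" by auto
    show "bochner_eta_inner T \<Omega> \<eta> (?e i) (?e i') = 0"
      using ne kn kn' f_orth[of k k'] by (auto simp: bochner_eta_inner_products j_orthonormal)
  qed (rule products_dense[OF f])
  then show ?thesis by (rule B.complete_basisI)
qed

end

theorem theorem5p2:
  fixes \<Omega> :: "(real ^ 3) set" and \<eta> :: "real ^ 3 \<Rightarrow> real" and \<mu>\<^sub>0 T :: real
    and j :: "nat \<Rightarrow> real ^ 3 \<Rightarrow> real ^ 3" and f :: "nat \<Rightarrow> real \<Rightarrow> real"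
  assumes "bounded_lipschitz_domain \<Omega>"
    and "\<mu>\<^sub>0 > 0"
    and "\<eta> \<in> Linf_plus \<Omega>"
    and "successive_maximizers \<mu>\<^sub>0 \<Omega> \<eta> j"
    and "0 < T"
    and "fourier_basis T f"
  shows "complete_basis (bochner_L2_H_L T \<Omega>) (bochner_eta_inner T \<Omega> \<eta>)
           ({1..} \<times> {1..}) (\<lambda>(k, n) (t, x). f k t *\<^sub>R j n x)"
proof -
  interpret weighted_maximizers \<Omega> \<eta> \<mu>\<^sub>0 j
    using assms(1-4) by unfold_locales (auto simp: bounded_lipschitz_domain_def)
  show ?thesis using assms(6) by (rule complete_basis_products)
qed

end
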